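(* Let $M>0$ and $T\ge0$. Let $(\mathbf f^*,\boldsymbol\chi^* )\in\mathcal A_{\rm c.m.}\times\mathcal A_{\rm q.m.}$ be a minimizer of $$\mathcal F_{\min}(M)=\inf\{\mathcal F(\mathbf f,\boldsymbol\chi): (\mathbf f,\boldsymbol\chi)\in\mathcal A_{\rm c.m.}\times\mathcal A_{\rm q.m.},\ \mathcal M(\mathbf f)=M\}$$ satisfying, for some $\mu>0$ and all $j\in\mathbb N$, $$f_j^*(y,v)=\tilde\beta\big(\mu-\tfrac{|v|^2}{2}-\lambda_j^*(y)\big),\qquad \Big(-\tfrac{\partial_z^2}{2}+(U_{\rho_{(\mathbf f^*,\boldsymbol\chi^* )}}+V_{\rm ext})(y,\cdot)\Big)\chi_j^*(y,\cdot)=\lambda_j^*(y)\chi_j^*(y,\cdot),$$ where $\lambda_j^*(y)$ is the $j$-th eigenvalue of $-\frac{\partial_z^2}{2}+(U_{\rho_{(\mathbf f^*,\boldsymbol\chi^* )}}+V_{\rm ext})(y,\cdot)$ with form domain $H^1_0(0,1)$ (such a minimizer exists, and all minimizers of $\mathcal F_{\min}(M)$ have the same potential $U_{\rho_{(\mathbf f^*,\boldsymbol\chi^* )}}$). Then $(\mathbf f^*,\boldsymbol\chi^* )$ is stable under the Vlasov–Schrödinger–Poisson system in the following sense: for every $\epsilon>0$ there exists $\delta>0$ such that, whenever (i) $(\mathbf f_0,\boldsymbol\chi_0)\in\mathcal A_{\rm c.m.}\times\mathcal A_{\rm q.m.}$, $|\mathcal M(\mathbf f_0)-M|\le\delta$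 and $|\mathcal F(\mathbf f_0,\boldsymbol\chi_0)-\mathcal F(\mathbf f^*,\boldsymbol\chi^* )|\le\delta$; and (ii) $(\mathbf f(t),\boldsymbol\chi(t))$, $t\in\mathbb R$, is a unique global weak solution of the Vlasov–Schrödinger–Poisson system with initial data $(\mathbf f_0,\boldsymbol\chi_0)$, $\mathbf f(t)$ satisfies the specular-reflection boundary condition, and $\mathcal M(\mathbf f(t))=\mathcal M(\mathbf f_0)$ and $\mathcal F(\mathbf f(t),\boldsymbol\chi(t))=\mathcal F(\mathbf f_0,\boldsymbol\chi_0)$ for all $t\in\mathbb R$, one has $$\sup_{t\in\mathbb R}\big\|\nabla\big(U_{\rho_{(\mathbf f(t),\boldsymbol\chi(t))}}-U_{\rho_{(\mathbf f^*,\boldsymbol\chi^* )}}\big)\big\|_{L^2(\Omega)}^2\le\epsilon.$$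
   Context: Setting. $\omega\subset\mathbb R^2$ is a smooth bounded domain, $\Omega=\omega\times(0,1)$, and $x=(y,z)\in\omega\times(0,1)$. Functions are measurable, and identities between functions hold almost everywhere. Standing assumptions: $V_{\rm ext}\in C(\overline\Omega)\cap C^1(\Omega)$, $V_{\rm ext}\ge0$; $\beta:[0,1]\to[0,\infty)$ is strictly convex and differentiable with $\beta(0)=0$. Admissible classes. $\mathcal A_{\rm c.m.}$ is the set of sequences $\mathbf f=\{f_j\}_{j=1}^\infty\in\ell^1(\mathbb N;L^1(\omega\times\mathbb R^2))$ with $0\le f_j(y,v)\le1$ for all $j$ and $(y,v)$. $\mathcal A_{\rm q.m.}$ is the set of sequences $\boldsymbol\chi=\{\chi_j\}_{j=1}^\infty$ of functions $\chi_j:\Omega\to\mathbb C$ such that for all $y\in\omega$, $\chi_j(y,\cdot)\in H^1_0(0,1)$ and $\langle\chi_j(y,\cdot),\chi_k(y,\cdot)\rangle_{L^2(0,1)}=\delta_{jk}$ for all $j,k$. Densities and potentials. $\rho_{f}(y)=\int_{\mathbb R^2}f(y,v)\,dv$ and $\rho_{(\mathbf f,\boldsymbol\chi)}(x)=\sum_{j=1}^\infty\rho_{f_j}(y)|\chi_j(x)|^2$. For a density $\rho$ on $\Omega$, $U_\rho\in H^1_\omega(\Omega):=\{u\in H^1(\Omega):u|_{\partial\omega\times(0,1)}=0\}$ is the weak solution of $-\Delta U=\rho$ in $\Omega$, $U=0$ on $\partial\omega\times(0,1)$, $\partial_zU=0$ on $\omega\times\{0,1\}$, i.e. $\int_\Omega\nabla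 U\cdot\nabla\varphi\,dx=\int_\Omega\rho\varphi\,dx$ for all $\varphi\in H^1_\omega(\Omega)$; it exists and is unique for $\rho\in L^{6/5}(\Omega)$. Functionals (values in $[0,\infty]$): $\mathcal M(\mathbf f)=\sum_j\iint_{\omega\times\mathbb R^2}f_j\,dydv$, $$\mathcal E(\mathbf f,\boldsymbol\chi)=\sum_{j}\iint_{\omega\times\mathbb R^2}\Big(\tfrac{|v|^2}2+\tfrac12\|\partial_z\chi_j(y,\cdot)\|_{L^2(0,1)}^2\Big)f_j\,dydv+\sum_j\iint_{\Omega\times\mathbb R^2}V_{\rm ext}|\chi_j|^2f_j\,dxdv+\tfrac12\int_\Omega|\nabla U_{\rho_{(\mathbf f,\boldsymbol\chi)}}|^2dx,$$ $\mathcal C_\beta(\mathbf f)=\sum_j\iint_{\omega\times\mathbb R^2}\beta(f_j)\,dydv$, and $\mathcal F=\mathcal F_{T,\beta}=\mathcal E+T\mathcal C_\beta$ (with $\mathcal F=+\infty$ whenever one of its terms is infinite or undefined). The function $\tilde\beta$: if $T=0$, $\tilde\beta(s)=\mathbf 1_{\{s\ge0\}}$; if $T>0$, $\tilde\beta(s)=\mathbf 1_{\{s\ge0\}}\min\{(\beta')^{-1}(s/T),1\}$, with the convention that $(\beta')^{-1}(s/T)$ is taken to be $0$ if $s/T<\beta'(0)$ and that $\tilde\beta(s)=1$ if $s/T\ge\beta'(1)$. Vlasov–Schrödinger–Poisson system. The unknown is a pair $(\mathbf f(t),\boldsymbol\chi(t))\in\mathcal A_{\rm c.m.}\times\mathcal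 A_{\rm q.m.}$ for each time $t$, such that: for each $j$, $$\partial_tf_j+v\cdot\nabla_yf_j-\nabla_y\lambda_j(t,y)\cdot\nabla_vf_j=0\ \text{ on }\omega\times\mathbb R^2,\qquad f_j(0,\cdot)=f_{j,0};$$ for each $(t,y)$, $\big(-\frac{\partial_z^2}{2}+(U+V_{\rm ext})(t,y,\cdot)\big)\chi_j(t,y,\cdot)=\lambda_j(t,y)\chi_j(t,y,\cdot)$ on $(0,1)$, $\chi_j(t,y,0)=\chi_j(t,y,1)=0$, where $V_{\rm ext}$ does not depend on $t$, and $\lambda_j(t,y)$ is the $j$-th eigenvalue of that operator with form domain $H_0^1(0,1)$; and $U(t,\cdot)=U_{\rho_{(\mathbf f(t),\boldsymbol\chi(t))}}$. The specular-reflection boundary condition is $f_j(t,y,v)=f_j(t,y,v-2(v\cdot n_y)n_y)$ for $y\in\partial\omega$ with $v\cdot n_y<0$, where $n_y$ is the outward unit normal to $\partial\omega$ at $y$. Weak solution means that the Vlasov equation with its boundary condition holds in the usual distributional sense (tested against functions $\varphi\in C_c^\infty(\mathbb R\times\overline\omega\times\mathbb R^2)$ with $\varphi(t,y,v)=\varphi(t,y,v-2(v\cdot n_y)n_y)$ on $\partial\omega$), while for each $t$ the Poisson equation holds in the form $U(t,\cdot)=U_{\rho_{(\mathbf f(t),\boldsymbol\chi(t))}}\in H^1_\omega(\Omega)$, i.e. $\int_\Omega\nabla U(t,\cdot)\cdot\nabla\varphi\,dx=\int_\Omega\rho_{(\mathbf f(t),\boldsymbol\chi(t))}\varphi\,dx$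 for all $\varphi\in H^1_\omega(\Omega)$, and for each $t$, each $y\in\omega$ and each $j$ the Schrödinger equation $\big(-\frac{\partial_z^2}{2}+U(t,y,\cdot)+V_{\rm ext}(y,\cdot)\big)\chi_j(t,y,\cdot)=\lambda_j(t,y)\chi_j(t,y,\cdot)$ holds on $(0,1)$ with $\chi_j(t,y,0)=\chi_j(t,y,1)=0$ and $\lambda_j(t,y)$ the $j$-th eigenvalue of the operator $-\frac{\partial_z^2}{2}+U(t,y,\cdot)+V_{\rm ext}(y,\cdot)$ with form domain $H_0^1(0,1)$. *)

theory Defs
  imports "HOL-Analysis.Analysis"
begin

section \<open>Smooth functions, test functions and weak derivatives\<close>

text \<open>Used for open \<open>S\<close> only, so \<open>frechet_derivative f (at x)\<close> depends on \<open>f\<close> on \<open>S\<close> alone.\<close>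

primrec Ck_on :: "nat \<Rightarrow> 'a::euclidean_space set \<Rightarrow> ('a \<Rightarrow> 'b::real_normed_vector) \<Rightarrow> bool" where
  "Ck_on 0 S f = continuous_on S f"
| "Ck_on (Suc k) S f =
     ((\<forall>x\<in>S. f differentiable (at x)) \<and>
      (\<forall>i\<in>Basis. Ck_on k S (\<lambda>x. frechet_derivative f (at x) i)))"

definition smooth_on :: "'a::euclidean_space set \<Rightarrow> ('a \<Rightarrow> 'b::real_normed_vector) \<Rightarrow> bool" where
  "smooth_on S f \<longleftrightarrow> (\<forall>k. Ck_on k S f)"

definition grad :: "('a::euclidean_space \<Rightarrow> real) \<Rightarrow> 'a \<Rightarrow> 'a" where
  "grad h x = (\<Sum>i\<in>Basis. frechet_derivative h (at x) i *\<^sub>R i)"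

definition test_functions :: "'a::euclidean_space set \<Rightarrow> ('a \<Rightarrow> 'b::real_normed_vector) set" where
  "test_functions S =
     {\<phi>. smooth_on UNIV \<phi> \<and> compact (closure {x. \<phi> x \<noteq> 0}) \<and> closure {x. \<phi> x \<noteq> 0} \<subseteq> S}"

definition loc_integrable :: "'a::euclidean_space set \<Rightarrow> ('a \<Rightarrow> 'b::euclidean_space) \<Rightarrow> bool" where
  "loc_integrable S u \<longleftrightarrow> (\<forall>K. compact K \<and> K \<subseteq> S \<longrightarrow> integrable (lebesgue_on K) u)"

definition has_weak_partial ::
    "'a::euclidean_space set \<Rightarrow> 'a \<Rightarrow> ('a \<Rightarrow> 'b::euclidean_space) \<Rightarrow> ('a \<Rightarrow> 'b) \<Rightarrow> bool" where
  "has_weak_partial S i u g \<longleftrightarrow>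
     loc_integrable S u \<and> loc_integrable S g \<and>
     (\<forall>\<phi> :: 'a \<Rightarrow> real. \<phi> \<in> test_functions S \<longrightarrow>
        (\<integral>x. frechet_derivative \<phi> (at x) i *\<^sub>R u x \<partial>lebesgue_on S)
          = - (\<integral>x. \<phi> x *\<^sub>R g x \<partial>lebesgue_on S))"

text \<open>Weak derivatives are determined almost everywhere, so the choice made here does not
  affect integrals.\<close>

definition weak_partial ::
    "'a::euclidean_space set \<Rightarrow> 'a \<Rightarrow> ('a \<Rightarrow> 'b::euclidean_space) \<Rightarrow> 'a \<Rightarrow> 'b" where
  "weak_partial S i u = (SOME g. has_weak_partial S i u g)"

definition weak_grad :: "'a::euclidean_space set \<Rightarrow> ('a \<Rightarrow> real) \<Rightarrow> 'a \<Rightarrow> 'a" where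
  "weak_grad S u x = (\<Sum>i\<in>Basis. weak_partial S i u x *\<^sub>R i)"


section \<open>Sobolev spaces\<close>

definition L2_normsq :: "'a::euclidean_space set \<Rightarrow> ('a \<Rightarrow> 'b::euclidean_space) \<Rightarrow> ennreal" where
  "L2_normsq S u = (\<integral>\<^sup>+x. ennreal ((norm (u x))\<^sup>2) \<partial>lebesgue_on S)"

definition L2 :: "'a::euclidean_space set \<Rightarrow> ('a \<Rightarrow> 'b::euclidean_space) set" where
  "L2 S = {u. u \<in> borel_measurable (lebesgue_on S) \<and> L2_normsq S u < \<infinity>}"

definition H1 :: "'a::euclidean_space set \<Rightarrow> ('a \<Rightarrow> 'b::euclidean_space) set" where
  "H1 S = {u \<in> L2 S. \<forall>i\<in>Basis. \<exists>g\<in>L2 S. has_weak_partial S i u g}"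

definition H1_normsq :: "'a::euclidean_space set \<Rightarrow> ('a \<Rightarrow> 'b::euclidean_space) \<Rightarrow> ennreal" where
  "H1_normsq S u = L2_normsq S u + (\<Sum>i\<in>Basis. L2_normsq S (weak_partial S i u))"

definition H1_closure ::
    "'a::euclidean_space set \<Rightarrow> ('a \<Rightarrow> 'b::euclidean_space) set \<Rightarrow> ('a \<Rightarrow> 'b) set" where
  "H1_closure S D =
     {u \<in> H1 S. \<exists>\<phi>. (\<forall>n::nat. \<phi> n \<in> D) \<and>
        (\<lambda>n. H1_normsq S (\<lambda>x. \<phi> n x - u x)) \<longlonglongrightarrow> 0}"

definition H1_0 :: "'a::euclidean_space set \<Rightarrow> ('a \<Rightarrow> 'b::euclidean_space) set" where
  "H1_0 S = H1_closure S (test_functions S)"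

abbreviation unit_ivl :: "real set" where
  "unit_ivl \<equiv> {0<..<1}"

type_synonym vec2 = "real^2"

abbreviation cylinder :: "vec2 set \<Rightarrow> (vec2 \<times> real) set" where
  "cylinder \<omega> \<equiv> \<omega> \<times> unit_ivl"

text \<open>Functions in \<open>H\<^sup>1(\<omega> \<times> (0,1))\<close> with zero trace on the lateral boundary
  \<open>\<partial>\<omega> \<times> (0,1)\<close>; as usual for partial Dirichlet conditions, this is the \<open>H\<^sup>1\<close>-closure of
  the functions smooth up to the boundary that vanish there.\<close>

definition H1_lateral :: "vec2 set \<Rightarrow> (vec2 \<times> real \<Rightarrow> real) set" where
  "H1_lateral \<omega> = H1_closure (cylinder \<omega>)
     {\<phi>. smooth_on UNIV \<phi> \<and> (\<forall>y\<in>frontier \<omega>. \<forall>z\<in>unit_ivl. \<phi> (y, z) = 0)}"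


section \<open>Smooth domains\<close>

definition local_defining_function ::
    "vec2 set \<Rightarrow> vec2 \<Rightarrow> vec2 set \<Rightarrow> (vec2 \<Rightarrow> real) \<Rightarrow> bool" where
  "local_defining_function \<omega> p W h \<longleftrightarrow>
     open W \<and> p \<in> W \<and> smooth_on W h \<and> (\<forall>x\<in>W. grad h x \<noteq> 0) \<and> \<omega> \<inter> W = {x\<in>W. h x < 0}"

definition smooth_bounded_domain :: "vec2 set \<Rightarrow> bool" where
  "smooth_bounded_domain \<omega> \<longleftrightarrow>
     open \<omega> \<and> connected \<omega> \<and> \<omega> \<noteq> {} \<and> bounded \<omega> \<and>
     (\<forall>p\<in>frontier \<omega>. \<exists>W h. local_defining_function \<omega> p W h)"

definition outward_normal :: "vec2 set \<Rightarrow> vec2 \<Rightarrow> vec2" where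
  "outward_normal \<omega> y =
     (THE n. \<exists>W h. local_defining_function \<omega> y W h \<and> n = grad h y /\<^sub>R norm (grad h y))"


section \<open>Admissible classes, density, Poisson potential\<close>

text \<open>Sequences indexed by \<open>j = 1, 2, \<dots>\<close> in the mathematics are indexed by \<open>j = 0, 1, \<dots>\<close> here.
  Functions are represented by total functions of which only the restriction to
  \<open>\<omega> \<times> \<real>\<^sup>2\<close>, respectively \<open>\<omega> \<times> (0,1)\<close>, is used.\<close>

type_synonym cl_state = "nat \<Rightarrow> vec2 \<times> vec2 \<Rightarrow> real"
type_synonym qm_state = "nat \<Rightarrow> vec2 \<times> real \<Rightarrow> complex"

definition mass :: "vec2 set \<Rightarrow> cl_state \<Rightarrow> ennreal" where
  "mass \<omega> f = (\<Sum>j. \<integral>\<^sup>+p. ennreal (f j p) \<partial>lebesgue_on (\<omega> \<times> UNIV))"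

definition A_cm :: "vec2 set \<Rightarrow> cl_state set" where
  "A_cm \<omega> = {f. (\<forall>j. f j \<in> borel_measurable (lebesgue_on (\<omega> \<times> UNIV))) \<and>
     (\<forall>j. \<forall>y\<in>\<omega>. \<forall>v. 0 \<le> f j (y, v) \<and> f j (y, v) \<le> 1) \<and>
     mass \<omega> f < \<infinity>}"

definition L2_inner :: "(real \<Rightarrow> complex) \<Rightarrow> (real \<Rightarrow> complex) \<Rightarrow> complex" where
  "L2_inner u w = (\<integral>z. u z * cnj (w z) \<partial>lebesgue_on unit_ivl)"

definition A_qm :: "vec2 set \<Rightarrow> qm_state set" where
  "A_qm \<omega> = {ch. (\<forall>j. ch j \<in> borel_measurable (lebesgue_on (cylinder \<omega>))) \<and>
     (\<forall>y\<in>\<omega>. (\<forall>j. (\<lambda>z. ch j (y, z)) \<in> H1_0 unit_ivl) \<and>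
        (\<forall>j k. L2_inner (\<lambda>z. ch j (y, z)) (\<lambda>z. ch k (y, z)) = (if j = k then 1 else 0)))}"

definition velocity_average :: "(vec2 \<times> vec2 \<Rightarrow> real) \<Rightarrow> vec2 \<Rightarrow> real" where
  "velocity_average f y = (\<integral>v. f (y, v) \<partial>lebesgue)"

text \<open>For admissible states the series converges almost everywhere, as its terms are nonnegative
  and its integral is the total mass.\<close>

definition particle_density :: "cl_state \<Rightarrow> qm_state \<Rightarrow> vec2 \<times> real \<Rightarrow> real" where
  "particle_density f ch x = (\<Sum>j. velocity_average (f j) (fst x) * (cmod (ch j x))\<^sup>2)"

definition poisson_solution ::
    "vec2 set \<Rightarrow> (vec2 \<times> real \<Rightarrow> real) \<Rightarrow> (vec2 \<times> real \<Rightarrow> real) \<Rightarrow> bool" where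
  "poisson_solution \<omega> \<rho> U \<longleftrightarrow>
     U \<in> H1_lateral \<omega> \<and>
     (\<forall>\<phi>\<in>H1_lateral \<omega>.
        integrable (lebesgue_on (cylinder \<omega>)) (\<lambda>x. \<rho> x * \<phi> x) \<and>
        (\<integral>x. weak_grad (cylinder \<omega>) U x \<bullet> weak_grad (cylinder \<omega>) \<phi> x
             \<partial>lebesgue_on (cylinder \<omega>))
          = (\<integral>x. \<rho> x * \<phi> x \<partial>lebesgue_on (cylinder \<omega>)))"

text \<open>A representative of the weak solution, which is unique up to null sets.\<close>

definition potential :: "vec2 set \<Rightarrow> (vec2 \<times> real \<Rightarrow> real) \<Rightarrow> vec2 \<times> real \<Rightarrow> real" where
  "potential \<omega> \<rho> = (SOME U. poisson_solution \<omega> \<rho> U)"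


section \<open>Functionals\<close>

definition kinetic_energy :: "vec2 set \<Rightarrow> cl_state \<Rightarrow> qm_state \<Rightarrow> ennreal" where
  "kinetic_energy \<omega> f ch =
     (\<Sum>j. \<integral>\<^sup>+(y, v). (ennreal ((norm v)\<^sup>2 / 2)
            + L2_normsq unit_ivl (weak_partial unit_ivl 1 (\<lambda>z. ch j (y, z))) / 2)
          * ennreal (f j (y, v)) \<partial>lebesgue_on (\<omega> \<times> UNIV))"

definition external_energy ::
    "vec2 set \<Rightarrow> (vec2 \<times> real \<Rightarrow> real) \<Rightarrow> cl_state \<Rightarrow> qm_state \<Rightarrow> ennreal" where
  "external_energy \<omega> V f ch =
     (\<Sum>j. \<integral>\<^sup>+(x, v). ennreal (V x * (cmod (ch j x))\<^sup>2 * f j (fst x, v))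
          \<partial>lebesgue_on (cylinder \<omega> \<times> (UNIV :: vec2 set)))"

definition field_energy :: "vec2 set \<Rightarrow> cl_state \<Rightarrow> qm_state \<Rightarrow> ennreal" where
  "field_energy \<omega> f ch =
     (if \<exists>U. poisson_solution \<omega> (particle_density f ch) U
      then L2_normsq (cylinder \<omega>)
             (weak_grad (cylinder \<omega>) (potential \<omega> (particle_density f ch))) / 2
      else \<infinity>)"

definition energy ::
    "vec2 set \<Rightarrow> (vec2 \<times> real \<Rightarrow> real) \<Rightarrow> cl_state \<Rightarrow> qm_state \<Rightarrow> ennreal" where
  "energy \<omega> V f ch = kinetic_energy \<omega> f ch + external_energy \<omega> V f ch + field_energy \<omega> f ch"

definition casimir :: "vec2 set \<Rightarrow> (real \<Rightarrow> real) \<Rightarrow> cl_state \<Rightarrow> ennreal" where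
  "casimir \<omega> \<beta> f = (\<Sum>j. \<integral>\<^sup>+p. ennreal (\<beta> (f j p)) \<partial>lebesgue_on (\<omega> \<times> UNIV))"

definition free_energy ::
    "vec2 set \<Rightarrow> (vec2 \<times> real \<Rightarrow> real) \<Rightarrow> real \<Rightarrow> (real \<Rightarrow> real) \<Rightarrow> cl_state \<Rightarrow> qm_state \<Rightarrow> ennreal" where
  "free_energy \<omega> V T \<beta> f ch = energy \<omega> V f ch + ennreal T * casimir \<omega> \<beta> f"

definition is_minimizer ::
    "vec2 set \<Rightarrow> (vec2 \<times> real \<Rightarrow> real) \<Rightarrow> real \<Rightarrow> (real \<Rightarrow> real) \<Rightarrow> real
      \<Rightarrow> cl_state \<Rightarrow> qm_state \<Rightarrow> bool" where
  "is_minimizer \<omega> V T \<beta> M f ch \<longleftrightarrow>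
     f \<in> A_cm \<omega> \<and> ch \<in> A_qm \<omega> \<and> mass \<omega> f = ennreal M \<and>
     (\<forall>f'\<in>A_cm \<omega>. \<forall>ch'\<in>A_qm \<omega>. mass \<omega> f' = ennreal M \<longrightarrow>
        free_energy \<omega> V T \<beta> f ch \<le> free_energy \<omega> V T \<beta> f' ch')"

definition entropy_generator :: "(real \<Rightarrow> real) \<Rightarrow> bool" where
  "entropy_generator \<beta> \<longleftrightarrow>
     \<beta> 0 = 0 \<and> (\<forall>s\<in>{0..1}. 0 \<le> \<beta> s) \<and> \<beta> differentiable_on {0..1} \<and>
     (\<forall>r\<in>{0..1}. \<forall>s\<in>{0..1}. \<forall>a\<in>{0<..<1}. r \<noteq> s \<longrightarrow>
        \<beta> ((1 - a) * r + a * s) < (1 - a) * \<beta> r + a * \<beta> s)"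

text \<open>The derivative on \<open>[0,1]\<close>, one-sided at the endpoints.\<close>

definition dbeta :: "(real \<Rightarrow> real) \<Rightarrow> real \<Rightarrow> real" where
  "dbeta \<beta> s = vector_derivative \<beta> (at s within {0..1})"

definition beta_tilde :: "real \<Rightarrow> (real \<Rightarrow> real) \<Rightarrow> real \<Rightarrow> real" where
  "beta_tilde T \<beta> s =
     (if s < 0 then 0
      else if T = 0 then 1
      else if s / T < dbeta \<beta> 0 then 0
      else if s / T \<ge> dbeta \<beta> 1 then 1
      else min (the_inv_into {0..1} (dbeta \<beta>) (s / T)) 1)"


section \<open>The transverse Schroedinger operator\<close>

text \<open>\<open>(-\<partial>\<^sub>z\<^sup>2/2 + W) u = E u\<close> on \<open>(0,1)\<close> with Dirichlet conditions, in the form sense.\<close>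

definition schroedinger_eq :: "(real \<Rightarrow> real) \<Rightarrow> real \<Rightarrow> (real \<Rightarrow> complex) \<Rightarrow> bool" where
  "schroedinger_eq W E u \<longleftrightarrow>
     u \<in> H1_0 unit_ivl \<and>
     (\<forall>\<phi>\<in>H1_0 unit_ivl.
        integrable (lebesgue_on unit_ivl) (\<lambda>z. complex_of_real (W z) * u z * cnj (\<phi> z)) \<and>
        L2_inner (weak_partial unit_ivl 1 u) (weak_partial unit_ivl 1 \<phi>) / 2
          + L2_inner (\<lambda>z. complex_of_real (W z) * u z) \<phi>
          = complex_of_real E * L2_inner u \<phi>)"

text \<open>\<open>lam j\<close> is the \<open>j\<close>-th eigenvalue for every \<open>j\<close>: the sequence is nondecreasing and every
  real \<open>E\<close> occurs in it as often as the dimension of its eigenspace, i.e. as the largest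
  number of \<open>L\<^sup>2\<close>-orthonormal eigenfunctions (in particular not at all if \<open>E\<close> is no eigenvalue).\<close>

definition eigenvalues :: "(real \<Rightarrow> real) \<Rightarrow> (nat \<Rightarrow> real) \<Rightarrow> bool" where
  "eigenvalues W lam \<longleftrightarrow>
     mono lam \<and>
     (\<forall>E. finite {j. lam j = E} \<and>
        (\<forall>n. n \<le> card {j. lam j = E} \<longleftrightarrow>
           (\<exists>u. (\<forall>k<n. schroedinger_eq W E (u k)) \<and>
                (\<forall>k<n. \<forall>l<n. L2_inner (u k) (u l) = (if k = l then 1 else 0)))))"


section \<open>The Vlasov--Schroedinger--Poisson system\<close>

definition specular_test_functions :: "vec2 set \<Rightarrow> (real \<times> vec2 \<times> vec2 \<Rightarrow> real) set" where
  "specular_test_functions \<omega> =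
     {\<phi> \<in> test_functions UNIV. \<forall>t. \<forall>y\<in>frontier \<omega>. \<forall>v.
        \<phi> (t, y, v) = \<phi> (t, y, v - (2 * (v \<bullet> outward_normal \<omega> y)) *\<^sub>R outward_normal \<omega> y)}"

text \<open>\<open>transport \<phi> g\<close> is \<open>\<partial>\<^sub>t\<phi> + v \<cdot> \<nabla>\<^sub>y\<phi> - g(t,y) \<cdot> \<nabla>\<^sub>v\<phi>\<close>, with \<open>g\<close> the force term \<open>\<nabla>\<^sub>y\<lambda>\<^sub>j\<close>.\<close>

definition transport ::
    "(real \<times> vec2 \<times> vec2 \<Rightarrow> real) \<Rightarrow> (real \<Rightarrow> vec2 \<Rightarrow> vec2) \<Rightarrow> real \<times> vec2 \<times> vec2 \<Rightarrow> real" where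
  "transport \<phi> g = (\<lambda>(t, y, v). frechet_derivative \<phi> (at (t, y, v)) (1, v, - g t y))"

text \<open>Distributional form of the Vlasov equation with specular reflection. Testing separately on
  \<open>t > 0\<close> and \<open>t < 0\<close>, with boundary terms at \<open>t = 0\<close>, encodes the initial condition; the two
  identities together give the equation on all of \<open>\<real>\<close>.\<close>

definition vlasov_weak ::
    "vec2 set \<Rightarrow> (vec2 \<times> vec2 \<Rightarrow> real) \<Rightarrow> (real \<Rightarrow> vec2 \<times> vec2 \<Rightarrow> real) \<Rightarrow> (real \<Rightarrow> vec2 \<Rightarrow> vec2) \<Rightarrow> bool" where
  "vlasov_weak \<omega> f0 f g \<longleftrightarrow>
     (\<forall>\<phi>\<in>specular_test_functions \<omega>.
        integrable (lebesgue_on (UNIV \<times> \<omega> \<times> UNIV)) (\<lambda>(t, p). f t p * transport \<phi> g (t, p)) \<and>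
        (\<integral>(t, p). f t p * transport \<phi> g (t, p) \<partial>lebesgue_on ({0<..} \<times> \<omega> \<times> UNIV))
          = - (\<integral>p. f0 p * \<phi> (0, p) \<partial>lebesgue_on (\<omega> \<times> UNIV)) \<and>
        (\<integral>(t, p). f t p * transport \<phi> g (t, p) \<partial>lebesgue_on ({..<0} \<times> \<omega> \<times> UNIV))
          = (\<integral>p. f0 p * \<phi> (0, p) \<partial>lebesgue_on (\<omega> \<times> UNIV)))"

text \<open>\<open>g j t y\<close> below is the weak gradient \<open>\<nabla>\<^sub>y\<lambda>\<^sub>j(t,y)\<close>; \<open>U t\<close> is the representative of the
  Poisson potential whose slices enter the Schroedinger equation.\<close>

definition VSP_solution ::
    "vec2 set \<Rightarrow> (vec2 \<times> real \<Rightarrow> real) \<Rightarrow> cl_state \<Rightarrow> qm_state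
      \<Rightarrow> (real \<Rightarrow> cl_state) \<Rightarrow> (real \<Rightarrow> qm_state) \<Rightarrow> bool" where
  "VSP_solution \<omega> V f0 ch0 f ch \<longleftrightarrow>
     (\<forall>t. f t \<in> A_cm \<omega> \<and> ch t \<in> A_qm \<omega>) \<and>
     (\<forall>j. (\<lambda>(t, p). f t j p) \<in> borel_measurable (lebesgue_on (UNIV \<times> \<omega> \<times> UNIV))) \<and>
     (\<forall>j. (\<lambda>(t, x). ch t j x) \<in> borel_measurable (lebesgue_on (UNIV \<times> cylinder \<omega>))) \<and>
     (\<forall>j. AE p in lebesgue_on (\<omega> \<times> UNIV). f 0 j p = f0 j p) \<and>
     (\<forall>j. AE x in lebesgue_on (cylinder \<omega>). ch 0 j x = ch0 j x) \<and>
     (\<exists>(U :: real \<Rightarrow> vec2 \<times> real \<Rightarrow> real) (lam :: nat \<Rightarrow> real \<Rightarrow> vec2 \<Rightarrow> real)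
        (g :: nat \<Rightarrow> real \<Rightarrow> vec2 \<Rightarrow> vec2).
        (\<lambda>(t, x). U t x) \<in> borel_measurable (lebesgue_on (UNIV \<times> cylinder \<omega>)) \<and>
        (\<forall>j. (\<lambda>(t, y). lam j t y) \<in> borel_measurable (lebesgue_on (UNIV \<times> \<omega>))) \<and>
        (\<forall>j. (\<lambda>(t, y). g j t y) \<in> borel_measurable (lebesgue_on (UNIV \<times> \<omega>))) \<and>
        (\<forall>t. poisson_solution \<omega> (particle_density (f t) (ch t)) (U t)) \<and>
        (\<forall>t. \<forall>y\<in>\<omega>.
           eigenvalues (\<lambda>z. U t (y, z) + V (y, z)) (\<lambda>j. lam j t y) \<and>
           (\<forall>j. schroedinger_eq (\<lambda>z. U t (y, z) + V (y, z)) (lam j t y) (\<lambda>z. ch t j (y, z)))) \<and>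
        (\<forall>j. AE t in lebesgue. \<forall>i\<in>Basis. has_weak_partial \<omega> i (lam j t) (\<lambda>y. g j t y \<bullet> i)) \<and>
        (\<forall>j. vlasov_weak \<omega> (f0 j) (\<lambda>t. f t j) (g j)))"

text \<open>Eigenfunctions are determined only up to a phase depending on \<open>(t,y)\<close>, and a weak solution
  may be altered on a null set of times; uniqueness is understood modulo these.\<close>

definition unique_VSP_solution ::
    "vec2 set \<Rightarrow> (vec2 \<times> real \<Rightarrow> real) \<Rightarrow> cl_state \<Rightarrow> qm_state
      \<Rightarrow> (real \<Rightarrow> cl_state) \<Rightarrow> (real \<Rightarrow> qm_state) \<Rightarrow> bool" where
  "unique_VSP_solution \<omega> V f0 ch0 f ch \<longleftrightarrow>
     VSP_solution \<omega> V f0 ch0 f ch \<and>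
     (\<forall>f' ch'. VSP_solution \<omega> V f0 ch0 f' ch' \<longrightarrow>
        (AE t in lebesgue. \<forall>j.
           (AE p in lebesgue_on (\<omega> \<times> UNIV). f' t j p = f t j p) \<and>
           (AE y in lebesgue_on \<omega>. \<exists>c. cmod c = 1 \<and>
              (AE z in lebesgue_on unit_ivl. ch' t j (y, z) = c * ch t j (y, z)))))"

end

theory Submission
  imports Defs "HOL-Complex_Analysis.Great_Picard"
begin

text \<open>
  Stability is a static fact: the solution enters only through the conservation of mass and free
  energy. Put \<open>H y = -\<partial>\<^sub>z\<^sup>2/2 + U*(y,\<cdot>) + V(y,\<cdot>)\<close>. Up to a constant, the free energy of a state is
  \<open>1/2 \<parallel>\<nabla>(U - U*)\<parallel>\<^sup>2\<close> plus the sum over \<open>j\<close> of the integrals of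
  \<open>(|v|\<^sup>2/2 + \<langle>\<chi>\<^sub>j, H \<chi>\<^sub>j\<rangle> - \<mu>) f\<^sub>j + T \<beta>(f\<^sub>j)\<close> plus \<open>\<mu>\<close> times the mass. By the variational principle for \<open>H\<close>,
  Bessel's inequality and Legendre duality (a Peierls type argument), this sum is minimal at
  the equilibrium, even without a mass constraint. Hence
  \<open>1/2 \<parallel>\<nabla>(U - U*)\<parallel>\<^sup>2 \<le> F - F* + \<mu> (M* - M)\<close>, and \<open>\<delta> = \<epsilon>/(2 (1 + \<mu>))\<close> works.
\<close>

text \<open>The quadratic term comes from testing the Poisson equation of U with the equilibrium
  potential: the cross term of the squared gradient of the difference is then the integral of the
  density against that potential, which is the potential inside H. Completeness of the
  eigenfunctions of H is never established, so <chi, H chi> is not expanded in them. It is enough to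
  look below \<mu>0 = \<mu> - T \<beta>'(0), above which nothing is occupied: only finitely many
  eigenvalues lie there, and the overlaps of the two families of transverse states need only be
  sub-stochastic. Two obstacles shape the rest. Nothing makes the eigenvalues or the transverse
  kinetic energy measurable in y; the former are recovered from the set of occupied velocities, the
  latter is handled by sub- and superadditivity of the lower integral. Nor is the equilibrium
  potential known to be nonnegative; as all energies have values in [0,\<infinity>], its negative
  part is carried on the opposite side of each inequality.\<close>

section \<open>Smooth cutoff functions\<close>

lemma Ck_on_Suc_imp: "Ck_on (Suc k) UNIV f \<Longrightarrow> Ck_on k UNIV f"
proof (induction k arbitrary: f)
  case 0
  then have "\<forall>x. isCont f x"
    by (simp add: differentiable_imp_continuous_within)
  then show ?case by (simp add: continuous_at_imp_continuous_on)
next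
  case (Suc k)
  then show ?case by auto
qed

lemma Ck_on_add:
  "Ck_on k UNIV f \<Longrightarrow> Ck_on k UNIV g \<Longrightarrow> Ck_on k UNIV (\<lambda>x. f x + g x)"
proof (induction k arbitrary: f g)
  case 0
  then show ?case by (auto intro: continuous_intros)
next
  case (Suc k)
  have "frechet_derivative (\<lambda>x. f x + g x) (at x) i
      = frechet_derivative f (at x) i + frechet_derivative g (at x) i" for x i
  proof -
    have "((\<lambda>x. f x + g x) has_derivative
        (\<lambda>i. frechet_derivative f (at x) i + frechet_derivative g (at x) i)) (at x)"
      using Suc.prems by (intro has_derivative_add) (simp_all add: frechet_derivative_works[THEN iffD1])
    from frechet_derivative_at[OF this] show ?thesis by metis
  qed
  then show ?case using Suc by auto
qed

lemma Ck_on_bounded_linear: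
  fixes f :: "'c::euclidean_space \<Rightarrow> 'a::real_normed_vector" and h :: "'a \<Rightarrow> 'b::real_normed_vector"
  assumes "bounded_linear h"
  shows "Ck_on k UNIV f \<Longrightarrow> Ck_on k UNIV (\<lambda>x. h (f x))"
proof (induction k arbitrary: f)
  case 0
  then show ?case
    using continuous_on_compose2[OF linear_continuous_on[OF assms, of UNIV]] by simp
next
  case (Suc k)
  have D: "((\<lambda>x. h (f x)) has_derivative (\<lambda>i. h (frechet_derivative f (at x) i))) (at x)" for x
    using Suc.prems
    by (intro bounded_linear.has_derivative[OF assms]) (simp add: frechet_derivative_works[THEN iffD1])
  moreover have "frechet_derivative (\<lambda>x. h (f x)) (at x) i
      = h (frechet_derivative f (at x) i)" for x i
    by (simp flip: frechet_derivative_at[OF D])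
  ultimately show ?case using Suc by (auto simp: differentiable_def)
qed

lemma Ck_on_scaleR:
  "Ck_on k UNIV f \<Longrightarrow> Ck_on k UNIV g \<Longrightarrow> Ck_on k UNIV (\<lambda>x. f x *\<^sub>R g x)"
proof (induction k arbitrary: f g)
  case 0
  then show ?case by (auto intro: continuous_intros)
next
  case (Suc k)
  have D: "((\<lambda>x. f x *\<^sub>R g x) has_derivative
        (\<lambda>i. f x *\<^sub>R frechet_derivative g (at x) i + frechet_derivative f (at x) i *\<^sub>R g x)) (at x)" for x
    using Suc.prems by (intro has_derivative_scaleR) (simp_all add: frechet_derivative_works[THEN iffD1])
  have F: "frechet_derivative (\<lambda>x. f x *\<^sub>R g x) (at x) i
     = f x *\<^sub>R frechet_derivative g (at x) i + frechet_derivative f (at x) i *\<^sub>R g x" for x i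
    by (simp flip: frechet_derivative_at[OF D])
  have fg: "Ck_on k UNIV f" "Ck_on k UNIV g"
    by (rule Ck_on_Suc_imp[OF Suc.prems(1)], rule Ck_on_Suc_imp[OF Suc.prems(2)])
  have d: "Ck_on k UNIV (\<lambda>x. frechet_derivative f (at x) i)"
    "Ck_on k UNIV (\<lambda>x. frechet_derivative g (at x) i)" if "i \<in> Basis" for i
    using Suc.prems that by simp_all
  have "Ck_on k UNIV (\<lambda>x. frechet_derivative (\<lambda>x. f x *\<^sub>R g x) (at x) i)"
    if "i \<in> Basis" for i
    unfolding F by (rule Ck_on_add[OF Suc.IH[OF fg(1) d(2)[OF that]] Suc.IH[OF d(1)[OF that] fg(2)]])
  moreover have "\<forall>x. (\<lambda>x. f x *\<^sub>R g x) differentiable at x"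
    using D by (auto simp: differentiable_def)
  ultimately show ?case by simp
qed

lemma Ck_on_const: "Ck_on k UNIV (\<lambda>x::'a::euclidean_space. c::'b::real_normed_vector)"
proof (induction k arbitrary: c)
  case 0
  show ?case by simp
next
  case (Suc k)
  have F: "frechet_derivative (\<lambda>x::'a. c) (at x) = (\<lambda>i. 0)" for x
    by (rule frechet_derivative_at[OF has_derivative_const, symmetric])
  have "\<forall>x\<in>UNIV. (\<lambda>x::'a. c) differentiable at x" by (intro ballI differentiable_const)
  moreover have "Ck_on k UNIV (\<lambda>x::'a. 0::'b)" by (rule Suc.IH)
  then have "\<forall>i\<in>Basis. Ck_on k UNIV (\<lambda>x. frechet_derivative (\<lambda>x::'a. c) (at x) i)"
    unfolding F by blast
  ultimately show ?case unfolding Ck_on.simps(2) by (rule conjI)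
qed

lemma Ck_on_affine_inner:
  fixes f :: "real \<Rightarrow> 'b::real_normed_vector"
  shows "Ck_on k UNIV f \<Longrightarrow> Ck_on k UNIV (\<lambda>x. f (x \<bullet> v + d))"
proof (induction k arbitrary: f)
  case 0
  then have "continuous_on UNIV (\<lambda>x. f (x \<bullet> v + d))"
    by (intro continuous_on_compose2[of UNIV f UNIV "\<lambda>x. x \<bullet> v + d"])
      (simp_all add: continuous_on_add continuous_on_inner)
  then show ?case by simp
next
  case (Suc k)
  let ?f' = "\<lambda>t. frechet_derivative f (at t) 1"
  have D: "((\<lambda>x. f (x \<bullet> v + d)) has_derivative
        (\<lambda>i. (i \<bullet> v) *\<^sub>R ?f' (x \<bullet> v + d))) (at x)" for x
  proof -
    have f: "(f has_derivative frechet_derivative f (at (x \<bullet> v + d))) (at (x \<bullet> v + d))"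
      using Suc.prems by (simp add: frechet_derivative_works[THEN iffD1])
    have "((\<lambda>x. f (x \<bullet> v + d)) has_derivative
        (\<lambda>i. frechet_derivative f (at (x \<bullet> v + d)) (i \<bullet> v))) (at x)"
      by (rule has_derivative_compose[where f = "\<lambda>x. x \<bullet> v + d", OF _ f])
        (rule has_derivative_add[OF has_derivative_inner_left[OF has_derivative_ident]
          has_derivative_const, simplified])
    moreover have "frechet_derivative f (at (x \<bullet> v + d)) (i \<bullet> v) = (i \<bullet> v) *\<^sub>R ?f' (x \<bullet> v + d)" for i
      using linear_scale[OF has_derivative_linear[OF f], of "i \<bullet> v" 1] by simp
    ultimately show ?thesis by simp
  qed
  have F: "frechet_derivative (\<lambda>x. f (x \<bullet> v + d)) (at x) i = (i \<bullet> v) *\<^sub>R ?f' (x \<bullet> v + d)" for x i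
    by (simp flip: frechet_derivative_at[OF D])
  have "Ck_on k UNIV ?f'" using Suc.prems by simp
  then have "Ck_on k UNIV (\<lambda>x. frechet_derivative (\<lambda>x. f (x \<bullet> v + d)) (at x) i)" for i :: 'a
    unfolding F by (rule Ck_on_scaleR[OF Ck_on_const Suc.IH])
  moreover have "\<forall>x. (\<lambda>x. f (x \<bullet> v + d)) differentiable at x"
    using D by (auto simp: differentiable_def)
  ultimately show ?case by simp
qed

section \<open>Functions that are flat at 0\<close>

definition exp_tail :: "real poly \<Rightarrow> real \<Rightarrow> real" where
  "exp_tail p t = (if 0 < t then poly p (1 / t) * exp (- (1 / t)) else 0)"

lemma poly_mult_exp_minus_tendsto_0: "((\<lambda>x::real. poly p x * exp (- x)) \<longlongrightarrow> 0) at_top"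
proof -
  have "((\<lambda>x::real. \<Sum>i\<le>degree p. coeff p i * (x ^ i / exp x)) \<longlongrightarrow> (\<Sum>i\<le>degree p. coeff p i * 0)) at_top"
    by (intro tendsto_sum tendsto_mult tendsto_const tendsto_power_div_exp_0)
  then show ?thesis
    by (simp add: poly_altdef sum_distrib_right exp_minus divide_inverse mult.assoc)
qed

text \<open>With x = 1/t the chain rule reads d/dt = -x^2 d/dx, so p(x) exp(-x) becomes x^2 (p -
  p')(x) exp(-x), which is again of this form; this is why the functions carry a polynomial. At t =
  0 the right difference quotient is the function with polynomial x p, and it tends to 0.\<close>

lemma exp_tail_has_derivative:
  "(exp_tail p has_real_derivative exp_tail (monom 1 2 * (p - pderiv p)) t) (at t)"
proof -
  consider "t < 0" | "t > 0" | "t = 0" by linarith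
  then show ?thesis
  proof cases
    case 1
    have "((\<lambda>_. 0) has_real_derivative 0) (at t)" by simp
    then have "(exp_tail p has_real_derivative 0) (at t)"
      by (rule has_field_derivative_transform_within_open[of _ _ _ "{..<0}"])
        (use 1 in \<open>simp_all add: exp_tail_def\<close>)
    with 1 show ?thesis by (simp add: exp_tail_def)
  next
    case 2
    have "((\<lambda>t. poly p (1 / t) * exp (- (1 / t))) has_real_derivative
       exp_tail (monom 1 2 * (p - pderiv p)) t) (at t)"
    proof -
      have "((\<lambda>t. poly p (1 / t)) has_real_derivative poly (pderiv p) (1 / t) * (- 1 / t\<^sup>2)) (at t)"
        using 2 by (intro DERIV_chain2[OF poly_DERIV]) (auto intro!: derivative_eq_intros simp: power2_eq_square)
      moreover have "((\<lambda>t. exp (- (1 / t))) has_real_derivative exp (- (1 / t)) * (1 / t\<^sup>2)) (at t)"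
        using 2 by (auto intro!: derivative_eq_intros simp: power2_eq_square)
      ultimately have "((\<lambda>t. poly p (1 / t) * exp (- (1 / t))) has_real_derivative
        poly (pderiv p) (1 / t) * (- 1 / t\<^sup>2) * exp (- (1 / t))
          + exp (- (1 / t)) * (1 / t\<^sup>2) * poly p (1 / t)) (at t)"
        by (rule DERIV_mult)
      then show ?thesis
        using 2 by (simp add: exp_tail_def poly_monom power_divide algebra_simps)
    qed
    then show ?thesis
      by (rule has_field_derivative_transform_within_open[of _ _ _ "{0<..}"])
        (use 2 in \<open>simp_all add: exp_tail_def\<close>)
  next
    case 3
    have "((\<lambda>h. exp_tail p h / h) \<longlongrightarrow> 0) (at_right 0)"
    proof -
      have "((\<lambda>h. poly (monom 1 1 * p) (1 / h) * exp (- (1 / h))) \<longlongrightarrow> 0) (at_right 0)"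
        using filterlim_compose[OF poly_mult_exp_minus_tendsto_0[of "monom 1 1 * p"]
            filterlim_inverse_at_top_right] by (simp add: divide_inverse)
      then show ?thesis
        by (rule Lim_transform_eventually)
          (auto simp: eventually_at_filter exp_tail_def poly_monom)
    qed
    moreover have "((\<lambda>h. exp_tail p h / h) \<longlongrightarrow> 0) (at_left 0)"
      by (rule Lim_transform_eventually[OF tendsto_const])
        (auto simp: eventually_at_filter exp_tail_def)
    ultimately have "((\<lambda>h. exp_tail p h / h) \<longlongrightarrow> 0) (at 0)"
      by (simp add: filterlim_split_at)
    then show ?thesis
      unfolding 3 has_field_derivative_iff by (simp add: exp_tail_def)
  qed
qed

lemma Ck_on_exp_tail: "Ck_on k UNIV (exp_tail p)"
proof (induction k arbitrary: p)
  case 0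
  show ?case
    using DERIV_isCont[OF exp_tail_has_derivative] by (simp add: continuous_on_eq_continuous_at)
next
  case (Suc k)
  let ?q = "monom 1 2 * (p - pderiv p)"
  have D: "(exp_tail p has_derivative (\<lambda>h. exp_tail ?q t * h)) (at t)" for t
    using exp_tail_has_derivative[of p t] by (simp add: has_field_derivative_def)
  have "frechet_derivative (exp_tail p) (at t) i = exp_tail ?q t * i" for t i
    by (simp flip: frechet_derivative_at[OF D])
  moreover have "\<forall>t. exp_tail p differentiable at t"
    using D by (auto simp: differentiable_def)
  ultimately show ?case using Suc.IH[of ?q] by simp
qed

section \<open>Cutoffs supported in a box\<close>

text \<open>On the open box each coordinate contributes exp(-1/(n(x_i - a_i))) exp(-1/(n(b_i -
  x_i))), and off the box some factor is 0: the support never leaves the closed box, while the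
  values inside tend to 1 as n grows. The arguments are written in the shape x \<bullet> v + d
  required by \<open>Ck_on_affine_inner\<close>.\<close>

definition box_cutoff :: "'a::euclidean_space \<Rightarrow> 'a \<Rightarrow> nat \<Rightarrow> 'a \<Rightarrow> real" where
  "box_cutoff a b n x = (\<Prod>i\<in>Basis. exp_tail 1 (x \<bullet> (real n *\<^sub>R i) + - real n * (a \<bullet> i))
     * exp_tail 1 (x \<bullet> (- real n *\<^sub>R i) + real n * (b \<bullet> i)))"

lemma Ck_on_prod:
  fixes f :: "'i \<Rightarrow> 'a::euclidean_space \<Rightarrow> real"
  shows "(\<And>i. i \<in> I \<Longrightarrow> Ck_on k UNIV (f i)) \<Longrightarrow> Ck_on k UNIV (\<lambda>x. \<Prod>i\<in>I. f i x)"
proof (induction I rule: infinite_finite_induct)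
  case (insert i I)
  then show ?case using Ck_on_scaleR[of k "f i" "\<lambda>x. \<Prod>i\<in>I. f i x"] by simp
qed (simp_all add: Ck_on_const)

lemma smooth_on_box_cutoff: "smooth_on UNIV (box_cutoff a b n)"
  unfolding smooth_on_def box_cutoff_def real_scaleR_def[symmetric]
  by (intro allI Ck_on_prod Ck_on_scaleR Ck_on_affine_inner Ck_on_exp_tail)

lemma exp_tail_1: "0 \<le> exp_tail 1 t" "exp_tail 1 t \<le> 1" "exp_tail 1 t = 0 \<longleftrightarrow> t \<le> 0"
  by (auto simp: exp_tail_def)

lemma box_cutoff_bounds: "0 \<le> box_cutoff a b n x" "box_cutoff a b n x \<le> 1"
  unfolding box_cutoff_def
  by (auto intro!: prod_nonneg prod_le_1 mult_le_one exp_tail_1 mult_nonneg_nonneg)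

lemma box_cutoff_eq_0:
  assumes "x \<notin> box a b"
  shows "box_cutoff a b n x = 0"
proof -
  obtain i where i: "i \<in> Basis" "x \<bullet> i \<le> a \<bullet> i \<or> x \<bullet> i \<ge> b \<bullet> i"
    using assms by (auto simp: mem_box not_less)
  have "x \<bullet> (real n *\<^sub>R i) + - real n * (a \<bullet> i) \<le> 0 \<or> x \<bullet> (- real n *\<^sub>R i) + real n * (b \<bullet> i) \<le> 0"
    using i(2) mult_left_mono[of "x \<bullet> i" "a \<bullet> i" "real n"] mult_left_mono[of "b \<bullet> i" "x \<bullet> i" "real n"]
    by auto
  then show ?thesis unfolding box_cutoff_def
    using i(1) exp_tail_1(3) by (intro prod_zero) (auto intro!: bexI[of _ i])
qed

lemma box_cutoff_tendsto:
  "(\<lambda>n. box_cutoff a b n x) \<longlonglongrightarrow> indicator (box a b) x"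
proof (cases "x \<in> box a b")
  case True
  have lim: "(\<lambda>n. exp_tail 1 (real n * d)) \<longlonglongrightarrow> 1" if "d > 0" for d
  proof -
    have "(\<lambda>n. exp (- (1 / (real n * d)))) \<longlonglongrightarrow> exp (- 0)"
      using that by (intro tendsto_exp tendsto_minus tendsto_divide_0[OF tendsto_const]
        filterlim_at_top_imp_at_infinity
        filterlim_at_top_mult_tendsto_pos[OF tendsto_const] filterlim_real_sequentially)
    moreover have "\<forall>\<^sub>F n in sequentially. exp (- (1 / (real n * d))) = exp_tail 1 (real n * d)"
      using that by (intro eventually_sequentiallyI[of 1]) (simp add: exp_tail_def)
    ultimately show ?thesis
      using Lim_transform_eventually by fastforce
  qed
  have "(\<lambda>n. \<Prod>i\<in>Basis. exp_tail 1 (real n * (x \<bullet> i - a \<bullet> i)) * exp_tail 1 (real n * (b \<bullet> i - x \<bullet> i)))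
      \<longlonglongrightarrow> (\<Prod>i\<in>(Basis::'a set). 1 * 1)"
    using True by (intro tendsto_prod tendsto_mult lim) (auto simp: mem_box)
  with True show ?thesis by (simp add: box_cutoff_def algebra_simps)
next
  case False
  then show ?thesis by (simp add: box_cutoff_eq_0)
qed

lemma box_cutoff_test_function:
  assumes "cbox a b \<subseteq> S"
  shows "box_cutoff a b n \<in> test_functions S"
proof -
  have "{x. box_cutoff a b n x \<noteq> 0} \<subseteq> cbox a b"
    using box_cutoff_eq_0 box_subset_cbox by blast
  then have "closure {x. box_cutoff a b n x \<noteq> 0} \<subseteq> cbox a b"
    by (intro closure_minimal closed_cbox)
  then show ?thesis unfolding test_functions_def
    using assms smooth_on_box_cutoff
    by (auto simp: compact_eq_bounded_closed intro: bounded_subset bounded_cbox)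
qed

section \<open>Weak derivatives\<close>

lemma integrable_mult_compact_support:
  fixes g :: "'a::euclidean_space \<Rightarrow> 'b::euclidean_space" and \<psi> :: "'a \<Rightarrow> real"
  assumes "open S" "loc_integrable S g" "continuous_on UNIV \<psi>" "compact K" "K \<subseteq> S"
    and "\<And>x. x \<notin> K \<Longrightarrow> \<psi> x = 0"
  shows "integrable (lebesgue_on S) (\<lambda>x. \<psi> x *\<^sub>R g x)"
    and "(\<integral>x. \<psi> x *\<^sub>R g x \<partial>lebesgue_on S) = (\<integral>x. \<psi> x *\<^sub>R g x \<partial>lebesgue_on K)"
proof -
  have S: "S \<in> sets lebesgue" using \<open>open S\<close> by simp
  have K: "K \<in> sets lebesgue" using \<open>compact K\<close> by (simp add: compact_imp_closed)
  obtain B where B: "\<And>x. x \<in> K \<Longrightarrow> norm (\<psi> x) \<le> B"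
    using compact_imp_bounded[OF compact_continuous_image[OF continuous_on_subset[OF assms(3)] \<open>compact K\<close>]]
    unfolding bounded_iff by auto
  have g: "integrable (lebesgue_on K) g"
    using assms(2,4,5) by (auto simp: loc_integrable_def)
  have m: "\<psi> \<in> borel_measurable (lebesgue_on K)"
    using continuous_imp_measurable_on_sets_lebesgue[OF continuous_on_subset[OF assms(3)] K] by simp
  have "integrable (lebesgue_on K) (\<lambda>x. B *\<^sub>R g x)" using g by simp
  then have i: "integrable (lebesgue_on K) (\<lambda>x. \<psi> x *\<^sub>R g x)"
  proof (rule Bochner_Integration.integrable_bound)
    show "(\<lambda>x. \<psi> x *\<^sub>R g x) \<in> borel_measurable (lebesgue_on K)"
      using m g by (intro borel_measurable_scaleR) auto
    show "AE x in lebesgue_on K. norm (\<psi> x *\<^sub>R g x) \<le> norm (B *\<^sub>R g x)"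
      by (rule AE_I2) (auto intro!: mult_right_mono order_trans[OF B[unfolded real_norm_def]] simp: K)
  qed
  have eq: "indicator S x * \<psi> x = indicator K x * \<psi> x" for x
    using assms(5,6) by (auto simp: indicator_def)
  show "integrable (lebesgue_on S) (\<lambda>x. \<psi> x *\<^sub>R g x)"
    using i S K by (simp add: integrable_restrict_space eq)
  show "(\<integral>x. \<psi> x *\<^sub>R g x \<partial>lebesgue_on S) = (\<integral>x. \<psi> x *\<^sub>R g x \<partial>lebesgue_on K)"
    using S K by (simp add: integral_restrict_space eq)
qed

lemma test_function_deriv:
  fixes \<phi> :: "'a::euclidean_space \<Rightarrow> 'b::real_normed_vector"
  assumes "\<phi> \<in> test_functions S"
  obtains K where "compact K" "K \<subseteq> S" "\<And>x. x \<notin> K \<Longrightarrow> \<phi> x = 0"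
    "\<And>x i. x \<notin> K \<Longrightarrow> frechet_derivative \<phi> (at x) i = 0"
    "continuous_on UNIV \<phi>" "\<And>x. (\<phi> has_derivative frechet_derivative \<phi> (at x)) (at x)"
    "\<And>i. i \<in> Basis \<Longrightarrow> continuous_on UNIV (\<lambda>x. frechet_derivative \<phi> (at x) i)"
proof -
  let ?K = "closure {x. \<phi> x \<noteq> 0}"
  have s: "Ck_on 0 UNIV \<phi>" "Ck_on 1 UNIV \<phi>" and K: "compact ?K" "?K \<subseteq> S"
    using assms by (auto simp: test_functions_def smooth_on_def simp del: Ck_on.simps)
  have "frechet_derivative \<phi> (at x) = (\<lambda>_. 0)" if "x \<notin> ?K" for x
  proof -
    have "((\<lambda>_. 0) has_derivative (\<lambda>_. 0)) (at x)" by (rule has_derivative_const)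
    then have "(\<phi> has_derivative (\<lambda>_. 0)) (at x)"
      by (rule has_derivative_transform_within_open[where s = "- ?K"])
        (use that closure_subset[of "{x. \<phi> x \<noteq> 0}"] in \<open>auto simp: open_Compl closed_closure\<close>)
    then show ?thesis using frechet_derivative_at by metis
  qed
  then have 1: "frechet_derivative \<phi> (at x) i = 0" if "x \<notin> ?K" for x i
    using that by metis
  have 2: "\<phi> x = 0" if "x \<notin> ?K" for x
    using that closure_subset[of "{x. \<phi> x \<noteq> 0}"] by blast
  have 3: "(\<phi> has_derivative frechet_derivative \<phi> (at x)) (at x)" for x
    using s(2) by (simp add: frechet_derivative_works[THEN iffD1])
  have 4: "continuous_on UNIV (\<lambda>x. frechet_derivative \<phi> (at x) i)" if "i \<in> Basis" for i
    using s(2) that by simp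
  have 5: "continuous_on UNIV \<phi>" using s(1) by simp
  show ?thesis by (rule that[OF K 2 1 5 3 4])
qed

lemma test_function_integrable:
  fixes g :: "'a::euclidean_space \<Rightarrow> 'b::euclidean_space" and \<phi> :: "'a \<Rightarrow> real"
  assumes "open S" "loc_integrable S g" "\<phi> \<in> test_functions S"
  shows "integrable (lebesgue_on S) (\<lambda>x. \<phi> x *\<^sub>R g x)"
    and "i \<in> Basis \<Longrightarrow> integrable (lebesgue_on S) (\<lambda>x. frechet_derivative \<phi> (at x) i *\<^sub>R g x)"
proof -
  obtain K where K: "compact K" "K \<subseteq> S" "\<And>x. x \<notin> K \<Longrightarrow> \<phi> x = 0"
    "\<And>x i. x \<notin> K \<Longrightarrow> frechet_derivative \<phi> (at x) i = 0"
    "continuous_on UNIV \<phi>" "\<And>i. i \<in> Basis \<Longrightarrow> continuous_on UNIV (\<lambda>x. frechet_derivative \<phi> (at x) i)"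
    using test_function_deriv[OF assms(3)] by metis
  show "integrable (lebesgue_on S) (\<lambda>x. \<phi> x *\<^sub>R g x)"
    by (rule integrable_mult_compact_support(1)[OF assms(1,2) K(5,1,2,3)])
  show "integrable (lebesgue_on S) (\<lambda>x. frechet_derivative \<phi> (at x) i *\<^sub>R g x)" if "i \<in> Basis"
    by (rule integrable_mult_compact_support(1)[OF assms(1,2) K(6)[OF that] K(1,2,4)])
qed

section \<open>The fundamental lemma of the calculus of variations\<close>

lemma integral_cbox_eq_0_if_test_integrals_eq_0:
  fixes g :: "'a::euclidean_space \<Rightarrow> 'b::euclidean_space"
  assumes "open S" "loc_integrable S g" "cbox a b \<subseteq> S"
    and "\<And>\<phi>::'a \<Rightarrow> real. \<phi> \<in> test_functions S \<Longrightarrow> (\<integral>x. \<phi> x *\<^sub>R g x \<partial>lebesgue_on S) = 0"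
  shows "integral (cbox a b) g = 0"
proof -
  let ?K = "cbox a b"
  have g: "integrable (lebesgue_on ?K) g"
    using assms(2,3) by (simp add: loc_integrable_def)
  have c: "continuous_on UNIV (box_cutoff a b n)" for n
    using smooth_on_box_cutoff[of a b n] unfolding smooth_on_def by (auto dest: spec[of _ 0])
  have ind: "indicator (box a b) \<in> borel_measurable (lebesgue_on ?K)"
    by (rule measurable_restrict_space1) (simp add: borel_measurable_indicator)
  \<comment> \<open>The cutoffs are test functions bounded by 1 that converge to the indicator of
    the open box, so dominated convergence applies; the faces of the box are null and the closed box
    follows.\<close>
  have "(\<lambda>n. \<integral>x. box_cutoff a b n x *\<^sub>R g x \<partial>lebesgue_on ?K)
      \<longlonglongrightarrow> (\<integral>x. indicator (box a b) x *\<^sub>R g x \<partial>lebesgue_on ?K)"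
  proof (rule integral_dominated_convergence[where w = "\<lambda>x. norm (g x)"])
    show "(\<lambda>x. box_cutoff a b n x *\<^sub>R g x) \<in> borel_measurable (lebesgue_on ?K)" for n
      using g continuous_imp_measurable_on_sets_lebesgue[OF continuous_on_subset[OF c, of ?K]]
      by (intro borel_measurable_scaleR) auto
    show "(\<lambda>x. indicator (box a b) x *\<^sub>R g x) \<in> borel_measurable (lebesgue_on ?K)"
      using g by (intro borel_measurable_scaleR ind) auto
    show "AE x in lebesgue_on ?K. norm (box_cutoff a b n x *\<^sub>R g x) \<le> norm (g x)" for n
      by (rule AE_I2) (simp add: box_cutoff_bounds mult_left_le_one_le)
    show "AE x in lebesgue_on ?K. (\<lambda>n. box_cutoff a b n x *\<^sub>R g x) \<longlonglongrightarrow> indicator (box a b) x *\<^sub>R g x"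
      by (rule AE_I2) (intro tendsto_scaleR box_cutoff_tendsto tendsto_const)
    show "integrable (lebesgue_on ?K) (\<lambda>x. norm (g x))" using g by simp
  qed
  moreover have "(\<integral>x. box_cutoff a b n x *\<^sub>R g x \<partial>lebesgue_on ?K) = 0" for n
  proof -
    have "box_cutoff a b n x = 0" if "x \<notin> ?K" for x
      using that box_cutoff_eq_0 box_subset_cbox by blast
    from integrable_mult_compact_support(2)[OF assms(1,2) c compact_cbox assms(3) this]
    show ?thesis using assms(4)[OF box_cutoff_test_function[OF assms(3)]] by metis
  qed
  ultimately have "(\<integral>x. indicator (box a b) x *\<^sub>R g x \<partial>lebesgue_on ?K) = 0"
    by (simp add: LIMSEQ_const_iff)
  moreover have "(\<integral>x. indicator (box a b) x *\<^sub>R g x \<partial>lebesgue_on ?K) = (\<integral>x. g x \<partial>lebesgue_on ?K)"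
  proof (rule integral_cong_AE)
    show "(\<lambda>x. indicator (box a b) x *\<^sub>R g x) \<in> borel_measurable (lebesgue_on ?K)"
      using g by (intro borel_measurable_scaleR ind) auto
    have "AE x in lebesgue. x \<notin> cbox a b - box a b"
      using AE_not_in[OF negligible_frontier_interval[of a b, unfolded negligible_iff_null_sets]] .
    then have "AE x in lebesgue. x \<in> ?K \<longrightarrow> indicator (box a b) x *\<^sub>R g x = g x"
      by (rule eventually_mono) simp
    then show "AE x in lebesgue_on ?K. indicator (box a b) x *\<^sub>R g x = g x"
      by (simp add: AE_restrict_space_iff)
  qed (use g in auto)
  moreover have "(\<integral>x. g x \<partial>lebesgue_on ?K) = integral ?K g"
    using g by (simp add: lebesgue_integral_eq_integral)
  ultimately show ?thesis by simp
qed

text \<open>Integrals over all closed boxes in S vanish by the previous lemma, and Lebesgue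
  differentiation recovers g(x), for almost every x, as the limit of averages over small cubes with
  corner x. Countably many closed boxes exhaust S.\<close>

lemma AE_eq_0_if_test_integrals_eq_0:
  fixes g :: "'a::euclidean_space \<Rightarrow> 'b::euclidean_space"
  assumes "open S" "loc_integrable S g"
    and test: "\<And>\<phi>::'a \<Rightarrow> real. \<phi> \<in> test_functions S \<Longrightarrow> (\<integral>x. \<phi> x *\<^sub>R g x \<partial>lebesgue_on S) = 0"
  shows "AE x in lebesgue_on S. g x = 0"
proof -
  have box: "AE x in lebesgue. x \<in> cbox c d \<longrightarrow> g x = 0" if cd: "cbox c d \<subseteq> S" for c d
  proof -
    let ?f = "\<lambda>x. if x \<in> cbox c d then g x else 0"
    have "integrable (lebesgue_on (cbox c d)) g"
      using assms(2) cd by (simp add: loc_integrable_def)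
    then have "g absolutely_integrable_on cbox c d"
      by (simp add: set_integrable_def integrable_restrict_space)
    then have "?f absolutely_integrable_on UNIV"
      by (simp add: absolutely_integrable_restrict_UNIV)
    then have "?f integrable_on cbox a b" for a b
      using absolutely_integrable_on_subcbox set_lebesgue_integral_eq_integral(1)
      by (metis UNIV_I absolutely_integrable_on_def integrable_on_subcbox subset_UNIV)
    then obtain N where N: "negligible N"
      "\<And>x e. \<lbrakk>x \<notin> N; 0 < e\<rbrakk> \<Longrightarrow> \<exists>\<delta>>0. \<forall>h. 0 < h \<and> h < \<delta> \<longrightarrow>
          norm (integral (cbox x (x + h *\<^sub>R One)) ?f /\<^sub>R h ^ DIM('a) - ?f x) < e"
      using integrable_ccontinuous_explicit[of ?f] by blast
    have zero: "g x = 0" if x: "x \<notin> N" "x \<in> box c d" for x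
    proof (rule ccontr)
      assume "g x \<noteq> 0"
      then obtain \<delta> where \<delta>: "\<delta> > 0" "\<And>h. 0 < h \<Longrightarrow> h < \<delta> \<Longrightarrow>
          norm (integral (cbox x (x + h *\<^sub>R One)) ?f /\<^sub>R h ^ DIM('a) - ?f x) < norm (g x)"
        using N(2)[OF x(1), of "norm (g x)"] by auto
      obtain r where r: "r > 0" "ball x r \<subseteq> box c d"
        using x(2) open_box open_contains_ball by blast
      \<comment> \<open>The side is below the \<delta> of the differentiation theorem, and small
        enough that the l^1 bound of the norm keeps the cube inside the ball of radius r around
        x.\<close>
      define h where "h = min (\<delta> / 2) (r / (2 * DIM('a)))"
      have h: "0 < h" "h < \<delta>" "h * DIM('a) < r"
      proof -
        have "h * DIM('a) \<le> r / (2 * DIM('a)) * DIM('a)"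
          unfolding h_def by (intro mult_right_mono) auto
        then show "h * DIM('a) < r" using r by simp
      qed (use \<delta>(1) r(1) in \<open>auto simp: h_def min_def\<close>)
      have sub: "cbox x (x + h *\<^sub>R One) \<subseteq> cbox c d"
      proof
        fix y assume y: "y \<in> cbox x (x + h *\<^sub>R One)"
        have "norm (y - x) \<le> (\<Sum>i\<in>Basis. \<bar>(y - x) \<bullet> i\<bar>)" by (rule norm_le_l1)
        also have "\<dots> \<le> (\<Sum>i\<in>(Basis::'a set). h)"
          using y by (intro sum_mono) (auto simp: mem_box inner_simps)
        also have "\<dots> < r" using h(3) by (simp add: mult.commute)
        finally have "y \<in> ball x r" by (simp add: dist_norm norm_minus_commute)
        then show "y \<in> cbox c d" using r(2) box_subset_cbox by blast
      qed
      have "integral (cbox x (x + h *\<^sub>R One)) ?f = integral (cbox x (x + h *\<^sub>R One)) g"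
        using sub by (intro integral_cong) auto
      also have "\<dots> = 0"
        using integral_cbox_eq_0_if_test_integrals_eq_0[OF assms(1,2) _ test] sub cd by blast
      finally have "norm (g x) < norm (g x)"
        using \<delta>(2)[OF h(1,2)] x(2) box_subset_cbox[of c d] by auto
      then show False by simp
    qed
    have "AE x in lebesgue. x \<notin> N \<union> (cbox c d - box c d)"
      using AE_not_in[OF negligible_Un[OF N(1) negligible_frontier_interval[of c d],
        unfolded negligible_iff_null_sets]] .
    then show ?thesis by (rule eventually_mono) (use zero in blast)
  qed
  obtain D where D: "countable D" "D \<subseteq> Pow S" "\<And>X. X \<in> D \<Longrightarrow> \<exists>a b. X = cbox a b" "\<Union>D = S"
    by (rule open_countable_Union_open_cbox[OF \<open>open S\<close>]) metis
  have "AE x in lebesgue. \<forall>X\<in>D. x \<in> X \<longrightarrow> g x = 0"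
    unfolding AE_ball_countable[OF D(1)]
  proof
    fix X assume X: "X \<in> D"
    obtain a b where "X = cbox a b" using D(3)[OF X] by blast
    then show "AE x in lebesgue. x \<in> X \<longrightarrow> g x = 0" using box[of a b] D(2) X by auto
  qed
  then have "AE x in lebesgue. x \<in> S \<longrightarrow> g x = 0"
    by (rule eventually_mono) (use D(4) in blast)
  then show ?thesis using \<open>open S\<close> by (simp add: AE_restrict_space_iff)
qed

section \<open>Linearity and uniqueness of weak derivatives\<close>

lemma loc_integrable_lincomb:
  fixes u w :: "'a::euclidean_space \<Rightarrow> 'b::euclidean_space"
  assumes "loc_integrable S u" "loc_integrable S w" "bounded_linear L"
  shows "loc_integrable S (\<lambda>x. u x + L (w x))"
  using assms(1,2)
  by (auto simp: loc_integrable_def intro!: Bochner_Integration.integrable_add integrable_bounded_linear[OF assms(3)])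

lemma has_weak_partial_lincomb:
  fixes u w :: "'a::euclidean_space \<Rightarrow> 'b::euclidean_space"
  assumes "open S" "i \<in> Basis" "has_weak_partial S i u g" "has_weak_partial S i w h" "bounded_linear L"
  shows "has_weak_partial S i (\<lambda>x. u x + L (w x)) (\<lambda>x. g x + L (h x))"
proof -
  have loc: "loc_integrable S u" "loc_integrable S w" "loc_integrable S g" "loc_integrable S h"
    using assms by (auto simp: has_weak_partial_def)
  have scaleR: "r *\<^sub>R (a + L b) = r *\<^sub>R a + L (r *\<^sub>R b)" for r a b
    using assms(5) by (simp add: scaleR_add_right linear_simps)
  have *: "(\<integral>x. \<psi> x *\<^sub>R (a x + L (b x)) \<partial>lebesgue_on S)
      = (\<integral>x. \<psi> x *\<^sub>R a x \<partial>lebesgue_on S) + L (\<integral>x. \<psi> x *\<^sub>R b x \<partial>lebesgue_on S)"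
    if "integrable (lebesgue_on S) (\<lambda>x. \<psi> x *\<^sub>R a x)" "integrable (lebesgue_on S) (\<lambda>x. \<psi> x *\<^sub>R b x)"
    for \<psi> :: "'a \<Rightarrow> real" and a b
    unfolding scaleR using that integrable_bounded_linear[OF assms(5) that(2)]
    by (simp add: integral_bounded_linear[OF assms(5)])
  show ?thesis unfolding has_weak_partial_def
  proof (intro conjI allI impI)
    show "loc_integrable S (\<lambda>x. u x + L (w x))" "loc_integrable S (\<lambda>x. g x + L (h x))"
      by (rule loc_integrable_lincomb[OF _ _ assms(5)], rule loc, rule loc)+
    fix \<phi> :: "'a \<Rightarrow> real" assume \<phi>: "\<phi> \<in> test_functions S"
    note int = test_function_integrable[OF assms(1) _ \<phi>]
    have "(\<integral>x. frechet_derivative \<phi> (at x) i *\<^sub>R (u x + L (w x)) \<partial>lebesgue_on S)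
       = (\<integral>x. frechet_derivative \<phi> (at x) i *\<^sub>R u x \<partial>lebesgue_on S)
         + L (\<integral>x. frechet_derivative \<phi> (at x) i *\<^sub>R w x \<partial>lebesgue_on S)"
      by (rule *[OF int(2)[OF loc(1) assms(2)] int(2)[OF loc(2) assms(2)]])
    also have "\<dots> = - (\<integral>x. \<phi> x *\<^sub>R g x \<partial>lebesgue_on S) + L (- (\<integral>x. \<phi> x *\<^sub>R h x \<partial>lebesgue_on S))"
      using assms(3,4) \<phi> unfolding has_weak_partial_def by simp
    also have "\<dots> = - (\<integral>x. \<phi> x *\<^sub>R (g x + L (h x)) \<partial>lebesgue_on S)"
      using *[OF int(1)[OF loc(3)] int(1)[OF loc(4)]] assms(5) by (simp add: linear_simps)
    finally show "(\<integral>x. frechet_derivative \<phi> (at x) i *\<^sub>R (u x + L (w x)) \<partial>lebesgue_on S)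
        = - (\<integral>x. \<phi> x *\<^sub>R (g x + L (h x)) \<partial>lebesgue_on S)" .
  qed
qed

lemma has_weak_partial_diff:
  fixes u w :: "'a::euclidean_space \<Rightarrow> 'b::euclidean_space"
  assumes "open S" "i \<in> Basis" "has_weak_partial S i u g" "has_weak_partial S i w h"
  shows "has_weak_partial S i (\<lambda>x. u x - w x) (\<lambda>x. g x - h x)"
  using has_weak_partial_lincomb[OF assms bounded_linear_minus[OF bounded_linear_ident]] by simp

text \<open>The difference of two weak derivatives of u is a weak derivative of 0, so its integral
  against every test function vanishes.\<close>

lemma has_weak_partial_unique:
  fixes u :: "'a::euclidean_space \<Rightarrow> 'b::euclidean_space"
  assumes "open S" "i \<in> Basis" "has_weak_partial S i u g" "has_weak_partial S i u h"
  shows "AE x in lebesgue_on S. g x = h x"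
proof -
  have "has_weak_partial S i (\<lambda>x. 0) (\<lambda>x. g x - h x)"
    using has_weak_partial_diff[OF assms] by simp
  then have "AE x in lebesgue_on S. g x - h x = 0"
    by (intro AE_eq_0_if_test_integrals_eq_0 assms(1)) (simp_all add: has_weak_partial_def)
  then show ?thesis by simp
qed

lemma weak_partial_AE:
  fixes u :: "'a::euclidean_space \<Rightarrow> 'b::euclidean_space"
  assumes "open S" "i \<in> Basis" "has_weak_partial S i u g"
  shows "has_weak_partial S i u (weak_partial S i u)"
    and "AE x in lebesgue_on S. weak_partial S i u x = g x"
proof -
  show *: "has_weak_partial S i u (weak_partial S i u)"
    unfolding weak_partial_def by (rule someI[of "has_weak_partial S i u", OF assms(3)])
  show "AE x in lebesgue_on S. weak_partial S i u x = g x"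
    using has_weak_partial_unique[OF assms(1,2) * assms(3)] .
qed

text \<open>Local integrability gives measurability on compact subsets only; an open set is a
  countable union of closed boxes.\<close>

lemma loc_integrable_borel_measurable:
  assumes "open S" "loc_integrable S g"
  shows "g \<in> borel_measurable (lebesgue_on S)"
proof -
  obtain D where D: "countable D" "D \<subseteq> Pow S" "\<And>X. X \<in> D \<Longrightarrow> \<exists>a b. X = cbox a b" "\<Union>D = S"
    by (rule open_countable_Union_open_cbox[OF \<open>open S\<close>]) metis
  show ?thesis
  proof (rule measurable_piecewise_restrict[OF D(1)])
    fix X assume X: "X \<in> D"
    then have XS: "X \<subseteq> S" using D(2) by blast
    obtain a b where ab: "X = cbox a b" using X D(3) by blast
    have "integrable (lebesgue_on X) g"
      using assms(2) XS ab by (simp add: loc_integrable_def)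
    then show "g \<in> borel_measurable (restrict_space (lebesgue_on S) X)"
      using XS by (auto simp: restrict_restrict_space ab Int_absorb1 assms(1))
    show "X \<inter> space (lebesgue_on S) \<in> sets (lebesgue_on S)"
      using XS assms(1) ab by (auto simp: sets_restrict_space image_iff)
  qed (use D(4) in auto)
qed

lemma H1_weak_partial:
  fixes u :: "'a::euclidean_space \<Rightarrow> 'b::euclidean_space"
  assumes "open S" "u \<in> H1 S" "i \<in> Basis"
  shows "has_weak_partial S i u (weak_partial S i u)" "weak_partial S i u \<in> L2 S"
proof -
  obtain g where g: "g \<in> L2 S" "has_weak_partial S i u g"
    using assms by (auto simp: H1_def)
  note * = weak_partial_AE[OF assms(1,3) g(2)]
  show "has_weak_partial S i u (weak_partial S i u)" by (rule *(1))
  have "weak_partial S i u \<in> borel_measurable (lebesgue_on S)"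
    using *(1) by (intro loc_integrable_borel_measurable[OF assms(1)]) (simp add: has_weak_partial_def)
  moreover have "L2_normsq S (weak_partial S i u) = L2_normsq S g"
    unfolding L2_normsq_def using *(2) by (intro nn_integral_cong_AE) auto
  ultimately show "weak_partial S i u \<in> L2 S"
    using g(1) by (simp add: L2_def)
qed

lemma weak_partial_diff_AE:
  fixes u w :: "'a::euclidean_space \<Rightarrow> 'b::euclidean_space"
  assumes "open S" "u \<in> H1 S" "w \<in> H1 S" "i \<in> Basis"
  shows "AE x in lebesgue_on S.
    weak_partial S i (\<lambda>x. u x - w x) x = weak_partial S i u x - weak_partial S i w x"
  by (rule weak_partial_AE(2)[OF assms(1,4) has_weak_partial_diff[OF assms(1,4)
        H1_weak_partial(1)[OF assms(1,2,4)] H1_weak_partial(1)[OF assms(1,3,4)]]])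

section \<open>Hermitian forms\<close>

text \<open>X consists of actual functions, not of classes modulo null sets, so even an inner
  product is only semidefinite here. Positivity is left to the single lemmas, because the locale has
  to cover the form of an operator that is merely bounded below. Closure under u + c w generates all
  linear operations.\<close>

locale hermitian_form =
  fixes X :: "('a \<Rightarrow> complex) set" and h :: "('a \<Rightarrow> complex) \<Rightarrow> ('a \<Rightarrow> complex) \<Rightarrow> complex"
  assumes comb: "u \<in> X \<Longrightarrow> w \<in> X \<Longrightarrow> (\<lambda>z. u z + c * w z) \<in> X"
    and h_comb: "u \<in> X \<Longrightarrow> w \<in> X \<Longrightarrow> v \<in> X \<Longrightarrow> h (\<lambda>z. u z + c * w z) v = h u v + c * h w v"
    and h_cnj: "u \<in> X \<Longrightarrow> v \<in> X \<Longrightarrow> h v u = cnj (h u v)"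
begin

lemma h_comb_right:
  assumes "u \<in> X" "w \<in> X" "v \<in> X"
  shows "h v (\<lambda>z. u z + c * w z) = h v u + cnj c * h v w"
  using assms by (simp add: h_cnj[of _ v] h_comb comb)

lemma diff: "u \<in> X \<Longrightarrow> w \<in> X \<Longrightarrow> (\<lambda>z. u z - w z) \<in> X"
  using comb[of u w "-1"] by simp

lemma add: "u \<in> X \<Longrightarrow> w \<in> X \<Longrightarrow> (\<lambda>z. u z + w z) \<in> X"
  using comb[of u w 1] by simp

lemma scale: "u \<in> X \<Longrightarrow> (\<lambda>z. c * u z) \<in> X"
  using comb[of u u "c - 1"] by (simp add: algebra_simps)

lemma h_diff: "u \<in> X \<Longrightarrow> w \<in> X \<Longrightarrow> v \<in> X \<Longrightarrow> h (\<lambda>z. u z - w z) v = h u v - h w v"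
  using h_comb[of u w v "-1"] by simp

lemma h_scale: "u \<in> X \<Longrightarrow> v \<in> X \<Longrightarrow> h (\<lambda>z. c * u z) v = c * h u v"
  using h_comb[of u u v "c - 1"] by (simp add: algebra_simps)

lemma h_real: "u \<in> X \<Longrightarrow> h u u = complex_of_real (Re (h u u))"
  using h_cnj[of u u] by (simp add: complex_eq_iff)

lemma h_quad_comb:
  assumes "u \<in> X" "w \<in> X"
  shows "Re (h (\<lambda>z. u z + c * w z) (\<lambda>z. u z + c * w z))
    = Re (h u u) + 2 * Re (c * h w u) + (cmod c)\<^sup>2 * Re (h w w)"
proof -
  have "h (\<lambda>z. u z + c * w z) (\<lambda>z. u z + c * w z)
      = h u u + cnj c * h u w + c * h w u + (c * cnj c) * h w w"
    using assms by (simp add: h_comb h_comb_right comb algebra_simps)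
  moreover have "cnj c * h u w = cnj (c * h w u)"
    using assms by (simp add: h_cnj[of u w])
  ultimately show ?thesis by (simp add: complex_norm_square[symmetric] flip: of_real_power)
qed

lemma h_quad_scale: "u \<in> X \<Longrightarrow> Re (h (\<lambda>z. c * u z) (\<lambda>z. c * u z)) = (cmod c)\<^sup>2 * Re (h u u)"
  using h_cnj[of "\<lambda>z. c * u z" u]
  by (simp add: h_scale scale h_cnj[of u "\<lambda>z. c * u z"] complex_norm_square[symmetric] mult.assoc[symmetric]
      mult.commute[of _ "cnj c"] flip: of_real_power)

lemma h_parallelogram:
  assumes "u \<in> X" "w \<in> X"
  shows "Re (h (\<lambda>z. u z - w z) (\<lambda>z. u z - w z)) + Re (h (\<lambda>z. u z + w z) (\<lambda>z. u z + w z))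
    = 2 * Re (h u u) + 2 * Re (h w w)"
  using h_quad_comb[OF assms, of 1] h_quad_comb[OF assms, of "-1"] by simp

lemma sum_comb:
  assumes "u \<in> X" "\<And>k::nat. k < n \<Longrightarrow> e k \<in> X"
  shows "(\<lambda>z. u z + (\<Sum>k<n. c k * e k z)) \<in> X"
    and "v \<in> X \<Longrightarrow> h (\<lambda>z. u z + (\<Sum>k<n. c k * e k z)) v = h u v + (\<Sum>k<n. c k * h (e k) v)"
proof -
  have "(\<lambda>z. u z + (\<Sum>k<n. c k * e k z)) \<in> X
      \<and> (\<forall>v\<in>X. h (\<lambda>z. u z + (\<Sum>k<n. c k * e k z)) v = h u v + (\<Sum>k<n. c k * h (e k) v))"
    using assms(2)
  proof (induction n)
    case 0
    then show ?case using assms(1) by simp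
  next
    case (Suc n)
    then have IH: "(\<lambda>z. u z + (\<Sum>k<n. c k * e k z)) \<in> X"
      "\<forall>v\<in>X. h (\<lambda>z. u z + (\<Sum>k<n. c k * e k z)) v = h u v + (\<Sum>k<n. c k * h (e k) v)" by auto
    have e: "e n \<in> X" using Suc.prems by simp
    show ?case
      using comb[OF IH(1) e, of "c n"] h_comb[OF IH(1) e, of _ "c n"] IH(2)
      by (simp add: add.assoc)
  qed
  then show "(\<lambda>z. u z + (\<Sum>k<n. c k * e k z)) \<in> X"
    "v \<in> X \<Longrightarrow> h (\<lambda>z. u z + (\<Sum>k<n. c k * e k z)) v = h u v + (\<Sum>k<n. c k * h (e k) v)" by auto
qed

text \<open>Nonnegativity at u + r c w with c = \<open>cnj (h w u)\<close> is an inequality between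
  polynomials in the real r. Since h may be degenerate, h(w,w) = 0 is a separate case: the
  expression is then affine in r, which forces h(w,u) = 0.\<close>

lemma Cauchy_Schwarz:
  assumes pos: "\<And>u. u \<in> X \<Longrightarrow> 0 \<le> Re (h u u)" and uw: "u \<in> X" "w \<in> X"
  shows "(cmod (h u w))\<^sup>2 \<le> Re (h u u) * Re (h w w)"
proof -
  let ?c = "cnj (h w u)"
  have ineq: "0 \<le> Re (h u u) + 2 * r * (cmod (h w u))\<^sup>2 + r\<^sup>2 * (cmod (h w u))\<^sup>2 * Re (h w w)" for r
  proof -
    have "Re (complex_of_real r * ?c * h w u) = r * (cmod (h w u))\<^sup>2"
      by (simp add: mult.assoc complex_norm_square[symmetric] mult.commute[of "cnj _"] flip: of_real_power)
    then show ?thesis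
      using pos[OF comb[OF uw, of "complex_of_real r * ?c"]] h_quad_comb[OF uw, of "complex_of_real r * ?c"]
      by (simp add: norm_mult power_mult_distrib)
  qed
  have eq: "cmod (h u w) = cmod (h w u)" using uw by (simp add: h_cnj[of w u])
  show ?thesis
  proof (cases "Re (h w w) = 0")
    case True
    have "cmod (h w u) = 0"
    proof (rule ccontr)
      assume "cmod (h w u) \<noteq> 0"
      then have p: "(cmod (h w u))\<^sup>2 > 0" by simp
      \<comment> \<open>With this r the affine expression equals -h(u,u) - 2.\<close>
      show False
        using ineq[of "- (Re (h u u) + 1) / (cmod (h w u))\<^sup>2"] p pos[OF uw(1)] True
        by (simp add: nonzero_divide_eq_eq)
    qed
    then show ?thesis using True eq by simp
  next
    case False
    then have p: "Re (h w w) > 0" using pos[OF uw(2)] by linarith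
    have "0 \<le> Re (h u u) - (cmod (h w u))\<^sup>2 / Re (h w w)"
      using ineq[of "- 1 / Re (h w w)"] p by (simp add: power2_eq_square field_simps)
    then show ?thesis using p eq by (simp add: field_simps)
  qed
qed

lemma quad_tendsto:
  assumes pos: "\<And>u. u \<in> X \<Longrightarrow> 0 \<le> Re (h u u)"
    and X: "\<And>n. u n \<in> X" "w \<in> X" "v \<in> X"
    and lim: "(\<lambda>n. Re (h (\<lambda>z. u n z - w z) (\<lambda>z. u n z - w z))) \<longlonglongrightarrow> 0"
  shows "(\<lambda>n. h (u n) v) \<longlonglongrightarrow> h w v"
    and "(\<lambda>n. Re (h (u n) (u n))) \<longlonglongrightarrow> Re (h w w)"
proof -
  let ?d = "\<lambda>n z. u n z - w z"
  have d: "?d n \<in> X" for n using X diff by blast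
  have *: "(\<lambda>n. h (?d n) v) \<longlonglongrightarrow> 0" if v: "v \<in> X" for v
  proof -
    have "(\<lambda>n. sqrt (Re (h (?d n) (?d n)) * Re (h v v))) \<longlonglongrightarrow> sqrt (0 * Re (h v v))"
      by (rule tendsto_real_sqrt[OF tendsto_mult[OF lim tendsto_const]])
    moreover have "cmod (h (?d n) v) \<le> sqrt (Re (h (?d n) (?d n)) * Re (h v v))" for n
      by (rule real_le_rsqrt[OF Cauchy_Schwarz[OF pos d v]])
    ultimately show ?thesis
      using Lim_null_comparison[OF always_eventually, of "\<lambda>n. h (?d n) v"] by force
  qed
  have "(\<lambda>n. h (?d n) v + h w v) \<longlonglongrightarrow> 0 + h w v"
    by (rule tendsto_add[OF *[OF X(3)] tendsto_const])
  then show "(\<lambda>n. h (u n) v) \<longlonglongrightarrow> h w v"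
    using X by (simp add: h_diff)
  have "(\<lambda>n. Re (h w w) + 2 * Re (h (?d n) w) + Re (h (?d n) (?d n)))
      \<longlonglongrightarrow> Re (h w w) + 2 * Re 0 + 0"
    by (rule tendsto_add[OF tendsto_add[OF tendsto_const
        tendsto_mult[OF tendsto_const tendsto_Re[OF *[OF X(2)]]]] lim])
  moreover have "Re (h (u n) (u n)) = Re (h w w) + 2 * Re (h (?d n) w) + Re (h (?d n) (?d n))" for n
    using h_quad_comb[OF X(2) d, of 1 n] by simp
  ultimately show "(\<lambda>n. Re (h (u n) (u n))) \<longlonglongrightarrow> Re (h w w)" by simp
qed

end

text \<open>The form of a semibounded operator with compact resolvent: a lower bound -C,
  precompactness of form-bounded sets, closedness. \<open>compact\<close> delivers only a
  subsequence that is Cauchy for s; a limit comes from \<open>complete\<close>, once the sequence is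
  known to be Cauchy for B too.\<close>

locale semibounded_form = s: hermitian_form X s + B: hermitian_form X B
  for X :: "('a \<Rightarrow> complex) set" and s B +
  fixes C :: real
  assumes s_nonneg: "u \<in> X \<Longrightarrow> 0 \<le> Re (s u u)"
    and bounded_below: "u \<in> X \<Longrightarrow> - C * Re (s u u) \<le> Re (B u u)"
    and compact: "\<And>v K. (\<And>n. v n \<in> X) \<Longrightarrow> (\<And>n. Re (s (v n) (v n)) \<le> 1) \<Longrightarrow> (\<And>n. Re (B (v n) (v n)) \<le> K) \<Longrightarrow>
      \<exists>r :: nat \<Rightarrow> nat. strict_mono r \<and> (\<forall>e>0. \<exists>N. \<forall>m\<ge>N. \<forall>n\<ge>N.
        Re (s (\<lambda>z. v (r m) z - v (r n) z) (\<lambda>z. v (r m) z - v (r n) z)) < e)"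
    and complete: "\<And>v. (\<And>n. v n \<in> X) \<Longrightarrow>
      (\<forall>e>0. \<exists>N. \<forall>m\<ge>N. \<forall>n\<ge>N. Re (s (\<lambda>z. v m z - v n z) (\<lambda>z. v m z - v n z)) < e) \<Longrightarrow>
      (\<forall>e>0. \<exists>N. \<forall>m\<ge>N. \<forall>n\<ge>N. Re (B (\<lambda>z. v m z - v n z) (\<lambda>z. v m z - v n z)) < e) \<Longrightarrow>
      \<exists>w\<in>X. (\<lambda>n. Re (s (\<lambda>z. v n z - w z) (\<lambda>z. v n z - w z))) \<longlonglongrightarrow> 0
         \<and> (\<lambda>n. Re (B (\<lambda>z. v n z - w z) (\<lambda>z. v n z - w z))) \<longlonglongrightarrow> 0"
begin

definition orthonormal :: "nat \<Rightarrow> (nat \<Rightarrow> 'a \<Rightarrow> complex) \<Rightarrow> bool" where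
  "orthonormal n e \<longleftrightarrow> (\<forall>k<n. e k \<in> X) \<and> (\<forall>k<n. \<forall>l<n. s (e k) (e l) = (if k = l then 1 else 0))"

text \<open>The component of u orthogonal to e 0, ..., e (n-1). The sign sits in the coefficients so
  that \<open>sum_comb\<close> applies as it stands.\<close>

definition residual :: "nat \<Rightarrow> (nat \<Rightarrow> 'a \<Rightarrow> complex) \<Rightarrow> ('a \<Rightarrow> complex) \<Rightarrow> 'a \<Rightarrow> complex" where
  "residual n e u = (\<lambda>z. u z + (\<Sum>k<n. - s u (e k) * e k z))"

lemma residual:
  assumes "orthonormal n e" "u \<in> X"
  shows "residual n e u \<in> X"
    and "l < n \<Longrightarrow> s (residual n e u) (e l) = 0"
    and "Re (s (residual n e u) (residual n e u)) = Re (s u u) - (\<Sum>k<n. (cmod (s u (e k)))\<^sup>2)"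
proof -
  let ?y = "residual n e u"
  have e: "\<And>k. k < n \<Longrightarrow> e k \<in> X" "\<And>k l. k < n \<Longrightarrow> l < n \<Longrightarrow> s (e k) (e l) = (if k = l then 1 else 0)"
    using assms(1) by (auto simp: orthonormal_def)
  show y: "?y \<in> X" unfolding residual_def by (rule s.sum_comb(1)[OF assms(2) e(1)])
  have sy: "s ?y v = s u v + (\<Sum>k<n. - s u (e k) * s (e k) v)" if "v \<in> X" for v
    unfolding residual_def by (rule s.sum_comb(2)[OF assms(2) e(1) that])
  show orth: "s ?y (e l) = 0" if "l < n" for l
  proof -
    have "(\<Sum>k<n. - s u (e k) * s (e k) (e l)) = (\<Sum>k<n. if k = l then - s u (e l) else 0)"
      using that by (intro sum.cong) (auto simp: e(2))
    then show ?thesis using sy[OF e(1)[OF that]] that by simp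
  qed
  have "s (e k) ?y = 0" if "k < n" for k
    using s.h_cnj[OF y e(1)[OF that]] orth[OF that] by simp
  then have "s ?y ?y = s u ?y" using sy[OF y] by simp
  also have "s u ?y = cnj (s ?y u)" using s.h_cnj[OF y assms(2)] .
  also have "s ?y u = s u u + (\<Sum>k<n. - s u (e k) * cnj (s u (e k)))"
    using sy[OF assms(2)] s.h_cnj[OF assms(2) e(1)] by simp
  also have "\<dots> = s u u - (\<Sum>k<n. complex_of_real ((cmod (s u (e k)))\<^sup>2))"
    unfolding complex_norm_square by (simp add: sum_negf)
  finally show "Re (s ?y ?y) = Re (s u u) - (\<Sum>k<n. (cmod (s u (e k)))\<^sup>2)"
    by (simp del: of_real_power)
qed

lemma Bessel:
  assumes "orthonormal n e" "u \<in> X"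
  shows "(\<Sum>k<n. (cmod (s u (e k)))\<^sup>2) \<le> Re (s u u)"
  using residual[OF assms] s_nonneg[OF residual(1)[OF assms]] by simp

text \<open>The direct method for the infimum E of B on the unit sphere of a closed subspace Y.
  Compactness makes a minimizing sequence Cauchy for s, and near-minimality together with the
  parallelogram law makes it Cauchy for B. Nothing is differentiated: B - E s is nonnegative on Y
  and vanishes at the limit, so Cauchy-Schwarz puts the limit into its kernel, which is the
  eigenvalue equation tested on Y.\<close>

lemma minimizer_exists:
  assumes Y: "Y \<subseteq> X" "\<And>u w c. u \<in> Y \<Longrightarrow> w \<in> Y \<Longrightarrow> (\<lambda>z. u z + c * w z) \<in> Y"
    and closed: "\<And>u w. (\<And>n. u n \<in> Y) \<Longrightarrow> w \<in> X \<Longrightarrow>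
      (\<lambda>n. Re (s (\<lambda>z. u n z - w z) (\<lambda>z. u n z - w z))) \<longlonglongrightarrow> 0 \<Longrightarrow> w \<in> Y"
    and w0: "w0 \<in> Y" "Re (B w0 w0) < m * Re (s w0 w0)"
  shows "\<exists>E w. E < m \<and> w \<in> Y \<and> s w w = 1 \<and> (\<forall>\<phi>\<in>Y. B w \<phi> = complex_of_real E * s w \<phi>)"
proof -
  have YX: "u \<in> X" if "u \<in> Y" for u using Y(1) that by blast
  interpret Ys: hermitian_form Y s
    by unfold_locales (assumption | rule Y(2) s.h_comb s.h_cnj YX)+
  interpret YB: hermitian_form Y B
    by unfold_locales (assumption | rule Y(2) B.h_comb B.h_cnj YX)+
  define S where "S = {Re (B w w) | w. w \<in> Y \<and> Re (s w w) = 1}"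
  define E where "E = Inf S"
  have bdd: "bdd_below S"
  proof (rule bdd_belowI)
    fix x assume "x \<in> S"
    then obtain w where w: "x = Re (B w w)" "w \<in> Y" "Re (s w w) = 1" by (auto simp: S_def)
    then show "- C \<le> x" using bounded_below[OF YX[OF w(2)]] by simp
  qed
  have normalize: "\<exists>y\<in>Y. Re (s y y) = 1 \<and> Re (B y y) * Re (s u u) = Re (B u u)"
    if "u \<in> Y" "Re (s u u) > 0" for u
  proof -
    let ?c = "complex_of_real (1 / sqrt (Re (s u u)))"
    have c: "(cmod ?c)\<^sup>2 * Re (s u u) = 1"
      using that by (simp add: power_divide norm_divide)
    show ?thesis
    proof (intro bexI conjI)
      show "(\<lambda>z. ?c * u z) \<in> Y" by (rule Ys.scale[OF that(1)])
      show "Re (s (\<lambda>z. ?c * u z) (\<lambda>z. ?c * u z)) = 1"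
        unfolding Ys.h_quad_scale[OF that(1)] by (rule c)
      have "(cmod ?c)\<^sup>2 * Re (B u u) * Re (s u u) = Re (B u u) * ((cmod ?c)\<^sup>2 * Re (s u u))"
        by (simp only: mult_ac)
      then show "Re (B (\<lambda>z. ?c * u z) (\<lambda>z. ?c * u z)) * Re (s u u) = Re (B u u)"
        unfolding YB.h_quad_scale[OF that(1)] c by simp
    qed
  qed
  have lower: "E * Re (s u u) \<le> Re (B u u)" if u: "u \<in> Y" for u
  proof (cases "Re (s u u) = 0")
    \<comment> \<open>A vector of zero s-norm cannot be normalized; for it the lower bound of the
      form gives 0 \<le> B(u,u).\<close>
    case True
    then show ?thesis using bounded_below[OF YX[OF that]] by simp
  next
    case False
    then have p: "Re (s u u) > 0" using s_nonneg[OF YX[OF that]] by linarith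
    then obtain y where y: "y \<in> Y" "Re (s y y) = 1" "Re (B y y) * Re (s u u) = Re (B u u)"
      using normalize[OF u] by blast
    have "E \<le> Re (B y y)" unfolding E_def using y by (intro cInf_lower bdd) (auto simp: S_def)
    then show ?thesis using mult_right_mono[of E "Re (B y y)" "Re (s u u)"] p y(3) by simp
  qed
  have w0pos: "Re (s w0 w0) > 0"
    using s_nonneg[OF YX[OF w0(1)]] bounded_below[OF YX[OF w0(1)]] w0(2) by (cases "Re (s w0 w0) = 0") auto
  have "E * Re (s w0 w0) < m * Re (s w0 w0)" using lower[OF w0(1)] w0(2) by linarith
  then have "E < m" using w0pos by simp
  have "S \<noteq> {}" using normalize[OF w0(1) w0pos] by (auto simp: S_def)
  have "\<exists>w. w \<in> Y \<and> Re (s w w) = 1 \<and> Re (B w w) < E + inverse (real (Suc n))" for n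
    using cInf_lessD[OF \<open>S \<noteq> {}\<close>, of "E + inverse (real (Suc n))"] unfolding E_def[symmetric]
    by (auto simp: S_def)
  then obtain w where w: "\<And>n. w n \<in> Y" "\<And>n. Re (s (w n) (w n)) = 1"
    "\<And>n. Re (B (w n) (w n)) < E + inverse (real (Suc n))" by metis
  have B_le: "Re (B (w n) (w n)) \<le> E + 1" for n
  proof -
    have "inverse (real (Suc n)) \<le> 1" by (simp add: inverse_le_1_iff)
    then show ?thesis using w(3)[of n] by linarith
  qed
  have s_le: "Re (s (w n) (w n)) \<le> 1" for n using w(2)[of n] by simp
  obtain r :: "nat \<Rightarrow> nat" where r: "strict_mono r" and s_Cauchy: "\<forall>e>0. \<exists>N. \<forall>m\<ge>N. \<forall>n\<ge>N.
      Re (s (\<lambda>z. w (r m) z - w (r n) z) (\<lambda>z. w (r m) z - w (r n) z)) < e"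
    using compact[of w "E + 1", OF YX[OF w(1)] s_le B_le] by blast
  let ?u = "\<lambda>n. w (r n)"
  have u: "?u n \<in> Y" for n by (rule w(1))
  have B_u: "Re (B (?u n) (?u n)) < E + inverse (real (Suc n))" for n
  proof -
    have "inverse (real (Suc (r n))) \<le> inverse (real (Suc n))"
      using seq_suble[OF r, of n] by (intro le_imp_inverse_le) auto
    then show ?thesis using w(3)[of "r n"] by linarith
  qed
  \<comment> \<open>By the parallelogram law B(d) = 2 B(u_m) + 2 B(u_n) - B(p), where B(p) \<ge> E
    s(p) and s(p) = 4 - s(d) by normalization; the two multiples 4 E cancel.\<close>
  have B_diff: "Re (B (\<lambda>z. ?u m z - ?u n z) (\<lambda>z. ?u m z - ?u n z))
      \<le> 2 * inverse (real (Suc m)) + 2 * inverse (real (Suc n))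
        + \<bar>E\<bar> * Re (s (\<lambda>z. ?u m z - ?u n z) (\<lambda>z. ?u m z - ?u n z))" for m n
  proof -
    let ?d = "\<lambda>z. ?u m z - ?u n z" and ?p = "\<lambda>z. ?u m z + ?u n z"
    have "Re (B ?d ?d) + Re (B ?p ?p) = 2 * Re (B (?u m) (?u m)) + 2 * Re (B (?u n) (?u n))"
      by (rule YB.h_parallelogram[OF u u])
    moreover have "Re (s ?d ?d) + Re (s ?p ?p) = 4"
      using Ys.h_parallelogram[OF u u, of m n] w(2) by simp
    moreover have "E * Re (s ?p ?p) \<le> Re (B ?p ?p)"
      by (rule lower[OF Ys.add[OF u u]])
    moreover have "E * Re (s ?d ?d) \<le> \<bar>E\<bar> * Re (s ?d ?d)"
      using s_nonneg[OF YX[OF Ys.diff[OF u u]], of m n] by (intro mult_right_mono) auto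
    moreover have "E * Re (s ?d ?d) + E * Re (s ?p ?p) = E * 4"
      unfolding distrib_left[symmetric] using calculation(2) by (simp only:)
    ultimately show ?thesis using B_u[of m] B_u[of n] by linarith
  qed
  have B_Cauchy: "\<forall>e>0. \<exists>N. \<forall>m\<ge>N. \<forall>n\<ge>N. Re (B (\<lambda>z. ?u m z - ?u n z) (\<lambda>z. ?u m z - ?u n z)) < e"
  proof (intro allI impI)
    fix e :: real assume "e > 0"
    \<comment> \<open>This tolerance makes the last term of \<open>B_diff\<close> at most e/2; the
      two terms 2/(n+1) stay below e/4 each once 1/(n+1) < e/8.\<close>
    obtain N1 where N1: "\<And>m n. m \<ge> N1 \<Longrightarrow> n \<ge> N1 \<Longrightarrow>
        Re (s (\<lambda>z. ?u m z - ?u n z) (\<lambda>z. ?u m z - ?u n z)) < e / (2 * (\<bar>E\<bar> + 1))"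
      using s_Cauchy[rule_format, of "e / (2 * (\<bar>E\<bar> + 1))"] \<open>e > 0\<close> by (auto simp: field_simps)
    obtain N2 where N2: "inverse (real (Suc N2)) < e / 8"
      using reals_Archimedean[of "e / 8"] \<open>e > 0\<close> by auto
    show "\<exists>N. \<forall>m\<ge>N. \<forall>n\<ge>N. Re (B (\<lambda>z. ?u m z - ?u n z) (\<lambda>z. ?u m z - ?u n z)) < e"
    proof (intro exI[of _ "max N1 N2"] allI impI)
      fix m n assume mn: "m \<ge> max N1 N2" "n \<ge> max N1 N2"
      have inv: "inverse (real (Suc k)) < e / 8" if "k \<ge> N2" for k
        by (rule le_less_trans[OF le_imp_inverse_le N2]) (use that in simp_all)
      have "inverse (real (Suc m)) < e / 8" "inverse (real (Suc n)) < e / 8"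
        using mn by (simp_all only: inv max.bounded_iff)
      moreover have "\<bar>E\<bar> * Re (s (\<lambda>z. ?u m z - ?u n z) (\<lambda>z. ?u m z - ?u n z))
          \<le> \<bar>E\<bar> * (e / (2 * (\<bar>E\<bar> + 1)))"
        using N1[of m n] mn by (intro mult_left_mono) auto
      moreover have "\<bar>E\<bar> * (e / (2 * (\<bar>E\<bar> + 1))) \<le> e / 2"
        using \<open>e > 0\<close> by (simp add: field_simps)
      ultimately show "Re (B (\<lambda>z. ?u m z - ?u n z) (\<lambda>z. ?u m z - ?u n z)) < e"
        using B_diff[of m n] by linarith
    qed
  qed
  obtain w' where w': "w' \<in> X"
    "(\<lambda>n. Re (s (\<lambda>z. ?u n z - w' z) (\<lambda>z. ?u n z - w' z))) \<longlonglongrightarrow> 0"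
    "(\<lambda>n. Re (B (\<lambda>z. ?u n z - w' z) (\<lambda>z. ?u n z - w' z))) \<longlonglongrightarrow> 0"
    using complete[of ?u, OF YX[OF u] s_Cauchy B_Cauchy] by blast
  have w'Y: "w' \<in> Y" using closed[of ?u, OF u w'(1,2)] .
  have "(\<lambda>n. Re (s (?u n) (?u n))) \<longlonglongrightarrow> Re (s w' w')"
    by (rule s.quad_tendsto(2)[OF s_nonneg YX[OF u] w'(1) w'(1) w'(2)])
  then have s1: "Re (s w' w') = 1" by (simp add: w(2) LIMSEQ_const_iff)
  \<comment> \<open>Nonnegative on Y by the choice of E; its zeros form its kernel.\<close>
  let ?q = "\<lambda>u v. B u v - complex_of_real E * s u v"
  interpret q: hermitian_form Y ?q
  proof
    fix u w v c assume u: "u \<in> Y"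
    show "(\<lambda>z. u z + c * w z) \<in> Y" if "w \<in> Y" by (rule Y(2)[OF u that])
    show "?q (\<lambda>z. u z + c * w z) v = ?q u v + c * ?q w v" if "w \<in> Y" "v \<in> Y"
      using u that by (simp add: Ys.h_comb YB.h_comb algebra_simps)
    show "?q v u = cnj (?q u v)" if "v \<in> Y"
      unfolding Ys.h_cnj[OF u that] YB.h_cnj[OF u that] by simp
  qed
  have q_nonneg: "0 \<le> Re (?q u u)" if "u \<in> Y" for u using lower[OF that] by simp
  have "(\<lambda>n. Re (?q (\<lambda>z. ?u n z - w' z) (\<lambda>z. ?u n z - w' z))) \<longlonglongrightarrow> 0"
    using tendsto_diff[OF w'(3) tendsto_mult_left[OF w'(2), of E]] by simp
  then have "(\<lambda>n. Re (?q (?u n) (?u n))) \<longlonglongrightarrow> Re (?q w' w')"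
    by (intro q.quad_tendsto(2)[where u = ?u and w = w' and v = w'] q_nonneg u w'Y)
  moreover have "(\<lambda>n. Re (?q (?u n) (?u n))) \<longlonglongrightarrow> 0"
  proof (rule tendsto_sandwich[OF _ _ tendsto_const LIMSEQ_inverse_real_of_nat])
    show "\<forall>\<^sub>F n in sequentially. 0 \<le> Re (?q (?u n) (?u n))"
      using q_nonneg u by (intro always_eventually) blast
    show "\<forall>\<^sub>F n in sequentially. Re (?q (?u n) (?u n)) \<le> inverse (real (Suc n))"
      using B_u w(2) by (intro always_eventually) (simp add: less_imp_le algebra_simps)
  qed
  ultimately have q0: "Re (?q w' w') = 0" using LIMSEQ_unique by blast
  show ?thesis
  proof (intro exI conjI ballI)
    show "E < m" "w' \<in> Y" by fact+
    show "s w' w' = 1" using Ys.h_real[OF w'Y] s1 by simp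
    show "B w' \<phi> = complex_of_real E * s w' \<phi>" if "\<phi> \<in> Y" for \<phi>
      using q.Cauchy_Schwarz[OF q_nonneg w'Y that] q0 by simp
  qed
qed

text \<open>The variational principle: if the form fell below \<open>m\<close> on the complement of the eigenvectors
  with eigenvalue below \<open>m\<close>, its minimizer there would be an eigenvector that is not counted.\<close>

lemma eigenvalue_lower_bound:
  assumes "mono lam" and fin: "\<And>E. finite {j. lam j = E}"
    and e: "\<And>n. orthonormal n e"
    and eig: "\<And>k \<phi>. \<phi> \<in> X \<Longrightarrow> B (e k) \<phi> = complex_of_real (lam k) * s (e k) \<phi>"
    and mult: "\<And>E n v. orthonormal n v \<Longrightarrow>
      (\<And>k \<phi>. k < n \<Longrightarrow> \<phi> \<in> X \<Longrightarrow> B (v k) \<phi> = complex_of_real E * s (v k) \<phi>) \<Longrightarrow>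
      n \<le> card {j. lam j = E}"
  obtains K where "{k. lam k < m} = {..<K}"
    and "\<And>u. u \<in> X \<Longrightarrow> m * Re (s u u) - (\<Sum>k<K. (m - lam k) * (cmod (s u (e k)))\<^sup>2) \<le> Re (B u u)"
proof -
  have eX: "e k \<in> X" and see: "s (e k) (e l) = (if k = l then 1 else 0)" for k l
    using e[of "Suc (max k l)"] by (auto simp: orthonormal_def)
  \<comment> \<open>Otherwise the \<open>e k\<close> would be a form-bounded orthonormal sequence.
    Its members have squared distance 2 from one another, so no subsequence is Cauchy.\<close>
  have "\<exists>k. m \<le> lam k"
  proof (rule ccontr)
    assume "\<not> (\<exists>k. m \<le> lam k)"
    then have "Re (B (e k) (e k)) \<le> m" for k
      using eig[OF eX, of k k] see[of k k] by (auto simp: not_le intro: less_imp_le)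
    then have Be: "Re (B (e k) (e k)) \<le> m" for k by blast
    have se: "Re (s (e k) (e k)) \<le> 1" for k using see[of k k] by simp
    obtain r :: "nat \<Rightarrow> nat" where r: "strict_mono r" and Cau: "\<forall>\<epsilon>>0. \<exists>N. \<forall>m\<ge>N. \<forall>n\<ge>N.
        Re (s (\<lambda>z. e (r m) z - e (r n) z) (\<lambda>z. e (r m) z - e (r n) z)) < \<epsilon>"
      using compact[of e m, OF eX se Be] by blast
    obtain N where N: "\<And>m n. m \<ge> N \<Longrightarrow> n \<ge> N \<Longrightarrow>
        Re (s (\<lambda>z. e (r m) z - e (r n) z) (\<lambda>z. e (r m) z - e (r n) z)) < 1"
      using Cau[rule_format, OF zero_less_one] by blast
    have ne: "r N \<noteq> r (Suc N)" using strict_monoD[OF r, of N "Suc N"] by simp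
    have "Re (s (\<lambda>z. e (r N) z - e (r (Suc N)) z) (\<lambda>z. e (r N) z - e (r (Suc N)) z)) = 2"
      using s.h_quad_comb[OF eX[of "r N"] eX[of "r (Suc N)"], of "-1"] see ne by simp
    then show False using N[of N "Suc N"] by simp
  qed
  then obtain k0 where k0: "m \<le> lam k0" by blast
  define K where "K = (LEAST k. m \<le> lam k)"
  have K: "m \<le> lam K" "\<And>k. m \<le> lam k \<Longrightarrow> K \<le> k"
    unfolding K_def by (rule LeastI[of "\<lambda>k. m \<le> lam k", OF k0], rule Least_le)
  have setK: "{k. lam k < m} = {..<K}"
    using K monoD[OF \<open>mono lam\<close>, of K] by (fastforce simp: not_le not_less)
  define Y where "Y = {w \<in> X. \<forall>k<K. s w (e k) = 0}"
  have ge: "m * Re (s w w) \<le> Re (B w w)" if w: "w \<in> Y" for w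
  proof (rule ccontr)
    assume "\<not> m * Re (s w w) \<le> Re (B w w)"
    then have less: "Re (B w w) < m * Re (s w w)" by simp
    have Y1: "Y \<subseteq> X" by (auto simp: Y_def)
    have Y2: "(\<lambda>z. u z + c * v z) \<in> Y" if "u \<in> Y" "v \<in> Y" for u v c
      using that s.comb s.h_comb eX by (auto simp: Y_def)
    have Y3: "v \<in> Y" if u: "\<And>n. u n \<in> Y" and v: "v \<in> X"
      and lim: "(\<lambda>n. Re (s (\<lambda>z. u n z - v z) (\<lambda>z. u n z - v z))) \<longlonglongrightarrow> 0" for u v
    proof -
      have lim_e: "(\<lambda>n. s (u n) (e k)) \<longlonglongrightarrow> s v (e k)" for k
        by (rule s.quad_tendsto(1)[OF s_nonneg _ v eX lim]) (use u Y1 in auto)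
      have "s v (e k) = 0" if "k < K" for k
      proof -
        have "s (u n) (e k) = 0" for n using u that by (simp add: Y_def)
        then show ?thesis using lim_e[of k] by (simp add: LIMSEQ_const_iff)
      qed
      then show ?thesis using v by (simp add: Y_def)
    qed
    have "\<exists>E v. E < m \<and> v \<in> Y \<and> s v v = 1 \<and> (\<forall>\<phi>\<in>Y. B v \<phi> = complex_of_real E * s v \<phi>)"
    proof (rule minimizer_exists[of Y w m])
      show "v \<in> Y" if "\<And>n. u n \<in> Y" "v \<in> X"
        "(\<lambda>n. Re (s (\<lambda>z. u n z - v z) (\<lambda>z. u n z - v z))) \<longlonglongrightarrow> 0" for u v
        using that by (rule Y3)
      show "(\<lambda>z. u z + c * v z) \<in> Y" if "u \<in> Y" "v \<in> Y" for u v c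
        using that by (rule Y2)
    qed (fact Y1 w less)+
    then obtain E v where E: "E < m" "v \<in> Y" "s v v = 1"
      "\<And>\<phi>. \<phi> \<in> Y \<Longrightarrow> B v \<phi> = complex_of_real E * s v \<phi>"
      by blast
    have vX: "v \<in> X" and ve: "\<And>k. k < K \<Longrightarrow> s v (e k) = 0" using E(2) by (auto simp: Y_def)
    have ev: "s (e k) v = 0" if "k < K" for k using s.h_cnj[OF vX eX] ve[OF that] by simp
    \<comment> \<open>The equation is known for test vectors in Y. A general \<phi> differs from its
      residual by a combination of the \<open>e k\<close> with k < K, on which both sides vanish,
      since these are eigenvectors orthogonal to v.\<close>
    have eig_v: "B v \<phi> = complex_of_real E * s v \<phi>" if \<phi>: "\<phi> \<in> X" for \<phi>
    proof -
      let ?c = "\<lambda>k. - s \<phi> (e k)"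
      have yY: "residual K e \<phi> \<in> Y" using residual(1,2)[OF e \<phi>] by (auto simp: Y_def)
      then have yX: "residual K e \<phi> \<in> X" using Y1 by blast
      have "s (residual K e \<phi>) v = s \<phi> v"
        using s.sum_comb(2)[OF \<phi> eX vX, where n = K and c = "?c"] ev by (simp add: residual_def)
      moreover have "B (residual K e \<phi>) v = B \<phi> v"
        using B.sum_comb(2)[OF \<phi> eX vX, where n = K and c = "?c"] ev eig[OF vX] by (simp add: residual_def)
      moreover have "B (residual K e \<phi>) v = complex_of_real E * s (residual K e \<phi>) v"
        using E(4)[OF yY] B.h_cnj[OF vX yX] s.h_cnj[OF vX yX] by simp
      ultimately have "B \<phi> v = complex_of_real E * s \<phi> v" by simp
      then show ?thesis
        unfolding B.h_cnj[OF \<phi> vX] s.h_cnj[OF \<phi> vX] by simp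
    qed
    define J where "J = {j. lam j = E}"
    define p where "p = card J"
    obtain f where f: "bij_betw f {..<p} J"
      using ex_bij_betw_nat_finite[OF fin[of E]] by (auto simp: p_def J_def atLeast0LessThan)
    have fJ: "lam (f k) = E" "f k < K" if "k < p" for k
    proof -
      have "f k \<in> J" using f that by (auto simp: bij_betw_def)
      then show "lam (f k) = E" by (simp add: J_def)
      then show "f k < K" using E(1) setK by auto
    qed
    \<comment> \<open>Since E < m, every listed eigenvector with eigenvalue E has index below K and
      is orthogonal to v; adjoining v gives one orthonormal eigenvector more than the multiplicity
      allows.\<close>
    define v' where "v' k = (if k < p then e (f k) else v)" for k
    have "Suc p \<le> card {j. lam j = E}"
    proof (rule mult)
      show "orthonormal (Suc p) v'"
        unfolding orthonormal_def
      proof (intro conjI allI impI)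
        fix k l assume "k < Suc p" "l < Suc p"
        then show "s (v' k) (v' l) = (if k = l then 1 else 0)"
          using fJ(2) ve ev E(3) inj_onD[OF bij_betw_imp_inj_on[OF f], of k l]
          by (auto simp: v'_def see less_Suc_eq)
      qed (use vX eX in \<open>auto simp: v'_def\<close>)
      show "B (v' k) \<phi> = complex_of_real E * s (v' k) \<phi>" if "k < Suc p" "\<phi> \<in> X" for k \<phi>
        using that eig[OF that(2), of "f k"] eig_v[OF that(2)] fJ(1) by (auto simp: v'_def)
    qed
    then show False by (simp add: p_def J_def)
  qed
  show ?thesis
  proof (rule that[OF setK])
    fix u assume u: "u \<in> X"
    let ?y = "residual K e u" and ?c = "\<lambda>k. - s u (e k)"
    note res = residual[where n = K, OF e u]
    have ey: "s (e k) ?y = 0" if "k < K" for k using s.h_cnj[OF res(1) eX] res(2)[OF that] by simp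
    \<comment> \<open>u splits into its projection on the \<open>e k\<close> and the residual, which
      lies in Y. The form has no cross terms between the two and is diagonal with entries
      \<open>lam k\<close> on the projection.\<close>
    have "B ?y ?y = B u ?y"
      using B.sum_comb(2)[OF u eX res(1), where n = K and c = "?c"] ey eig[OF res(1)] by (simp add: residual_def)
    also have "\<dots> = cnj (B ?y u)" by (rule B.h_cnj[OF res(1) u])
    also have "B ?y u = B u u + (\<Sum>k<K. - s u (e k) * (complex_of_real (lam k) * cnj (s u (e k))))"
      using B.sum_comb(2)[OF u eX u, where n = K and c = "?c"] eig[OF u] s.h_cnj[OF u eX] by (simp add: residual_def)
    also have "\<dots> = B u u - (\<Sum>k<K. complex_of_real (lam k * (cmod (s u (e k)))\<^sup>2))"
      unfolding of_real_mult complex_norm_square by (simp add: sum_negf mult_ac)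
    finally have By: "Re (B ?y ?y) = Re (B u u) - (\<Sum>k<K. lam k * (cmod (s u (e k)))\<^sup>2)"
      by (simp del: of_real_power of_real_mult)
    have "m * (Re (s u u) - (\<Sum>k<K. (cmod (s u (e k)))\<^sup>2)) \<le> Re (B ?y ?y)"
      using ge[of ?y] res by (auto simp: Y_def)
    then show "m * Re (s u u) - (\<Sum>k<K. (m - lam k) * (cmod (s u (e k)))\<^sup>2) \<le> Re (B u u)"
      unfolding By by (simp add: algebra_simps sum_distrib_left sum_subtractf)
  qed
qed

end

section \<open>The spaces $L^2(0,1)$ and $H^1_0(0,1)$\<close>

abbreviation lebesgue_unit :: "real measure" where
  "lebesgue_unit \<equiv> lebesgue_on unit_ivl"

abbreviation nsq :: "(real \<Rightarrow> complex) \<Rightarrow> real" where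
  "nsq u \<equiv> Re (L2_inner u u)"

abbreviation D1 :: "(real \<Rightarrow> complex) \<Rightarrow> real \<Rightarrow> complex" where
  "D1 \<equiv> weak_partial unit_ivl 1"

abbreviation L2u :: "(real \<Rightarrow> complex) set" where
  "L2u \<equiv> L2 unit_ivl"

lemma finite_measure_lebesgue_unit: "finite_measure lebesgue_unit"
  by (rule finite_measureI) (simp add: emeasure_restrict_space)

lemma emeasure_lebesgue_unit: "emeasure lebesgue_unit (space lebesgue_unit) = 1"
  by (simp add: emeasure_restrict_space)

lemma L2_iff:
  fixes S :: "'a::euclidean_space set" and u :: "'a \<Rightarrow> 'b::euclidean_space"
  shows "u \<in> L2 S \<longleftrightarrow> u \<in> borel_measurable (lebesgue_on S) \<and> integrable (lebesgue_on S) (\<lambda>z. (norm (u z))\<^sup>2)"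
  by (auto simp: L2_def L2_normsq_def integrable_iff_bounded)

lemma L2_normsq_eq:
  fixes S :: "'a::euclidean_space set" and u :: "'a \<Rightarrow> 'b::euclidean_space"
  assumes "u \<in> L2 S"
  shows "L2_normsq S u = ennreal (\<integral>z. (norm (u z))\<^sup>2 \<partial>lebesgue_on S)"
  unfolding L2_normsq_def using assms by (intro nn_integral_eq_integral) (auto simp: L2_iff)

lemma nsq_eq: "nsq u = (\<integral>z. (cmod (u z))\<^sup>2 \<partial>lebesgue_unit)"
proof -
  have "L2_inner u u = (\<integral>z. complex_of_real ((cmod (u z))\<^sup>2) \<partial>lebesgue_unit)"
    unfolding L2_inner_def complex_norm_square ..
  then show ?thesis by (simp only: integral_complex_of_real Re_complex_of_real)
qed

lemma nsq_nonneg: "0 \<le> nsq u"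
  unfolding nsq_eq by (rule Bochner_Integration.integral_nonneg) simp

lemma measurable_cnj [measurable]: "u \<in> borel_measurable M \<Longrightarrow> (\<lambda>z. cnj (u z)) \<in> borel_measurable M"
  by (rule borel_measurable_continuous_on[where f = cnj]) (simp_all add: continuous_on_cnj)

lemma L2_mult_integrable:
  assumes "u \<in> L2u" "w \<in> L2u"
  shows "integrable lebesgue_unit (\<lambda>z. u z * cnj (w z))"
proof -
  have [measurable]: "u \<in> borel_measurable lebesgue_unit" "w \<in> borel_measurable lebesgue_unit"
    using assms by (simp_all add: L2_iff)
  have "integrable lebesgue_unit (\<lambda>z. (cmod (u z))\<^sup>2 + (cmod (w z))\<^sup>2)"
    using assms by (simp add: L2_iff)
  then show ?thesis
  proof (rule Bochner_Integration.integrable_bound)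
    have "cmod (u z) * cmod (w z) \<le> (cmod (u z))\<^sup>2 + (cmod (w z))\<^sup>2" for z
    proof -
      have "2 * (cmod (u z) * cmod (w z)) \<le> (cmod (u z))\<^sup>2 + (cmod (w z))\<^sup>2"
        using sum_squares_bound[of "cmod (u z)" "cmod (w z)"] by (simp add: mult.assoc)
      then show ?thesis
        using mult_nonneg_nonneg[OF norm_ge_zero norm_ge_zero, of "u z" "w z"] by linarith
    qed
    then show "AE z in lebesgue_unit. norm (u z * cnj (w z)) \<le> norm ((cmod (u z))\<^sup>2 + (cmod (w z))\<^sup>2)"
      by (intro AE_I2) (simp add: norm_mult)
  qed measurable
qed

lemma L2_comb:
  assumes "u \<in> L2u" "w \<in> L2u"
  shows "(\<lambda>z. u z + c * w z) \<in> L2u"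
proof -
  have [measurable]: "u \<in> borel_measurable lebesgue_unit" "w \<in> borel_measurable lebesgue_unit"
    using assms by (simp_all add: L2_iff)
  have "integrable lebesgue_unit (\<lambda>z. 2 * (cmod (u z))\<^sup>2 + 2 * (cmod c)\<^sup>2 * (cmod (w z))\<^sup>2)"
    using assms by (simp add: L2_iff)
  then have "integrable lebesgue_unit (\<lambda>z. (cmod (u z + c * w z))\<^sup>2)"
  proof (rule Bochner_Integration.integrable_bound)
    have "(cmod (u z + c * w z))\<^sup>2 \<le> 2 * (cmod (u z))\<^sup>2 + 2 * (cmod c)\<^sup>2 * (cmod (w z))\<^sup>2" for z
    proof -
      have "(cmod (u z + c * w z))\<^sup>2 \<le> (cmod (u z) + cmod c * cmod (w z))\<^sup>2"
        using norm_triangle_ineq[of "u z" "c * w z"] by (intro power_mono) (simp_all add: norm_mult)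
      also have "\<dots> \<le> 2 * (cmod (u z))\<^sup>2 + 2 * (cmod c * cmod (w z))\<^sup>2"
        using sum_squares_bound[of "cmod (u z)" "cmod c * cmod (w z)"] by (simp add: power2_sum)
      finally show ?thesis by (simp add: power_mult_distrib)
    qed
    then show "AE z in lebesgue_unit. norm ((cmod (u z + c * w z))\<^sup>2)
        \<le> norm (2 * (cmod (u z))\<^sup>2 + 2 * (cmod c)\<^sup>2 * (cmod (w z))\<^sup>2)"
      by (intro AE_I2) simp
  qed measurable
  then show ?thesis by (simp add: L2_iff)
qed

interpretation L2: hermitian_form L2u L2_inner
proof
  fix u w v :: "real \<Rightarrow> complex" and c assume u: "u \<in> L2u"
  show "(\<lambda>z. u z + c * w z) \<in> L2u" if "w \<in> L2u" using u that by (rule L2_comb)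
  show "L2_inner (\<lambda>z. u z + c * w z) v = L2_inner u v + c * L2_inner w v" if w: "w \<in> L2u" "v \<in> L2u"
    unfolding L2_inner_def using L2_mult_integrable[OF u w(2)] L2_mult_integrable[OF w]
    by (simp add: distrib_right mult.assoc)
  show "L2_inner v u = cnj (L2_inner u v)" if "v \<in> L2u"
    unfolding L2_inner_def by (subst Bochner_Integration.integral_cnj[symmetric]) (simp add: mult.commute)
qed

lemma nsq_add_le:
  assumes "u \<in> L2u" "w \<in> L2u"
  shows "nsq (\<lambda>z. u z + w z) \<le> 2 * nsq u + 2 * nsq w"
  using L2.h_parallelogram[OF assms] nsq_nonneg[of "\<lambda>z. u z - w z"] by linarith

lemma nsq_triangle:
  assumes "u \<in> L2u" "v \<in> L2u" "w \<in> L2u"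
  shows "nsq (\<lambda>z. u z - w z) \<le> 2 * nsq (\<lambda>z. u z - v z) + 2 * nsq (\<lambda>z. v z - w z)"
  using nsq_add_le[OF L2.diff[OF assms(1,2)] L2.diff[OF assms(2,3)]] by simp

lemma nsq_cong_AE:
  assumes "AE z in lebesgue_unit. u z = w z" "u \<in> borel_measurable lebesgue_unit" "w \<in> borel_measurable lebesgue_unit"
  shows "nsq u = nsq w"
  unfolding nsq_eq using assms by (intro integral_cong_AE) auto

lemma L2_inner_cong_AE:
  assumes "AE z in lebesgue_unit. u z = u' z" "AE z in lebesgue_unit. w z = w' z"
    and [measurable]: "u \<in> borel_measurable lebesgue_unit" "w \<in> borel_measurable lebesgue_unit"
      "u' \<in> borel_measurable lebesgue_unit" "w' \<in> borel_measurable lebesgue_unit"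
  shows "L2_inner u w = L2_inner u' w'"
  unfolding L2_inner_def
  by (rule integral_cong_AE) (use assms(1,2) in \<open>measurable, auto\<close>)

lemma bounded_measurable_L2:
  assumes "u \<in> borel_measurable lebesgue_unit" "\<And>z. z \<in> unit_ivl \<Longrightarrow> cmod (u z) \<le> C"
  shows "u \<in> L2u"
proof -
  interpret finite_measure lebesgue_unit by (rule finite_measure_lebesgue_unit)
  have "integrable lebesgue_unit (\<lambda>z. (cmod (u z))\<^sup>2)"
    using assms by (intro integrable_const_bound[of _ "C\<^sup>2"] AE_I2) (auto intro!: power_mono)
  then show ?thesis using assms by (simp add: L2_iff)
qed

lemma continuous_L2:
  assumes "continuous_on {0..1} u"
  shows "u \<in> L2u"
proof -
  obtain C where "\<And>z. z \<in> {0..1} \<Longrightarrow> cmod (u z) \<le> C"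
    using compact_imp_bounded[OF compact_continuous_image[OF assms compact_Icc]]
    unfolding bounded_iff by blast
  moreover have "continuous_on unit_ivl u" by (rule continuous_on_subset[OF assms]) auto
  then have "u \<in> borel_measurable lebesgue_unit"
    by (rule continuous_imp_measurable_on_sets_lebesgue) simp
  ultimately show ?thesis by (intro bounded_measurable_L2[of u C]) auto
qed

lemma integral_lebesgue_unit:
  fixes f :: "real \<Rightarrow> 'b::euclidean_space"
  assumes "integrable lebesgue_unit f"
  shows "(\<integral>z. f z \<partial>lebesgue_unit) = integral {0..1} f"
  using lebesgue_integral_eq_integral[OF assms] by (simp add: integral_open_interval_real)

lemma L2_imp_integrable:
  assumes "u \<in> L2u"
  shows "integrable lebesgue_unit u"
  using L2_mult_integrable[OF assms continuous_L2[of "\<lambda>_. 1"]] by simp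

section \<open>Test functions on the unit interval\<close>

abbreviation d1 :: "(real \<Rightarrow> 'b::real_normed_vector) \<Rightarrow> real \<Rightarrow> 'b" where
  "d1 \<phi> z \<equiv> frechet_derivative \<phi> (at z) 1"

lemma test_function_1D:
  fixes \<phi> :: "real \<Rightarrow> 'b::real_normed_vector"
  assumes "\<phi> \<in> test_functions unit_ivl"
  shows "continuous_on UNIV \<phi>" "continuous_on UNIV (d1 \<phi>)"
    "(\<phi> has_vector_derivative d1 \<phi> z) (at z)" "\<phi> 0 = 0" "\<phi> 1 = 0"
proof -
  obtain K where K: "K \<subseteq> unit_ivl" "\<And>x. x \<notin> K \<Longrightarrow> \<phi> x = 0"
    "continuous_on UNIV \<phi>" "\<And>x. (\<phi> has_derivative frechet_derivative \<phi> (at x)) (at x)"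
    "\<And>i. i \<in> Basis \<Longrightarrow> continuous_on UNIV (\<lambda>x. frechet_derivative \<phi> (at x) i)"
    using test_function_deriv[OF assms] by metis
  show "continuous_on UNIV \<phi>" "continuous_on UNIV (d1 \<phi>)" using K(3) K(5)[of 1] by auto
  have z: "0 \<notin> K" "1 \<notin> K" using K(1) by auto
  show "\<phi> 0 = 0" "\<phi> 1 = 0" by (rule K(2)[OF z(1)], rule K(2)[OF z(2)])
  have "frechet_derivative \<phi> (at z) = (\<lambda>h. h *\<^sub>R d1 \<phi> z)"
    by (rule ext) (rule linear_scale[OF has_derivative_linear[OF K(4)[of z]], of _ 1,
      unfolded real_scaleR_def mult_1_right])
  then show "(\<phi> has_vector_derivative d1 \<phi> z) (at z)"
    using K(4)[of z] by (simp add: has_vector_derivative_def)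
qed

lemma test_function_L2:
  fixes \<phi> :: "real \<Rightarrow> complex"
  assumes "\<phi> \<in> test_functions unit_ivl"
  shows "\<phi> \<in> L2u" "d1 \<phi> \<in> L2u"
  using test_function_1D[OF assms] by (auto intro!: continuous_L2 intro: continuous_on_subset)

text \<open>Integration by parts; the boundary terms vanish because the supports lie in the open
  interval.\<close>

lemma test_function_weak_partial:
  fixes \<phi> :: "real \<Rightarrow> complex"
  assumes \<phi>: "\<phi> \<in> test_functions unit_ivl"
  shows "has_weak_partial unit_ivl 1 \<phi> (d1 \<phi>)"
proof -
  note p = test_function_1D[OF \<phi>]
  have loc: "loc_integrable unit_ivl f" if "continuous_on UNIV f" for f :: "real \<Rightarrow> complex"
    unfolding loc_integrable_def
  proof (intro allI impI)
    fix K :: "real set" assume K: "compact K \<and> K \<subseteq> unit_ivl"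
    have "integrable lborel (\<lambda>z. indicator K z *\<^sub>R f z)"
      using K that by (intro borel_integrable_compact continuous_on_subset[OF that]) simp_all
    then have "integrable lebesgue (\<lambda>z. indicator K z *\<^sub>R f z)"
      by (simp add: integrable_completion borel_measurable_integrable)
    then show "integrable (lebesgue_on K) f"
      using K by (simp add: integrable_restrict_space compact_imp_closed)
  qed
  show ?thesis unfolding has_weak_partial_def
  proof (intro conjI allI impI loc p(1,2))
    fix \<psi> :: "real \<Rightarrow> real" assume \<psi>: "\<psi> \<in> test_functions unit_ivl"
    note q = test_function_1D[OF \<psi>]
    have c: "continuous_on {0..1} f" if "continuous_on UNIV f" for f :: "real \<Rightarrow> complex"
      by (rule continuous_on_subset[OF that]) simp
    have i: "integrable lebesgue_unit f" if "continuous_on UNIV f" for f :: "real \<Rightarrow> complex"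
      by (rule L2_imp_integrable[OF continuous_L2[OF c[OF that]]])
    have c1: "continuous_on UNIV (\<lambda>z. d1 \<psi> z *\<^sub>R \<phi> z)" and c2: "continuous_on UNIV (\<lambda>z. \<psi> z *\<^sub>R d1 \<phi> z)"
      by (rule continuous_on_scaleR[OF q(2) p(1)], rule continuous_on_scaleR[OF q(1) p(2)])
    have "((\<lambda>z. \<psi> z *\<^sub>R d1 \<phi> z + d1 \<psi> z *\<^sub>R \<phi> z) has_integral \<psi> 1 *\<^sub>R \<phi> 1 - \<psi> 0 *\<^sub>R \<phi> 0) {0..1}"
    proof (rule fundamental_theorem_of_calculus)
      fix z :: real
      have "((\<lambda>z. \<psi> z *\<^sub>R \<phi> z) has_vector_derivative \<psi> z *\<^sub>R d1 \<phi> z + d1 \<psi> z *\<^sub>R \<phi> z) (at z)"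
        by (rule has_vector_derivative_scaleR[OF q(3)[folded has_real_derivative_iff_has_vector_derivative] p(3)])
      then show "((\<lambda>z. \<psi> z *\<^sub>R \<phi> z) has_vector_derivative \<psi> z *\<^sub>R d1 \<phi> z + d1 \<psi> z *\<^sub>R \<phi> z) (at z within {0..1})"
        by (rule has_vector_derivative_at_within)
    qed simp
    then have "0 = integral {0..1} (\<lambda>z. \<psi> z *\<^sub>R d1 \<phi> z + d1 \<psi> z *\<^sub>R \<phi> z)"
      by (simp add: q integral_unique)
    also have "\<dots> = (\<integral>z. \<psi> z *\<^sub>R d1 \<phi> z + d1 \<psi> z *\<^sub>R \<phi> z \<partial>lebesgue_unit)"
      by (rule integral_lebesgue_unit[symmetric, OF i[OF continuous_on_add[OF c2 c1]]])
    also have "\<dots> = (\<integral>z. \<psi> z *\<^sub>R d1 \<phi> z \<partial>lebesgue_unit) + (\<integral>z. d1 \<psi> z *\<^sub>R \<phi> z \<partial>lebesgue_unit)"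
      by (rule Bochner_Integration.integral_add[OF i[OF c2] i[OF c1]])
    finally show "(\<integral>z. d1 \<psi> z *\<^sub>R \<phi> z \<partial>lebesgue_unit) = - (\<integral>z. \<psi> z *\<^sub>R d1 \<phi> z \<partial>lebesgue_unit)"
      by (simp add: eq_neg_iff_add_eq_0 add.commute)
  qed
qed

lemma interval_indicator_L2:
  fixes x y :: real
  assumes xy: "0 \<le> x" "x \<le> y" "y \<le> 1"
  defines "i \<equiv> \<lambda>z. if z \<in> {x..y} then 1 else 0 :: complex"
  shows "i \<in> L2u" "nsq i = y - x"
proof -
  show i: "i \<in> L2u" unfolding i_def
  proof (rule bounded_measurable_L2[of _ 1])
    have "(\<lambda>z. if z \<in> {x..y} then 1 else 0 :: complex) \<in> borel_measurable lborel" by measurable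
    then show "(\<lambda>z. if z \<in> {x..y} then 1 else 0 :: complex) \<in> borel_measurable lebesgue_unit"
      by (rule measurable_restrict_space1[OF measurable_completion])
  qed simp
  have sub: "{0..1} \<inter> {x..y} = {x..y}" "{x..y} \<inter> {0..1} = {x..y}" using xy by auto
  have "L2_inner i i = integral {0..1} (\<lambda>z. i z * cnj (i z))"
    unfolding L2_inner_def by (rule integral_lebesgue_unit[OF L2_mult_integrable[OF i i]])
  also have "\<dots> = integral {0..1} (\<lambda>z. if z \<in> {x..y} then 1 else 0)"
    by (rule integral_cong) (simp add: i_def)
  also have "\<dots> = complex_of_real (y - x)"
    using xy by (simp only: integral_restrict_Int sub) (simp add: scaleR_conv_of_real)
  finally show "nsq i = y - x" by simp
qed

text \<open>\<phi> y - \<phi> x is the inner product of the derivative with the indicator of [x,y],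
  whose squared norm is y - x; Cauchy-Schwarz gives Hoelder continuity of order 1/2.\<close>

lemma test_function_Hoelder:
  fixes \<phi> :: "real \<Rightarrow> complex"
  assumes \<phi>: "\<phi> \<in> test_functions unit_ivl" and xy: "x \<in> {0..1}" "y \<in> {0..1}"
  shows "(cmod (\<phi> x - \<phi> y))\<^sup>2 \<le> \<bar>x - y\<bar> * nsq (d1 \<phi>)"
proof -
  have *: "(cmod (\<phi> y - \<phi> x))\<^sup>2 \<le> (y - x) * nsq (d1 \<phi>)" if xy: "0 \<le> x" "x \<le> y" "y \<le> 1" for x y
  proof -
    note p = test_function_1D[OF \<phi>]
    let ?i = "\<lambda>z. if z \<in> {x..y} then 1 else 0 :: complex"
    note i = interval_indicator_L2[OF xy]
    have sub: "{x..y} \<inter> {0..1} = {x..y}" "{0..1} \<inter> {x..y} = {x..y}" using xy by auto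
    have "L2_inner (d1 \<phi>) ?i = integral {0..1} (\<lambda>z. d1 \<phi> z * cnj (?i z))"
      unfolding L2_inner_def by (rule integral_lebesgue_unit[OF L2_mult_integrable[OF test_function_L2(2)[OF \<phi>] i(1)]])
    also have "\<dots> = integral {0..1} (\<lambda>z. if z \<in> {x..y} then d1 \<phi> z else 0)"
      by (rule integral_cong) simp
    also have "\<dots> = integral {x..y} (d1 \<phi>)"
      by (simp only: integral_restrict_Int sub)
    also have "\<dots> = \<phi> y - \<phi> x"
      using xy by (intro integral_unique fundamental_theorem_of_calculus)
        (auto intro: has_vector_derivative_at_within p(3))
    finally have 1: "L2_inner (d1 \<phi>) ?i = \<phi> y - \<phi> x" .
    show ?thesis
      using L2.Cauchy_Schwarz[OF nsq_nonneg test_function_L2(2)[OF \<phi>] i(1)] unfolding 1 i(2)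
      by (simp add: mult.commute)
  qed
  show ?thesis
  proof (cases "x \<le> y")
    case True
    then show ?thesis using *[of x y] xy by (simp add: norm_minus_commute)
  next
    case False
    then show ?thesis using *[of y x] xy by simp
  qed
qed

section \<open>Pointwise limits and completeness in L^2(0,1)\<close>

lemma L2_measurable: "u \<in> L2 S \<Longrightarrow> u \<in> borel_measurable (lebesgue_on S)"
  by (simp add: L2_iff)

text \<open>Fatou's lemma for the squared moduli: an almost everywhere limit inherits an eventual
  bound on the norm. Completeness and the identification of pointwise limits of test functions both
  rest on it.\<close>

lemma L2_Fatou:
  assumes f: "\<And>n. f n \<in> L2u" and [measurable]: "g \<in> borel_measurable lebesgue_unit"
    and lim: "AE z in lebesgue_unit. (\<lambda>n. f n z) \<longlonglongrightarrow> g z"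
    and le: "\<forall>\<^sub>F n in sequentially. nsq (f n) \<le> e"
  shows "g \<in> L2u" "nsq g \<le> e"
proof -
  have [measurable]: "f n \<in> borel_measurable lebesgue_unit" for n
    using f by (rule L2_measurable)
  have "(\<integral>\<^sup>+z. ennreal ((cmod (g z))\<^sup>2) \<partial>lebesgue_unit)
      = (\<integral>\<^sup>+z. liminf (\<lambda>n. ennreal ((cmod (f n z))\<^sup>2)) \<partial>lebesgue_unit)"
  proof (rule nn_integral_cong_AE)
    show "AE z in lebesgue_unit. ennreal ((cmod (g z))\<^sup>2) = liminf (\<lambda>n. ennreal ((cmod (f n z))\<^sup>2))"
      using lim
    proof eventually_elim
      case (elim z)
      have "(\<lambda>n. ennreal ((cmod (f n z))\<^sup>2)) \<longlonglongrightarrow> ennreal ((cmod (g z))\<^sup>2)"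
        by (rule tendsto_ennrealI[OF tendsto_power[OF tendsto_norm[OF elim]]])
      then show ?case by (rule lim_imp_Liminf[OF sequentially_bot, symmetric])
    qed
  qed
  also have "\<dots> \<le> liminf (\<lambda>n. \<integral>\<^sup>+z. ennreal ((cmod (f n z))\<^sup>2) \<partial>lebesgue_unit)"
    by (rule nn_integral_liminf) measurable
  also have "\<dots> = liminf (\<lambda>n. ennreal (nsq (f n)))"
    using L2_normsq_eq[OF f] unfolding L2_normsq_def nsq_eq by simp
  also have "\<dots> \<le> limsup (\<lambda>n. ennreal (nsq (f n)))"
    by (rule Liminf_le_Limsup) simp
  also have "\<dots> \<le> ennreal e"
    by (rule Limsup_bounded) (use le in \<open>auto elim!: eventually_mono intro: ennreal_leI\<close>)
  finally have *: "L2_normsq unit_ivl g \<le> ennreal e" by (simp add: L2_normsq_def)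
  also have "\<dots> < \<infinity>" by simp
  finally have "L2_normsq unit_ivl g < \<infinity>" .
  then show g: "g \<in> L2u" using assms(2) by (simp add: L2_def)
  have "0 \<le> e"
  proof -
    obtain n where "nsq (f n) \<le> e" using eventually_happens[OF le] by auto
    then show ?thesis using nsq_nonneg[of "f n"] by linarith
  qed
  then show "nsq g \<le> e"
    using * L2_normsq_eq[OF g] by (simp add: nsq_eq[symmetric])
qed

lemma L2_norm_integral_le:
  assumes "u \<in> L2u"
  shows "integrable lebesgue_unit (\<lambda>z. cmod (u z))" "(\<integral>z. cmod (u z) \<partial>lebesgue_unit) \<le> sqrt (nsq u)"
proof -
  show i: "integrable lebesgue_unit (\<lambda>z. cmod (u z))"
    using L2_imp_integrable[OF assms] by simp
  let ?a = "\<lambda>z. complex_of_real (cmod (u z))"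
  have one: "(\<lambda>_. 1) \<in> L2u" by (rule continuous_L2) simp
  have a: "?a \<in> L2u" using assms i by (simp add: L2_iff)
  have "L2_inner ?a (\<lambda>_. 1) = complex_of_real (\<integral>z. cmod (u z) \<partial>lebesgue_unit)"
    by (simp add: L2_inner_def integral_complex_of_real)
  moreover have "nsq (\<lambda>_. 1) = 1"
    unfolding nsq_eq using emeasure_lebesgue_unit by (simp add: measure_def)
  moreover have "nsq ?a = nsq u" by (simp add: nsq_eq)
  ultimately have "(\<integral>z. cmod (u z) \<partial>lebesgue_unit)\<^sup>2 \<le> nsq u"
    using L2.Cauchy_Schwarz[OF nsq_nonneg a one] by simp
  then show "(\<integral>z. cmod (u z) \<partial>lebesgue_unit) \<le> sqrt (nsq u)" by (rule real_le_rsqrt)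
qed

text \<open>Riesz-Fischer. Along a subsequence with increments below 4^(-k) in squared norm, the L^1
  norms of the increments are at most 2^(-k), because the interval has measure 1; the series of
  increments then converges absolutely almost everywhere. Fatou gives norm convergence of the whole
  sequence.\<close>

lemma L2_complete:
  assumes f: "\<And>n. f n \<in> L2u"
    and Cauchy: "\<And>e. e > 0 \<Longrightarrow> \<exists>N. \<forall>m\<ge>N. \<forall>n\<ge>N. nsq (\<lambda>z. f m z - f n z) < e"
  shows "\<exists>g\<in>L2u. (\<lambda>n. nsq (\<lambda>z. f n z - g z)) \<longlonglongrightarrow> 0"
proof -
  have "\<exists>N. \<forall>m\<ge>N. \<forall>n\<ge>N. nsq (\<lambda>z. f m z - f n z) < (1/4) ^ k" for k :: nat
    using Cauchy[of "(1/4) ^ k"] by simp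
  then obtain N where N: "\<And>k m n. m \<ge> N k \<Longrightarrow> n \<ge> N k \<Longrightarrow> nsq (\<lambda>z. f m z - f n z) < (1/4) ^ k"
    by metis
  \<comment> \<open>The maximum ensures r k \<ge> N j for all j \<le> k, so that one index meets all
    earlier tolerances.\<close>
  define r where "r k = Max (N ` {..k})" for k
  have r: "N j \<le> r k" if "j \<le> k" for j k
    unfolding r_def using that by (intro Max_ge) auto
  have [measurable]: "f n \<in> borel_measurable lebesgue_unit" for n
    using f by (rule L2_measurable)
  let ?d = "\<lambda>k z. f (r (Suc k)) z - f (r k) z"
  have d: "?d k \<in> L2u" for k by (rule L2.diff[OF f f])
  have d_le: "(\<integral>z. cmod (?d k z) \<partial>lebesgue_unit) \<le> (1/2) ^ k" for k
  proof -
    have "nsq (?d k) \<le> ((1/2) ^ k)\<^sup>2"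
    proof -
      have "((1/2::real) ^ k)\<^sup>2 = (1/4) ^ k"
        by (simp add: power_mult_distrib[symmetric] power2_eq_square)
      then show ?thesis using N[OF r[of k "Suc k"] r[of k k]] by simp
    qed
    then have "sqrt (nsq (?d k)) \<le> (1/2) ^ k" by (simp add: real_le_lsqrt nsq_nonneg)
    then show ?thesis using L2_norm_integral_le(2)[OF d] order_trans by blast
  qed
  have "(\<integral>\<^sup>+z. (\<Sum>k. ennreal (cmod (?d k z))) \<partial>lebesgue_unit)
      = (\<Sum>k. \<integral>\<^sup>+z. ennreal (cmod (?d k z)) \<partial>lebesgue_unit)"
    by (rule nn_integral_suminf) measurable
  also have "\<dots> \<le> (\<Sum>k. ennreal ((1/2) ^ k))"
  proof (rule suminf_le)
    show "(\<integral>\<^sup>+z. ennreal (cmod (?d k z)) \<partial>lebesgue_unit) \<le> ennreal ((1/2) ^ k)" for k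
      using d_le[of k] nn_integral_eq_integral[OF L2_norm_integral_le(1)[OF d, of k]]
      by (simp add: ennreal_leI)
  qed auto
  also have "\<dots> = ennreal (\<Sum>k. (1/2) ^ k)"
    by (rule suminf_ennreal2) (auto intro: summable_geometric)
  also have "\<dots> < \<infinity>" by simp
  finally have "AE z in lebesgue_unit. (\<Sum>k. ennreal (cmod (?d k z))) \<noteq> \<infinity>"
    by (intro nn_integral_noteq_infinite) auto
  then have conv: "AE z in lebesgue_unit. convergent (\<lambda>k. f (r k) z)"
  proof eventually_elim
    case (elim z)
    have "summable (\<lambda>k. cmod (?d k z))"
      using elim by (intro summable_suminf_not_top) simp_all
    then have "summable (\<lambda>k. ?d k z)" by (rule summable_norm_cancel)
    then have "(\<lambda>n. \<Sum>k<n. ?d k z) \<longlonglongrightarrow> (\<Sum>k. ?d k z)" by (rule summable_LIMSEQ)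
    then have "(\<lambda>n. f (r n) z - f (r 0) z) \<longlonglongrightarrow> (\<Sum>k. ?d k z)"
      using sum_lessThan_telescope[of "\<lambda>k. f (r k) z"] by simp
    from tendsto_add[OF this tendsto_const[of "f (r 0) z"]]
    show ?case by (auto simp: convergent_def)
  qed
  define g where "g z = lim (\<lambda>k. f (r k) z)" for z
  have g[measurable]: "g \<in> borel_measurable lebesgue_unit"
    unfolding g_def by (rule borel_measurable_lim_metric) measurable
  have close: "(\<lambda>z. f n z - g z) \<in> L2u \<and> nsq (\<lambda>z. f n z - g z) \<le> (1/4) ^ j" if n: "n \<ge> N j" for n j
  proof -
    have "AE z in lebesgue_unit. (\<lambda>k. f n z - f (r k) z) \<longlonglongrightarrow> f n z - g z"
      using conv by eventually_elim (auto simp: g_def convergent_LIMSEQ_iff intro!: tendsto_diff)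
    moreover have "\<forall>\<^sub>F k in sequentially. nsq (\<lambda>z. f n z - f (r k) z) \<le> (1/4) ^ j"
      by (rule eventually_sequentiallyI[of j]) (use N[OF n] r in \<open>auto intro: less_imp_le\<close>)
    ultimately show ?thesis
      using L2_Fatou[of "\<lambda>k z. f n z - f (r k) z" "\<lambda>z. f n z - g z" "(1/4) ^ j"] L2.diff[OF f f]
      by auto
  qed
  have "g \<in> L2u"
    using L2.diff[OF f[of "N 0"] conjunct1[OF close[of 0 "N 0"]]] by simp
  moreover have "(\<lambda>n. nsq (\<lambda>z. f n z - g z)) \<longlonglongrightarrow> 0"
  proof (rule LIMSEQ_I)
    fix e :: real assume "e > 0"
    obtain j where j: "(1/4::real) ^ j < e"
      using real_arch_pow_inv[OF \<open>e > 0\<close>, of "1/4"] by auto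
    show "\<exists>no. \<forall>n\<ge>no. norm (nsq (\<lambda>z. f n z - g z) - 0) < e"
      using close[of j] j nsq_nonneg by (intro exI[of _ "N j"]) fastforce
  qed
  ultimately show ?thesis by blast
qed

section \<open>H^1_0(0,1) through approximating test functions\<close>

lemma test_functions_comb:
  fixes \<phi> \<psi> :: "real \<Rightarrow> complex"
  assumes "\<phi> \<in> test_functions S" "\<psi> \<in> test_functions S"
  shows "(\<lambda>z. \<phi> z + c * \<psi> z) \<in> test_functions S"
    and "d1 (\<lambda>z. \<phi> z + c * \<psi> z) = (\<lambda>z. d1 \<phi> z + c * d1 \<psi> z)"
proof -
  have sm: "Ck_on k UNIV \<phi>" "Ck_on k UNIV \<psi>" for k
    using assms by (simp_all add: test_functions_def smooth_on_def)
  have "Ck_on k UNIV (\<lambda>z. \<phi> z + c * \<psi> z)" for k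
    by (rule Ck_on_add[OF sm(1) Ck_on_bounded_linear[OF bounded_linear_mult_right sm(2)]])
  moreover have "{z. \<phi> z + c * \<psi> z \<noteq> 0} \<subseteq> {z. \<phi> z \<noteq> 0} \<union> {z. \<psi> z \<noteq> 0}" by auto
  then have cl: "closure {z. \<phi> z + c * \<psi> z \<noteq> 0} \<subseteq> closure {z. \<phi> z \<noteq> 0} \<union> closure {z. \<psi> z \<noteq> 0}"
    unfolding closure_Un[symmetric] by (rule closure_mono)
  moreover have cp: "compact (closure {z. \<phi> z \<noteq> 0} \<union> closure {z. \<psi> z \<noteq> 0})"
    using assms by (auto simp: test_functions_def)
  have "compact (closure {z. \<phi> z + c * \<psi> z \<noteq> 0})"
    using bounded_subset[OF compact_imp_bounded[OF cp] cl] by (simp only: compact_eq_bounded_closed closed_closure)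
  ultimately show "(\<lambda>z. \<phi> z + c * \<psi> z) \<in> test_functions S"
    using assms by (auto simp: test_functions_def smooth_on_def)
  have "((\<lambda>z. \<phi> z + c * \<psi> z) has_derivative
      (\<lambda>h. frechet_derivative \<phi> (at z) h + c * frechet_derivative \<psi> (at z) h)) (at z)" for z
    using sm[of 1]
    by (intro has_derivative_add has_derivative_mult_right frechet_derivative_works[THEN iffD1]) simp_all
  from frechet_derivative_at[OF this] show "d1 (\<lambda>z. \<phi> z + c * \<psi> z) = (\<lambda>z. d1 \<phi> z + c * d1 \<psi> z)"
    by metis
qed

lemma L2_loc_integrable:
  assumes "u \<in> L2u"
  shows "loc_integrable unit_ivl u"
  unfolding loc_integrable_def
proof (intro allI impI)
  fix K :: "real set" assume K: "compact K \<and> K \<subseteq> unit_ivl"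
  have "integrable lebesgue (\<lambda>z. indicator unit_ivl z *\<^sub>R u z)"
    using L2_imp_integrable[OF assms] by (simp add: integrable_restrict_space)
  then have "integrable lebesgue (\<lambda>z. indicator K z *\<^sub>R indicator unit_ivl z *\<^sub>R u z)"
    by (rule integrable_mult_indicator[rotated]) (use K in \<open>simp add: compact_imp_closed\<close>)
  moreover have "indicator K z *\<^sub>R indicator unit_ivl z *\<^sub>R u z = indicator K z *\<^sub>R u z" for z
    using K by (auto simp: indicator_def)
  ultimately have "integrable lebesgue (\<lambda>z. indicator K z *\<^sub>R u z)" by (simp only:)
  then show "integrable (lebesgue_on K) u"
    using K by (simp add: integrable_restrict_space compact_imp_closed)
qed

text \<open>Together with \<open>H1_0D\<close> this turns membership in \<open>H1_0\<close> into two
  real null sequences, with an explicit candidate g in place of the choice inside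
  \<open>weak_partial\<close>. The weak derivative identity holds for the approximations and passes
  to the limit by continuity of the inner product.\<close>

lemma H1_0I:
  assumes \<phi>: "\<And>n. \<phi> n \<in> test_functions unit_ivl" and u: "u \<in> L2u" and g: "g \<in> L2u"
    and lim: "(\<lambda>n. nsq (\<lambda>z. \<phi> n z - u z)) \<longlonglongrightarrow> 0" "(\<lambda>n. nsq (\<lambda>z. d1 (\<phi> n) z - g z)) \<longlonglongrightarrow> 0"
  shows "u \<in> H1_0 unit_ivl" "AE z in lebesgue_unit. D1 u z = g z"
proof -
  have wp: "has_weak_partial unit_ivl 1 u g"
    unfolding has_weak_partial_def
  proof (intro conjI allI impI L2_loc_integrable u g)
    fix \<psi> :: "real \<Rightarrow> real" assume \<psi>: "\<psi> \<in> test_functions unit_ivl"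
    note q = test_function_1D[OF \<psi>]
    have c: "(\<lambda>z. complex_of_real (f z)) \<in> L2u" if "continuous_on UNIV f" for f
      by (rule continuous_L2[OF continuous_on_of_real[OF continuous_on_subset[OF that]]]) simp
    have eq: "(\<integral>z. f z *\<^sub>R w z \<partial>lebesgue_unit) = L2_inner w (\<lambda>z. complex_of_real (f z))" for f w
      unfolding L2_inner_def by (simp add: scaleR_conv_of_real mult.commute)
    have "(\<lambda>n. L2_inner (\<phi> n) (\<lambda>z. complex_of_real (d1 \<psi> z))) \<longlonglongrightarrow> L2_inner u (\<lambda>z. complex_of_real (d1 \<psi> z))"
      by (rule L2.quad_tendsto(1)[OF nsq_nonneg test_function_L2(1)[OF \<phi>] u c[OF q(2)] lim(1)])
    moreover have "(\<lambda>n. L2_inner (d1 (\<phi> n)) (\<lambda>z. complex_of_real (\<psi> z))) \<longlonglongrightarrow> L2_inner g (\<lambda>z. complex_of_real (\<psi> z))"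
      by (rule L2.quad_tendsto(1)[OF nsq_nonneg test_function_L2(2)[OF \<phi>] g c[OF q(1)] lim(2)])
    moreover have "L2_inner (\<phi> n) (\<lambda>z. complex_of_real (d1 \<psi> z)) = - L2_inner (d1 (\<phi> n)) (\<lambda>z. complex_of_real (\<psi> z))" for n
      using test_function_weak_partial[OF \<phi>, of n] \<psi> unfolding has_weak_partial_def eq by blast
    ultimately have "(\<lambda>n. - L2_inner (d1 (\<phi> n)) (\<lambda>z. complex_of_real (\<psi> z))) \<longlonglongrightarrow> L2_inner u (\<lambda>z. complex_of_real (d1 \<psi> z))"
      "(\<lambda>n. - L2_inner (d1 (\<phi> n)) (\<lambda>z. complex_of_real (\<psi> z))) \<longlonglongrightarrow> - L2_inner g (\<lambda>z. complex_of_real (\<psi> z))"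
      by (simp_all only: tendsto_minus)
    then show "(\<integral>z. d1 \<psi> z *\<^sub>R u z \<partial>lebesgue_unit) = - (\<integral>z. \<psi> z *\<^sub>R g z \<partial>lebesgue_unit)"
      unfolding eq by (rule LIMSEQ_unique)
  qed
  note I = open_greaterThanLessThan[of "0::real" 1]
  show D: "AE z in lebesgue_unit. D1 u z = g z"
    by (rule weak_partial_AE(2)[OF I _ wp]) simp
  have "u \<in> H1 unit_ivl" using u g wp by (auto simp: H1_def)
  moreover have "H1_normsq unit_ivl (\<lambda>z. \<phi> n z - u z)
      = ennreal (nsq (\<lambda>z. \<phi> n z - u z) + nsq (\<lambda>z. d1 (\<phi> n) z - g z))" for n
  proof -
    have "AE z in lebesgue_unit. D1 (\<lambda>z. \<phi> n z - u z) z = d1 (\<phi> n) z - g z"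
      by (rule weak_partial_AE(2)[OF I _ has_weak_partial_diff[OF I _ test_function_weak_partial[OF \<phi>] wp]]) simp_all
    then have "L2_normsq unit_ivl (D1 (\<lambda>z. \<phi> n z - u z)) = L2_normsq unit_ivl (\<lambda>z. d1 (\<phi> n) z - g z)"
      unfolding L2_normsq_def by (intro nn_integral_cong_AE) auto
    then show ?thesis
      using L2_normsq_eq[OF L2.diff[OF test_function_L2(1)[OF \<phi>] u], of n]
        L2_normsq_eq[OF L2.diff[OF test_function_L2(2)[OF \<phi>] g], of n]
      by (simp add: H1_normsq_def nsq_eq[symmetric] nsq_nonneg)
  qed
  moreover have "(\<lambda>n. ennreal (nsq (\<lambda>z. \<phi> n z - u z) + nsq (\<lambda>z. d1 (\<phi> n) z - g z))) \<longlonglongrightarrow> ennreal (0 + 0)"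
    by (rule tendsto_ennrealI[OF tendsto_add[OF lim]])
  ultimately show "u \<in> H1_0 unit_ivl"
    unfolding H1_0_def H1_closure_def mem_Collect_eq using \<phi> by (intro conjI exI[of _ \<phi>] allI) simp_all
qed

lemma H1_0D:
  assumes "u \<in> H1_0 unit_ivl"
  shows "u \<in> L2u" "D1 u \<in> L2u"
    "\<exists>\<phi>. (\<forall>n. \<phi> n \<in> test_functions unit_ivl) \<and> (\<lambda>n. nsq (\<lambda>z. \<phi> n z - u z)) \<longlonglongrightarrow> 0
      \<and> (\<lambda>n. nsq (\<lambda>z. d1 (\<phi> n) z - D1 u z)) \<longlonglongrightarrow> 0"
proof -
  note I = open_greaterThanLessThan[of "0::real" 1]
  obtain \<phi> where u: "u \<in> H1 unit_ivl" and \<phi>: "\<And>n. \<phi> n \<in> test_functions unit_ivl"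
    and lim: "(\<lambda>n. H1_normsq unit_ivl (\<lambda>x. \<phi> n x - u x)) \<longlonglongrightarrow> 0"
    using assms unfolding H1_0_def H1_closure_def by blast
  show uL: "u \<in> L2u" using u by (simp add: H1_def)
  have wp: "has_weak_partial unit_ivl 1 u (D1 u)" and DL: "D1 u \<in> L2u"
    using H1_weak_partial[OF I u, of 1] by simp_all
  show "D1 u \<in> L2u" by (rule DL)
  have eq: "H1_normsq unit_ivl (\<lambda>z. \<phi> n z - u z)
      = ennreal (nsq (\<lambda>z. \<phi> n z - u z) + nsq (\<lambda>z. d1 (\<phi> n) z - D1 u z))" for n
  proof -
    have "AE z in lebesgue_unit. D1 (\<lambda>z. \<phi> n z - u z) z = d1 (\<phi> n) z - D1 u z"
      by (rule weak_partial_AE(2)[OF I _ has_weak_partial_diff[OF I _ test_function_weak_partial[OF \<phi>] wp]]) simp_all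
    then have "L2_normsq unit_ivl (D1 (\<lambda>z. \<phi> n z - u z)) = L2_normsq unit_ivl (\<lambda>z. d1 (\<phi> n) z - D1 u z)"
      unfolding L2_normsq_def by (intro nn_integral_cong_AE) auto
    then show ?thesis
      using L2_normsq_eq[OF L2.diff[OF test_function_L2(1)[OF \<phi>] uL], of n]
        L2_normsq_eq[OF L2.diff[OF test_function_L2(2)[OF \<phi>] DL], of n]
      by (simp add: H1_normsq_def nsq_eq[symmetric] nsq_nonneg)
  qed
  have "(\<lambda>n. nsq (\<lambda>z. \<phi> n z - u z) + nsq (\<lambda>z. d1 (\<phi> n) z - D1 u z)) \<longlonglongrightarrow> 0"
    using lim unfolding eq by (subst (asm) ennreal_tendsto_0_iff) (auto intro: add_nonneg_nonneg nsq_nonneg)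
  then have "(\<lambda>n. nsq (\<lambda>z. \<phi> n z - u z)) \<longlonglongrightarrow> 0" "(\<lambda>n. nsq (\<lambda>z. d1 (\<phi> n) z - D1 u z)) \<longlonglongrightarrow> 0"
    by (auto intro!: tendsto_sandwich[OF _ _ tendsto_const, where h = "\<lambda>n. nsq (\<lambda>z. \<phi> n z - u z) + nsq (\<lambda>z. d1 (\<phi> n) z - D1 u z)"]
        always_eventually nsq_nonneg)
  then show "\<exists>\<phi>. (\<forall>n. \<phi> n \<in> test_functions unit_ivl) \<and> (\<lambda>n. nsq (\<lambda>z. \<phi> n z - u z)) \<longlonglongrightarrow> 0
      \<and> (\<lambda>n. nsq (\<lambda>z. d1 (\<phi> n) z - D1 u z)) \<longlonglongrightarrow> 0"
    using \<phi> by blast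
qed

lemma nsq_scale: "u \<in> L2u \<Longrightarrow> nsq (\<lambda>z. c * u z) = (cmod c)\<^sup>2 * nsq u"
  by (rule L2.h_quad_scale)

lemma nsq_comb_tendsto_0:
  assumes "\<And>n. a n \<in> L2u" "\<And>n. b n \<in> L2u" "(\<lambda>n. nsq (a n)) \<longlonglongrightarrow> 0" "(\<lambda>n. nsq (b n)) \<longlonglongrightarrow> 0"
  shows "(\<lambda>n. nsq (\<lambda>z. a n z + c * b n z)) \<longlonglongrightarrow> 0"
proof (rule tendsto_sandwich[OF always_eventually always_eventually tendsto_const])
  show "\<forall>n. 0 \<le> nsq (\<lambda>z. a n z + c * b n z)" by (intro allI nsq_nonneg)
  show "\<forall>n. nsq (\<lambda>z. a n z + c * b n z) \<le> 2 * nsq (a n) + 2 * ((cmod c)\<^sup>2 * nsq (b n))"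
  proof
    show "nsq (\<lambda>z. a n z + c * b n z) \<le> 2 * nsq (a n) + 2 * ((cmod c)\<^sup>2 * nsq (b n))" for n
      using nsq_add_le[OF assms(1) L2.scale[OF assms(2)], of n c n] nsq_scale[OF assms(2), of c n] by simp
  qed
  show "(\<lambda>n. 2 * nsq (a n) + 2 * ((cmod c)\<^sup>2 * nsq (b n))) \<longlonglongrightarrow> 0"
    using tendsto_add[OF tendsto_mult_left[OF assms(3), of 2]
        tendsto_mult_left[OF tendsto_mult_left[OF assms(4), of "(cmod c)\<^sup>2"], of 2]] by simp
qed

lemma H1_0_comb:
  assumes "u \<in> H1_0 unit_ivl" "w \<in> H1_0 unit_ivl"
  shows "(\<lambda>z. u z + c * w z) \<in> H1_0 unit_ivl"
    and "AE z in lebesgue_unit. D1 (\<lambda>z. u z + c * w z) z = D1 u z + c * D1 w z"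
proof -
  note u = H1_0D[OF assms(1)] and w = H1_0D[OF assms(2)]
  obtain \<phi> where \<phi>: "\<And>n. \<phi> n \<in> test_functions unit_ivl" "(\<lambda>n. nsq (\<lambda>z. \<phi> n z - u z)) \<longlonglongrightarrow> 0"
    "(\<lambda>n. nsq (\<lambda>z. d1 (\<phi> n) z - D1 u z)) \<longlonglongrightarrow> 0" using u(3) by blast
  obtain \<psi> where \<psi>: "\<And>n. \<psi> n \<in> test_functions unit_ivl" "(\<lambda>n. nsq (\<lambda>z. \<psi> n z - w z)) \<longlonglongrightarrow> 0"
    "(\<lambda>n. nsq (\<lambda>z. d1 (\<psi> n) z - D1 w z)) \<longlonglongrightarrow> 0" using w(3) by blast
  have t: "(\<lambda>z. \<phi> n z + c * \<psi> n z) \<in> test_functions unit_ivl" for n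
    by (rule test_functions_comb(1)[OF \<phi>(1) \<psi>(1)])
  have l1: "(\<lambda>n. nsq (\<lambda>z. \<phi> n z + c * \<psi> n z - (u z + c * w z))) \<longlonglongrightarrow> 0"
    using nsq_comb_tendsto_0[OF L2.diff[OF test_function_L2(1)[OF \<phi>(1)] u(1)]
        L2.diff[OF test_function_L2(1)[OF \<psi>(1)] w(1)] \<phi>(2) \<psi>(2), of c]
    by (simp add: algebra_simps)
  have l2: "(\<lambda>n. nsq (\<lambda>z. d1 (\<lambda>z. \<phi> n z + c * \<psi> n z) z - (D1 u z + c * D1 w z))) \<longlonglongrightarrow> 0"
    unfolding fun_cong[OF test_functions_comb(2)[OF \<phi>(1) \<psi>(1)]]
    using nsq_comb_tendsto_0[OF L2.diff[OF test_function_L2(2)[OF \<phi>(1)] u(2)]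
        L2.diff[OF test_function_L2(2)[OF \<psi>(1)] w(2)] \<phi>(3) \<psi>(3), of c]
    by (simp add: algebra_simps)
  show "(\<lambda>z. u z + c * w z) \<in> H1_0 unit_ivl"
    "AE z in lebesgue_unit. D1 (\<lambda>z. u z + c * w z) z = D1 u z + c * D1 w z"
    using H1_0I[OF t L2_comb[OF u(1) w(1)] L2_comb[OF u(2) w(2)] l1 l2] by auto
qed

lemma H1_0_diff:
  assumes "u \<in> H1_0 unit_ivl" "w \<in> H1_0 unit_ivl"
  shows "(\<lambda>z. u z - w z) \<in> H1_0 unit_ivl"
    and "nsq (D1 (\<lambda>z. u z - w z)) = nsq (\<lambda>z. D1 u z - D1 w z)"
proof -
  show *: "(\<lambda>z. u z - w z) \<in> H1_0 unit_ivl"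
    using H1_0_comb(1)[OF assms, of "-1"] by simp
  show "nsq (D1 (\<lambda>z. u z - w z)) = nsq (\<lambda>z. D1 u z - D1 w z)"
    using H1_0_comb(2)[OF assms, of "-1"]
    by (intro nsq_cong_AE L2_measurable[OF H1_0D(2)[OF *]]
        L2_measurable[OF L2.diff[OF H1_0D(2)[OF assms(1)] H1_0D(2)[OF assms(2)]]]) simp
qed

text \<open>Differences of approximating test functions vanish at 0, so the Hoelder bound against
  the point 0 controls their values by their derivatives alone. The approximations thus converge at
  every point of [0,1], the limit v inherits the Hoelder bound, and Fatou identifies it with u
  almost everywhere.\<close>

lemma H1_0_Hoelder:
  assumes "u \<in> H1_0 unit_ivl"
  obtains v where "AE z in lebesgue_unit. u z = v z" "v 0 = 0"
    "\<And>x y. x \<in> {0..1} \<Longrightarrow> y \<in> {0..1} \<Longrightarrow> (cmod (v x - v y))\<^sup>2 \<le> \<bar>x - y\<bar> * nsq (D1 u)"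
proof -
  note u = H1_0D[OF assms]
  obtain \<phi> where \<phi>: "\<And>n. \<phi> n \<in> test_functions unit_ivl" "(\<lambda>n. nsq (\<lambda>z. \<phi> n z - u z)) \<longlonglongrightarrow> 0"
    "(\<lambda>n. nsq (\<lambda>z. d1 (\<phi> n) z - D1 u z)) \<longlonglongrightarrow> 0" using u(3) by blast
  have diff: "(cmod (\<phi> n x - \<phi> m x))\<^sup>2
      \<le> 2 * nsq (\<lambda>z. d1 (\<phi> n) z - D1 u z) + 2 * nsq (\<lambda>z. d1 (\<phi> m) z - D1 u z)" if x: "x \<in> {0..1}" for n m x
  proof -
    have t: "(\<lambda>z. \<phi> n z + (-1) * \<phi> m z) \<in> test_functions unit_ivl"
      by (rule test_functions_comb(1)[OF \<phi>(1) \<phi>(1)])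
    have "(cmod (\<phi> n x - \<phi> m x))\<^sup>2 \<le> \<bar>x - 0\<bar> * nsq (\<lambda>z. d1 (\<phi> n) z + (-1) * d1 (\<phi> m) z)"
      using test_function_Hoelder[OF t x, of 0] test_function_1D(4)[OF \<phi>(1)]
      unfolding test_functions_comb(2)[OF \<phi>(1) \<phi>(1)] by simp
    also have "\<dots> \<le> nsq (\<lambda>z. d1 (\<phi> n) z - d1 (\<phi> m) z)"
      using x mult_left_le_one_le[OF nsq_nonneg, of x "\<lambda>z. d1 (\<phi> n) z - d1 (\<phi> m) z"] by simp
    also have "\<dots> \<le> 2 * nsq (\<lambda>z. d1 (\<phi> n) z - D1 u z) + 2 * nsq (\<lambda>z. D1 u z - d1 (\<phi> m) z)"
      by (rule nsq_triangle[OF test_function_L2(2)[OF \<phi>(1)] u(2) test_function_L2(2)[OF \<phi>(1)]])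
    also have "nsq (\<lambda>z. D1 u z - d1 (\<phi> m) z) = nsq (\<lambda>z. d1 (\<phi> m) z - D1 u z)"
      by (simp add: nsq_eq norm_minus_commute)
    finally show ?thesis .
  qed
  have "Cauchy (\<lambda>n. \<phi> n x)" if x: "x \<in> {0..1}" for x
  proof (rule metric_CauchyI)
    fix e :: real assume "e > 0"
    then have "e\<^sup>2 / 4 > 0" by simp
    from order_tendstoD(2)[OF \<phi>(3) this] obtain N where
      N: "\<And>n. n \<ge> N \<Longrightarrow> nsq (\<lambda>z. d1 (\<phi> n) z - D1 u z) < e\<^sup>2 / 4"
      unfolding eventually_sequentially by blast
    show "\<exists>M. \<forall>m\<ge>M. \<forall>n\<ge>M. dist (\<phi> m x) (\<phi> n x) < e"
    proof (intro exI[of _ N] allI impI)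
      fix m n assume "m \<ge> N" "n \<ge> N"
      then have "(cmod (\<phi> m x - \<phi> n x))\<^sup>2 < e\<^sup>2"
        using diff[OF x, of m n] N[of m] N[of n] by linarith
      then show "dist (\<phi> m x) (\<phi> n x) < e"
        using \<open>e > 0\<close> power_less_imp_less_base[of _ 2 e] by (simp add: dist_norm)
    qed
  qed
  then obtain v where v: "\<And>x. x \<in> {0..1} \<Longrightarrow> (\<lambda>n. \<phi> n x) \<longlonglongrightarrow> v x"
    unfolding Cauchy_convergent_iff convergent_def by metis
  have vm: "v \<in> borel_measurable lebesgue_unit"
  proof (rule borel_measurable_LIMSEQ_metric[where f = \<phi>])
    show "\<phi> n \<in> borel_measurable lebesgue_unit" for n by (rule L2_measurable[OF test_function_L2(1)[OF \<phi>(1)]])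
    show "(\<lambda>n. \<phi> n x) \<longlonglongrightarrow> v x" if "x \<in> space lebesgue_unit" for x
      using that by (intro v) auto
  qed
  have "(\<lambda>z. v z - u z) \<in> L2u \<and> nsq (\<lambda>z. v z - u z) \<le> e" if "e > 0" for e
  proof -
    have "AE z in lebesgue_unit. (\<lambda>n. \<phi> n z - u z) \<longlonglongrightarrow> v z - u z"
      by (rule AE_I2) (auto intro!: tendsto_diff v)
    moreover have "\<forall>\<^sub>F n in sequentially. nsq (\<lambda>z. \<phi> n z - u z) \<le> e"
      using order_tendstoD(2)[OF \<phi>(2) that] by (auto elim!: eventually_mono)
    moreover have "(\<lambda>z. v z - u z) \<in> borel_measurable lebesgue_unit"
      using vm L2_measurable[OF u(1)] by measurable
    ultimately show ?thesis
      using L2_Fatou[where f = "\<lambda>n z. \<phi> n z - u z" and g = "\<lambda>z. v z - u z" and e = e,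
        OF L2.diff[OF test_function_L2(1)[OF \<phi>(1)] u(1)]] by blast
  qed
  then have vu: "(\<lambda>z. v z - u z) \<in> L2u" and "\<And>e. e > 0 \<Longrightarrow> nsq (\<lambda>z. v z - u z) \<le> e"
    using zero_less_one by blast+
  then have "nsq (\<lambda>z. v z - u z) = 0"
    using nsq_nonneg[of "\<lambda>z. v z - u z"] field_le_epsilon[of "nsq (\<lambda>z. v z - u z)" 0]
    by (intro antisym) simp_all
  then have "AE z in lebesgue_unit. (cmod (v z - u z))\<^sup>2 = 0"
    unfolding nsq_eq using vu by (subst (asm) integral_nonneg_eq_0_iff_AE) (auto simp: L2_iff)
  then have 1: "AE z in lebesgue_unit. u z = v z" by (auto elim!: eventually_mono)
  have 2: "v 0 = 0"
    using v[of 0] test_function_1D(4)[OF \<phi>(1)] by (simp add: LIMSEQ_const_iff)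
  have 3: "(cmod (v x - v y))\<^sup>2 \<le> \<bar>x - y\<bar> * nsq (D1 u)" if "x \<in> {0..1}" "y \<in> {0..1}" for x y
  proof (rule LIMSEQ_le)
    show "(\<lambda>n. (cmod (\<phi> n x - \<phi> n y))\<^sup>2) \<longlonglongrightarrow> (cmod (v x - v y))\<^sup>2"
      by (rule tendsto_power[OF tendsto_norm[OF tendsto_diff[OF v[OF that(1)] v[OF that(2)]]]])
    show "(\<lambda>n. \<bar>x - y\<bar> * nsq (d1 (\<phi> n))) \<longlonglongrightarrow> \<bar>x - y\<bar> * nsq (D1 u)"
      by (rule tendsto_mult_left[OF L2.quad_tendsto(2)[OF nsq_nonneg test_function_L2(2)[OF \<phi>(1)] u(2) u(2) \<phi>(3)]])
    show "\<exists>N. \<forall>n\<ge>N. (cmod (\<phi> n x - \<phi> n y))\<^sup>2 \<le> \<bar>x - y\<bar> * nsq (d1 (\<phi> n))"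
      using test_function_Hoelder[OF \<phi>(1) that] by blast
  qed
  show ?thesis by (rule that[OF 1 2 3])
qed

section \<open>Closedness, compactness and sup bounds in H^1_0(0,1)\<close>

lemma nsq_le_of_bound:
  assumes "u \<in> L2u" "AE z in lebesgue_unit. cmod (u z) \<le> e"
  shows "nsq u \<le> e\<^sup>2"
proof -
  interpret finite_measure lebesgue_unit by (rule finite_measure_lebesgue_unit)
  have "nsq u \<le> (\<integral>z. e\<^sup>2 \<partial>lebesgue_unit)"
    unfolding nsq_eq using assms(1)
    by (intro integral_mono_AE) (use assms(2) in \<open>auto simp: L2_iff elim!: eventually_mono intro: power_mono\<close>)
  also have "\<dots> = e\<^sup>2"
    using emeasure_lebesgue_unit by (simp add: measure_def)
  finally show ?thesis .
qed

text \<open>A diagonal choice: for each n a test function closer than 1/(n+1) to u n, in squared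
  norm and for the derivatives as well.\<close>

lemma H1_0_closed:
  assumes u: "\<And>n. u n \<in> H1_0 unit_ivl" and wg: "w \<in> L2u" "g \<in> L2u"
    and lim: "(\<lambda>n. nsq (\<lambda>z. u n z - w z)) \<longlonglongrightarrow> 0" "(\<lambda>n. nsq (\<lambda>z. D1 (u n) z - g z)) \<longlonglongrightarrow> 0"
  shows "w \<in> H1_0 unit_ivl" "AE z in lebesgue_unit. D1 w z = g z"
proof -
  note U = H1_0D[OF u]
  have "\<exists>\<phi>. \<phi> \<in> test_functions unit_ivl \<and> nsq (\<lambda>z. \<phi> z - u n z) < inverse (real (Suc n))
      \<and> nsq (\<lambda>z. d1 \<phi> z - D1 (u n) z) < inverse (real (Suc n))" for n
  proof -
    obtain \<phi> where \<phi>: "\<And>k. \<phi> k \<in> test_functions unit_ivl" "(\<lambda>k. nsq (\<lambda>z. \<phi> k z - u n z)) \<longlonglongrightarrow> 0"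
      "(\<lambda>k. nsq (\<lambda>z. d1 (\<phi> k) z - D1 (u n) z)) \<longlonglongrightarrow> 0" using U(3)[of n] by blast
    have p: "0 < inverse (real (Suc n))" by simp
    have "\<forall>\<^sub>F k in sequentially. nsq (\<lambda>z. \<phi> k z - u n z) < inverse (real (Suc n))
        \<and> nsq (\<lambda>z. d1 (\<phi> k) z - D1 (u n) z) < inverse (real (Suc n))"
      by (intro eventually_conj order_tendstoD(2)[OF \<phi>(2) p] order_tendstoD(2)[OF \<phi>(3) p])
    from eventually_happens'[OF sequentially_bot this]
    show ?thesis using \<phi>(1) by blast
  qed
  then have "\<forall>n. \<exists>\<phi>. \<phi> \<in> test_functions unit_ivl \<and> nsq (\<lambda>z. \<phi> z - u n z) < inverse (real (Suc n))
      \<and> nsq (\<lambda>z. d1 \<phi> z - D1 (u n) z) < inverse (real (Suc n))" by (rule allI)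
  from choice[OF this]
  obtain \<phi> where \<phi>: "\<And>n. \<phi> n \<in> test_functions unit_ivl"
    "\<And>n. nsq (\<lambda>z. \<phi> n z - u n z) < inverse (real (Suc n))"
    "\<And>n. nsq (\<lambda>z. d1 (\<phi> n) z - D1 (u n) z) < inverse (real (Suc n))" by blast
  have lim': "(\<lambda>n. nsq (\<lambda>z. a n z - b z)) \<longlonglongrightarrow> 0"
    if L: "\<And>n. a n \<in> L2u" "\<And>n. c n \<in> L2u" "b \<in> L2u"
      and le: "\<And>n. nsq (\<lambda>z. a n z - c n z) < inverse (real (Suc n))"
      and l: "(\<lambda>n. nsq (\<lambda>z. c n z - b z)) \<longlonglongrightarrow> 0" for a c b
  proof (rule tendsto_sandwich[OF always_eventually always_eventually tendsto_const])
    show "\<forall>n. 0 \<le> nsq (\<lambda>z. a n z - b z)" by (intro allI nsq_nonneg)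
    show "\<forall>n. nsq (\<lambda>z. a n z - b z) \<le> 2 * inverse (real (Suc n)) + 2 * nsq (\<lambda>z. c n z - b z)"
    proof
      show "nsq (\<lambda>z. a n z - b z) \<le> 2 * inverse (real (Suc n)) + 2 * nsq (\<lambda>z. c n z - b z)" for n
        using nsq_triangle[OF L(1) L(2) L(3), of n n] le[of n] by linarith
    qed
    show "(\<lambda>n. 2 * inverse (real (Suc n)) + 2 * nsq (\<lambda>z. c n z - b z)) \<longlonglongrightarrow> 0"
      using tendsto_add[OF tendsto_mult_left[OF LIMSEQ_inverse_real_of_nat, of 2] tendsto_mult_left[OF l, of 2]]
      by simp
  qed
  note t = test_function_L2[OF \<phi>(1)]
  show "w \<in> H1_0 unit_ivl" "AE z in lebesgue_unit. D1 w z = g z"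
    using H1_0I[OF \<phi>(1) wg lim'[OF t(1) U(1) wg(1) \<phi>(2) lim(1)] lim'[OF t(2) U(2) wg(2) \<phi>(3) lim(2)]]
    by auto
qed

lemma H1_0_complete:
  assumes u: "\<And>n. u n \<in> H1_0 unit_ivl"
    and C1: "\<And>e. e > 0 \<Longrightarrow> \<exists>N. \<forall>m\<ge>N. \<forall>n\<ge>N. nsq (\<lambda>z. u m z - u n z) < e"
    and C2: "\<And>e. e > 0 \<Longrightarrow> \<exists>N. \<forall>m\<ge>N. \<forall>n\<ge>N. nsq (\<lambda>z. D1 (u m) z - D1 (u n) z) < e"
  shows "\<exists>w\<in>H1_0 unit_ivl. (\<lambda>n. nsq (\<lambda>z. u n z - w z)) \<longlonglongrightarrow> 0
    \<and> (\<lambda>n. nsq (D1 (\<lambda>z. u n z - w z))) \<longlonglongrightarrow> 0"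
proof -
  note U = H1_0D[OF u]
  obtain w where w: "w \<in> L2u" "(\<lambda>n. nsq (\<lambda>z. u n z - w z)) \<longlonglongrightarrow> 0"
    using L2_complete[OF U(1) C1] by blast
  obtain g where g: "g \<in> L2u" "(\<lambda>n. nsq (\<lambda>z. D1 (u n) z - g z)) \<longlonglongrightarrow> 0"
    using L2_complete[OF U(2) C2] by blast
  note W = H1_0_closed[OF u w(1) g(1) w(2) g(2)]
  have "nsq (D1 (\<lambda>z. u n z - w z)) = nsq (\<lambda>z. D1 (u n) z - g z)" for n
    unfolding H1_0_diff(2)[OF u W(1)]
    using W(2) by (intro nsq_cong_AE L2_measurable[OF L2.diff[OF U(2) g(1)]]
        L2_measurable[OF L2.diff[OF U(2) H1_0D(2)[OF W(1)]]]) (auto elim!: eventually_mono)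
  then show ?thesis using W(1) w(2) g(2) by auto
qed

text \<open>Rellich's theorem in one dimension. The Hoelder representatives vanish at 0 and share
  one modulus of continuity, so they are uniformly bounded and Arzela-Ascoli gives a uniformly
  convergent subsequence.\<close>

lemma H1_0_compact:
  assumes u: "\<And>n. u n \<in> H1_0 unit_ivl" and K: "\<And>n. nsq (D1 (u n)) \<le> K"
  shows "\<exists>r :: nat \<Rightarrow> nat. strict_mono r \<and>
    (\<forall>e>0. \<exists>N. \<forall>m\<ge>N. \<forall>n\<ge>N. nsq (\<lambda>z. u (r m) z - u (r n) z) < e)"
proof -
  have "\<exists>v. (AE z in lebesgue_unit. u n z = v z) \<and> v 0 = 0 \<and>
      (\<forall>x\<in>{0..1}. \<forall>y\<in>{0..1}. (cmod (v x - v y))\<^sup>2 \<le> \<bar>x - y\<bar> * K)" for n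
  proof -
    obtain v where v: "AE z in lebesgue_unit. u n z = v z" "v 0 = 0"
      "\<And>x y. x \<in> {0..1} \<Longrightarrow> y \<in> {0..1} \<Longrightarrow> (cmod (v x - v y))\<^sup>2 \<le> \<bar>x - y\<bar> * nsq (D1 (u n))"
      using H1_0_Hoelder[OF u] by blast
    have "(cmod (v x - v y))\<^sup>2 \<le> \<bar>x - y\<bar> * K" if "x \<in> {0..1}" "y \<in> {0..1}" for x y
      by (rule order_trans[OF v(3)[OF that] mult_left_mono[OF K]]) simp
    then show ?thesis using v(1,2) by blast
  qed
  then have "\<forall>n. \<exists>v. (AE z in lebesgue_unit. u n z = v z) \<and> v 0 = 0 \<and>
      (\<forall>x\<in>{0..1}. \<forall>y\<in>{0..1}. (cmod (v x - v y))\<^sup>2 \<le> \<bar>x - y\<bar> * K)" by (rule allI)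
  from choice[OF this]
  obtain v where v: "\<And>n. AE z in lebesgue_unit. u n z = v n z" "\<And>n. v n 0 = 0"
    "\<And>n x y. x \<in> {0..1} \<Longrightarrow> y \<in> {0..1} \<Longrightarrow> (cmod (v n x - v n y))\<^sup>2 \<le> \<bar>x - y\<bar> * K"
    by blast
  have K0: "0 \<le> K" using K[of 0] nsq_nonneg order_trans by blast
  have bound: "cmod (v n x) \<le> sqrt K" if x: "x \<in> {0..1}" for n x
  proof (rule real_le_rsqrt)
    have "(cmod (v n x))\<^sup>2 \<le> \<bar>x\<bar> * K" using v(3)[OF x, of 0 n] v(2) by simp
    also have "\<dots> \<le> 1 * K" using x K0 by (intro mult_right_mono) auto
    finally show "(cmod (v n x))\<^sup>2 \<le> K" by simp
  qed
  have equi: "\<exists>d>0. \<forall>n y. y \<in> {0..1} \<and> norm (x - y) < d \<longrightarrow> cmod (v n x - v n y) < e"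
    if x: "x \<in> {0..1}" and e: "0 < e" for x e
  proof (intro exI[of _ "e\<^sup>2 / (K + 1)"] conjI allI impI)
    show "0 < e\<^sup>2 / (K + 1)" using e K0 by simp
    fix n y assume y: "y \<in> {0..1} \<and> norm (x - y) < e\<^sup>2 / (K + 1)"
    have "(cmod (v n x - v n y))\<^sup>2 \<le> \<bar>x - y\<bar> * K" using v(3)[OF x] y by blast
    also have "\<dots> \<le> \<bar>x - y\<bar> * (K + 1)" by (intro mult_left_mono) auto
    also have "\<dots> < e\<^sup>2" using y K0 by (simp add: pos_less_divide_eq)
    finally show "cmod (v n x - v n y) < e"
      using e by (intro power_less_imp_less_base[of _ 2 e]) auto
  qed
  obtain g r where r: "strict_mono (r :: nat \<Rightarrow> nat)"
    and g: "\<And>e. 0 < e \<Longrightarrow> \<exists>N. \<forall>n x. n \<ge> N \<and> x \<in> {0..1} \<longrightarrow> cmod (v (r n) x - g x) < e"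
    by (rule Arzela_Ascoli[of "{0..1::real}" v "sqrt K", OF compact_Icc bound equi]) blast+
  have "\<exists>N. \<forall>m\<ge>N. \<forall>n\<ge>N. nsq (\<lambda>z. u (r m) z - u (r n) z) < e" if e: "e > 0" for e
  proof -
    \<comment> \<open>Two uniform errors of this size give a squared distance of at most 4 e / 9 <
      e.\<close>
    let ?\<delta> = "sqrt e / 3"
    have \<delta>: "?\<delta> > 0" using e by simp
    obtain N where N: "\<And>n x. n \<ge> N \<Longrightarrow> x \<in> {0..1} \<Longrightarrow> cmod (v (r n) x - g x) < ?\<delta>"
      using g[OF \<delta>] by blast
    have "nsq (\<lambda>z. u (r m) z - u (r n) z) < e" if mn: "m \<ge> N" "n \<ge> N" for m n
    proof -
      have "AE z in lebesgue_unit. z \<in> {0..1}" by (rule AE_I2) auto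
      then have "AE z in lebesgue_unit. cmod (u (r m) z - u (r n) z) \<le> 2 * ?\<delta>"
        using v(1)[of "r m"] v(1)[of "r n"]
      proof eventually_elim
        case (elim z)
        have "cmod (v (r m) z - v (r n) z) \<le> cmod (v (r m) z - g z) + cmod (v (r n) z - g z)"
          using norm_triangle_ineq4[of "v (r m) z - g z" "v (r n) z - g z"] by simp
        then show ?case using N[OF mn(1) elim(1)] N[OF mn(2) elim(1)] elim by simp
      qed
      then have "nsq (\<lambda>z. u (r m) z - u (r n) z) \<le> (2 * ?\<delta>)\<^sup>2"
        by (rule nsq_le_of_bound[OF L2.diff[OF H1_0D(1)[OF u] H1_0D(1)[OF u]]])
      also have "\<dots> < e" using e by (simp add: power_mult_distrib power_divide)
      finally show ?thesis .
    qed
    then show ?thesis by blast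
  qed
  then have "\<forall>e>0. \<exists>N. \<forall>m\<ge>N. \<forall>n\<ge>N. nsq (\<lambda>z. u (r m) z - u (r n) z) < e" by (intro allI impI)
  with r show ?thesis by (intro exI[of _ r] conjI)
qed

text \<open>Average |v x|^2 \<le> 2 |v z|^2 + 2 |v x - v z|^2 over z in an interval of length l that
  contains x. The free parameter is the point: the factor 2 l of the derivative term can be made
  small, at the price of a larger multiple of the norm of u.\<close>

lemma H1_0_sup:
  assumes u: "u \<in> H1_0 unit_ivl" and l: "0 < l" "l \<le> 1"
  shows "AE z in lebesgue_unit. (cmod (u z))\<^sup>2 \<le> 2 / l * nsq u + 2 * l * nsq (D1 u)"
proof -
  note U = H1_0D[OF u]
  obtain v where v: "AE z in lebesgue_unit. u z = v z"
    "\<And>x y. x \<in> {0..1} \<Longrightarrow> y \<in> {0..1} \<Longrightarrow> (cmod (v x - v y))\<^sup>2 \<le> \<bar>x - y\<bar> * nsq (D1 u)"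
    by (rule H1_0_Hoelder[OF u]) metis
  have bound: "(cmod (v x))\<^sup>2 \<le> 2 / l * nsq u + 2 * l * nsq (D1 u)" if x: "x \<in> unit_ivl" for x
  proof -
    \<comment> \<open>The left end is moved when x is close to 1, so that the interval stays inside
      [0,1] and still contains x.\<close>
    define a where "a = min x (1 - l)"
    have a: "0 \<le> a" "a \<le> a + l" "a + l \<le> 1" "x \<in> {a..a + l}"
      using x l by (auto simp: a_def min_def)
    define i where "i = (\<lambda>z. if z \<in> {a..a + l} then 1 else 0 :: complex)"
    have i: "i \<in> L2u" "nsq i = l"
      using interval_indicator_L2[OF a(1-3)] by (simp_all add: i_def)
    have iz: "cmod (i z) = (if z \<in> {a..a + l} then 1 else 0)" for z by (simp add: i_def)
    have int: "integrable lebesgue_unit (\<lambda>z. (cmod (i z))\<^sup>2)" using i(1) by (simp only: L2_iff)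
    have intu: "integrable lebesgue_unit (\<lambda>z. (cmod (u z))\<^sup>2)" using U(1) by (simp only: L2_iff)
    \<comment> \<open>The factor |i|^2 restricts the integration to the interval; the term in u is
      enlarged to all of (0,1).\<close>
    have "(\<integral>z. (cmod (i z))\<^sup>2 * (cmod (v x))\<^sup>2 \<partial>lebesgue_unit)
        \<le> (\<integral>z. 2 * (cmod (u z))\<^sup>2 + (cmod (i z))\<^sup>2 * (2 * l * nsq (D1 u)) \<partial>lebesgue_unit)"
    proof (rule integral_mono_AE)
      have "AE z in lebesgue_unit. z \<in> unit_ivl" by (rule AE_I2) auto
      with v(1) show "AE z in lebesgue_unit. (cmod (i z))\<^sup>2 * (cmod (v x))\<^sup>2
          \<le> 2 * (cmod (u z))\<^sup>2 + (cmod (i z))\<^sup>2 * (2 * l * nsq (D1 u))"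
      proof eventually_elim
        case (elim z)
        show ?case
        proof (cases "z \<in> {a..a + l}")
          case True
          have "(cmod (v x - v z))\<^sup>2 \<le> \<bar>x - z\<bar> * nsq (D1 u)" using v(2)[of x z] x elim(2) by auto
          also have "\<dots> \<le> l * nsq (D1 u)"
            using True a(4) by (intro mult_right_mono nsq_nonneg) auto
          finally have 1: "(cmod (v x - v z))\<^sup>2 \<le> l * nsq (D1 u)" .
          have "(cmod (v x))\<^sup>2 \<le> (cmod (v z) + cmod (v x - v z))\<^sup>2"
            using norm_triangle_ineq[of "v z" "v x - v z"] by (intro power_mono) auto
          also have "\<dots> \<le> 2 * (cmod (v z))\<^sup>2 + 2 * (cmod (v x - v z))\<^sup>2"
            using sum_squares_bound[of "cmod (v z)" "cmod (v x - v z)"] by (simp add: power2_sum)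
          finally show ?thesis using 1 True elim(1) by (simp add: iz)
        next
          case False
          then have "cmod (i z) = 0" by (simp only: iz if_False)
          then show ?thesis by simp
        qed
      qed
    qed (use int intu in auto)
    also have "\<dots> = 2 * nsq u + l * (2 * l * nsq (D1 u))"
      using int intu i(2) by (simp add: nsq_eq[symmetric])
    also have "(\<integral>z. (cmod (i z))\<^sup>2 * (cmod (v x))\<^sup>2 \<partial>lebesgue_unit) = l * (cmod (v x))\<^sup>2"
      using int i(2) by (simp add: nsq_eq[symmetric])
    finally show ?thesis using l by (simp add: field_simps)
  qed
  have "AE z in lebesgue_unit. z \<in> unit_ivl" by (rule AE_I2) auto
  with v(1) show ?thesis
  proof eventually_elim
    case (elim z)
    then show ?case using bound[OF elim(2)] by (simp only:)
  qed
qed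

section \<open>The transverse Schroedinger form\<close>

definition schroedinger_form :: "(real \<Rightarrow> real) \<Rightarrow> (real \<Rightarrow> complex) \<Rightarrow> (real \<Rightarrow> complex) \<Rightarrow> complex" where
  "schroedinger_form W u w = L2_inner (D1 u) (D1 w) / 2 + L2_inner (\<lambda>z. complex_of_real (W z) * u z) w"

lemma H1_0_bounded:
  assumes "u \<in> H1_0 unit_ivl"
  obtains C where "0 \<le> C" "AE z in lebesgue_unit. cmod (u z) \<le> C"
proof -
  let ?C = "2 * nsq u + 2 * nsq (D1 u)"
  have "AE z in lebesgue_unit. (cmod (u z))\<^sup>2 \<le> ?C"
    using H1_0_sup[OF assms, of 1] by simp
  then have "AE z in lebesgue_unit. cmod (u z) \<le> sqrt ?C"
    by eventually_elim (rule real_le_rsqrt)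
  moreover have "0 \<le> sqrt ?C" using nsq_nonneg[of u] nsq_nonneg[of "D1 u"] by simp
  ultimately show ?thesis using that by blast
qed

text \<open>Elements of \<open>H1_0\<close> are bounded almost everywhere, so an integrable
  potential is enough.\<close>

lemma potential_mult_integrable:
  assumes W: "integrable lebesgue_unit W" and u: "u \<in> H1_0 unit_ivl" and w: "w \<in> H1_0 unit_ivl"
  shows "integrable lebesgue_unit (\<lambda>z. complex_of_real (W z) * u z * cnj (w z))"
proof -
  have [measurable]: "u \<in> borel_measurable lebesgue_unit" "w \<in> borel_measurable lebesgue_unit"
    "W \<in> borel_measurable lebesgue_unit"
    using L2_measurable[OF H1_0D(1)[OF u]] L2_measurable[OF H1_0D(1)[OF w]] W by auto
  obtain C where C: "0 \<le> C" "AE z in lebesgue_unit. cmod (u z) \<le> C" by (rule H1_0_bounded[OF u])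
  obtain D where D: "0 \<le> D" "AE z in lebesgue_unit. cmod (w z) \<le> D" by (rule H1_0_bounded[OF w])
  have "integrable lebesgue_unit (\<lambda>z. W z * (C * D))" using W by simp
  then show ?thesis
  proof (rule Bochner_Integration.integrable_bound)
    show "AE z in lebesgue_unit. norm (complex_of_real (W z) * u z * cnj (w z)) \<le> norm (W z * (C * D))"
      using C(2) D(2)
    proof eventually_elim
      case (elim z)
      have "cmod (u z) * cmod (w z) \<le> C * D"
        using elim C(1) by (intro mult_mono) auto
      then show ?case using C(1) D(1)
        by (simp add: norm_mult abs_mult mult.assoc mult_left_mono)
    qed
  qed measurable
qed

lemma schroedinger_form_comb:
  assumes W: "integrable lebesgue_unit W" and u: "u \<in> H1_0 unit_ivl" and w: "w \<in> H1_0 unit_ivl"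
    and v: "v \<in> H1_0 unit_ivl"
  shows "schroedinger_form W (\<lambda>z. u z + c * w z) v = schroedinger_form W u v + c * schroedinger_form W w v"
proof -
  note D = H1_0D(2)[OF u] H1_0D(2)[OF w] H1_0D(2)[OF v]
  have "L2_inner (D1 (\<lambda>z. u z + c * w z)) (D1 v) = L2_inner (\<lambda>z. D1 u z + c * D1 w z) (D1 v)"
    by (rule L2_inner_cong_AE[OF H1_0_comb(2)[OF u w] _ L2_measurable[OF H1_0D(2)[OF H1_0_comb(1)[OF u w]]]
          L2_measurable[OF D(3)] L2_measurable[OF L2_comb[OF D(1,2)]] L2_measurable[OF D(3)]]) simp
  also have "\<dots> = L2_inner (D1 u) (D1 v) + c * L2_inner (D1 w) (D1 v)" by (rule L2.h_comb[OF D])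
  finally have 1: "L2_inner (D1 (\<lambda>z. u z + c * w z)) (D1 v) = L2_inner (D1 u) (D1 v) + c * L2_inner (D1 w) (D1 v)" .
  have "L2_inner (\<lambda>z. complex_of_real (W z) * (u z + c * w z)) v
      = (\<integral>z. complex_of_real (W z) * u z * cnj (v z) + c * (complex_of_real (W z) * w z * cnj (v z)) \<partial>lebesgue_unit)"
    unfolding L2_inner_def by (rule Bochner_Integration.integral_cong) (simp_all add: algebra_simps)
  also have "\<dots> = L2_inner (\<lambda>z. complex_of_real (W z) * u z) v + c * L2_inner (\<lambda>z. complex_of_real (W z) * w z) v"
    unfolding L2_inner_def
    using potential_mult_integrable[OF W u v] potential_mult_integrable[OF W w v] by simp
  finally show ?thesis
    unfolding schroedinger_form_def 1 by (simp add: algebra_simps add_divide_distrib)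
qed

lemma schroedinger_form_cnj:
  assumes u: "u \<in> H1_0 unit_ivl" and w: "w \<in> H1_0 unit_ivl"
  shows "schroedinger_form W w u = cnj (schroedinger_form W u w)"
proof -
  have "L2_inner (\<lambda>z. complex_of_real (W z) * w z) u = cnj (L2_inner (\<lambda>z. complex_of_real (W z) * u z) w)"
    unfolding L2_inner_def by (subst Bochner_Integration.integral_cnj[symmetric]) (simp add: mult_ac)
  then show ?thesis
    using L2.h_cnj[OF H1_0D(2)[OF u] H1_0D(2)[OF w]] by (simp add: schroedinger_form_def)
qed

definition form_bound :: "(real \<Rightarrow> real) \<Rightarrow> real" where
  "form_bound W = (\<integral>z. \<bar>W z\<bar> \<partial>lebesgue_unit)"

lemma form_bound_nonneg: "0 \<le> form_bound W"
  unfolding form_bound_def by (rule Bochner_Integration.integral_nonneg) simp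

lemma potential_form_bound:
  assumes W: "integrable lebesgue_unit W" and u: "u \<in> H1_0 unit_ivl" and l: "0 < l" "l \<le> 1"
  shows "\<bar>Re (L2_inner (\<lambda>z. complex_of_real (W z) * u z) u)\<bar>
    \<le> form_bound W * (2 / l * nsq u + 2 * l * nsq (D1 u))"
proof -
  let ?S = "2 / l * nsq u + 2 * l * nsq (D1 u)"
  have "\<bar>Re (L2_inner (\<lambda>z. complex_of_real (W z) * u z) u)\<bar>
      \<le> cmod (L2_inner (\<lambda>z. complex_of_real (W z) * u z) u)" by (rule abs_Re_le_cmod)
  also have "\<dots> \<le> (\<integral>z. norm (complex_of_real (W z) * u z * cnj (u z)) \<partial>lebesgue_unit)"
    unfolding L2_inner_def by (rule integral_norm_bound)
  also have "\<dots> \<le> (\<integral>z. \<bar>W z\<bar> * ?S \<partial>lebesgue_unit)"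
  proof (rule integral_mono_AE)
    show "integrable lebesgue_unit (\<lambda>z. norm (complex_of_real (W z) * u z * cnj (u z)))"
      by (rule integrable_norm[OF potential_mult_integrable[OF W u u]])
    show "integrable lebesgue_unit (\<lambda>z. \<bar>W z\<bar> * ?S)" using W by simp
    show "AE z in lebesgue_unit. norm (complex_of_real (W z) * u z * cnj (u z)) \<le> \<bar>W z\<bar> * ?S"
      using H1_0_sup[OF u l]
    proof eventually_elim
      case (elim z)
      then show ?case
        using mult_left_mono[OF elim, of "\<bar>W z\<bar>"] by (simp add: norm_mult power2_eq_square mult.assoc)
    qed
  qed
  finally show ?thesis by (simp add: form_bound_def)
qed

lemma schroedinger_form_quad:
  "Re (schroedinger_form W u u) = nsq (D1 u) / 2 + Re (L2_inner (\<lambda>z. complex_of_real (W z) * u z) u)"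
  by (simp add: schroedinger_form_def)

text \<open>Origin of the constant: let w be the L^1 norm of W and l = 1/(8 (w + 1)) in the sup
  bound. Multiplied by w, that bound is 16 w (w + 1) times the squared norm of u plus w/(w + 1)
  \<le> 1 times a quarter of the squared norm of the derivative; the factor 1/2 of the kinetic term
  absorbs the latter and leaves 1/4.\<close>

definition form_shift :: "(real \<Rightarrow> real) \<Rightarrow> real" where
  "form_shift W = 16 * form_bound W * (form_bound W + 1)"

lemma schroedinger_form_coercive:
  assumes W: "integrable lebesgue_unit W" and u: "u \<in> H1_0 unit_ivl"
  shows "nsq (D1 u) / 4 - form_shift W * nsq u \<le> Re (schroedinger_form W u u)"
proof -
  let ?w = "form_bound W"
  let ?l = "1 / (8 * (?w + 1))"
  have w: "0 \<le> ?w" by (rule form_bound_nonneg)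
  have l: "0 < ?l" "?l \<le> 1" using w by (simp_all add: field_simps)
  have "?w * (2 / ?l * nsq u + 2 * ?l * nsq (D1 u)) = form_shift W * nsq u + ?w / (?w + 1) * (nsq (D1 u) / 4)"
    using w by (simp add: form_shift_def field_simps)
  also have "\<dots> \<le> form_shift W * nsq u + 1 * (nsq (D1 u) / 4)"
    using w nsq_nonneg[of "D1 u"] by (intro add_left_mono mult_right_mono) (simp_all add: field_simps)
  finally show ?thesis
    using potential_form_bound[OF W u l] unfolding schroedinger_form_quad by linarith
qed

text \<open>Coercivity converts bounds and Cauchy conditions for the form into the same for the
  derivatives, and then compactness and completeness of \<open>H1_0\<close> apply.\<close>

lemma semibounded_schroedinger_form:
  assumes W: "integrable lebesgue_unit W"
  shows "semibounded_form (H1_0 unit_ivl) L2_inner (schroedinger_form W) (form_shift W)"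
proof -
  let ?X = "H1_0 unit_ivl :: (real \<Rightarrow> complex) set" and ?C = "form_shift W"
  have C: "0 \<le> ?C" using form_bound_nonneg[of W] by (simp add: form_shift_def)
  have s: "hermitian_form ?X L2_inner"
  proof
    fix u w v :: "real \<Rightarrow> complex" and c
    assume u: "u \<in> ?X"
    show "(\<lambda>z. u z + c * w z) \<in> ?X" if "w \<in> ?X" by (rule H1_0_comb(1)[OF u that])
    show "L2_inner (\<lambda>z. u z + c * w z) v = L2_inner u v + c * L2_inner w v" if "w \<in> ?X" "v \<in> ?X"
      by (rule L2.h_comb[OF H1_0D(1)[OF u] H1_0D(1)[OF that(1)] H1_0D(1)[OF that(2)]])
    show "L2_inner v u = cnj (L2_inner u v)" if "v \<in> ?X"
      by (rule L2.h_cnj[OF H1_0D(1)[OF u] H1_0D(1)[OF that]])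
  qed
  have B: "hermitian_form ?X (schroedinger_form W)"
  proof
    fix u w v :: "real \<Rightarrow> complex" and c
    assume u: "u \<in> ?X"
    show "(\<lambda>z. u z + c * w z) \<in> ?X" if "w \<in> ?X" by (rule H1_0_comb(1)[OF u that])
    show "schroedinger_form W (\<lambda>z. u z + c * w z) v = schroedinger_form W u v + c * schroedinger_form W w v"
      if "w \<in> ?X" "v \<in> ?X" by (rule schroedinger_form_comb[OF W u that])
    show "schroedinger_form W v u = cnj (schroedinger_form W u v)" if "v \<in> ?X"
      by (rule schroedinger_form_cnj[OF u that])
  qed
  have compact: "\<exists>r :: nat \<Rightarrow> nat. strict_mono r \<and> (\<forall>e>0. \<exists>N. \<forall>m\<ge>N. \<forall>n\<ge>N.
        nsq (\<lambda>z. v (r m) z - v (r n) z) < e)"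
    if v: "\<And>n. v n \<in> ?X" "\<And>n. nsq (v n) \<le> 1" "\<And>n. Re (schroedinger_form W (v n) (v n)) \<le> K" for v K
  proof (rule H1_0_compact[OF v(1)])
    fix n
    have "?C * nsq (v n) \<le> ?C" using mult_left_mono[OF v(2)[of n] C] by simp
    then have "nsq (D1 (v n)) / 4 \<le> K + ?C"
      using schroedinger_form_coercive[OF W v(1), of n] v(3)[of n] by linarith
    then show "nsq (D1 (v n)) \<le> 4 * (K + ?C)" by simp
  qed
  have complete: "\<exists>w\<in>?X. (\<lambda>n. nsq (\<lambda>z. v n z - w z)) \<longlonglongrightarrow> 0
         \<and> (\<lambda>n. Re (schroedinger_form W (\<lambda>z. v n z - w z) (\<lambda>z. v n z - w z))) \<longlonglongrightarrow> 0"
    if v: "\<And>n. v n \<in> ?X"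
      and C1: "\<forall>e>0. \<exists>N. \<forall>m\<ge>N. \<forall>n\<ge>N. nsq (\<lambda>z. v m z - v n z) < e"
      and C2: "\<forall>e>0. \<exists>N. \<forall>m\<ge>N. \<forall>n\<ge>N. Re (schroedinger_form W (\<lambda>z. v m z - v n z) (\<lambda>z. v m z - v n z)) < e" for v
  proof -
    have C2': "\<exists>N. \<forall>m\<ge>N. \<forall>n\<ge>N. nsq (\<lambda>z. D1 (v m) z - D1 (v n) z) < e" if e: "e > 0" for e
    proof -
      \<comment> \<open>Coercivity bounds a quarter of the squared derivative norm by the form plus
        \<open>form_shift W\<close> times the squared norm; each of these two is made at most
        e/8.\<close>
      have e1: "e / 8 > 0" "e / (8 * (?C + 1)) > 0" using e C by auto
      obtain N1 where N1: "\<forall>m\<ge>N1. \<forall>n\<ge>N1. Re (schroedinger_form W (\<lambda>z. v m z - v n z) (\<lambda>z. v m z - v n z)) < e / 8"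
        using C2[rule_format, OF e1(1)] by blast
      obtain N2 where N2: "\<forall>m\<ge>N2. \<forall>n\<ge>N2. nsq (\<lambda>z. v m z - v n z) < e / (8 * (?C + 1))"
        using C1[rule_format, OF e1(2)] by blast
      have "nsq (\<lambda>z. D1 (v m) z - D1 (v n) z) < e" if mn: "m \<ge> max N1 N2" "n \<ge> max N1 N2" for m n
      proof -
        let ?d = "\<lambda>z. v m z - v n z"
        have "?C * nsq ?d \<le> (?C + 1) * nsq ?d" by (intro mult_right_mono nsq_nonneg) simp
        also have "\<dots> \<le> (?C + 1) * (e / (8 * (?C + 1)))"
          using N2 mn C by (intro mult_left_mono) (auto intro: less_imp_le)
        also have "\<dots> = e / 8" using C by (simp add: field_simps)
        finally have "?C * nsq ?d \<le> e / 8" .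
        moreover have "Re (schroedinger_form W ?d ?d) < e / 8" using N1 mn by simp
        ultimately have "nsq (D1 ?d) < e"
          using schroedinger_form_coercive[OF W H1_0_diff(1)[OF v v], of m n] by linarith
        then show ?thesis by (simp only: H1_0_diff(2)[OF v v])
      qed
      then show ?thesis by blast
    qed
    obtain w where w: "w \<in> ?X" "(\<lambda>n. nsq (\<lambda>z. v n z - w z)) \<longlonglongrightarrow> 0" "(\<lambda>n. nsq (D1 (\<lambda>z. v n z - w z))) \<longlonglongrightarrow> 0"
      using H1_0_complete[OF v C1[rule_format] C2'] by blast
    have "(\<lambda>n. Re (schroedinger_form W (\<lambda>z. v n z - w z) (\<lambda>z. v n z - w z))) \<longlonglongrightarrow> 0"
    proof (rule Lim_null_comparison[OF always_eventually])
      show "\<forall>n. norm (Re (schroedinger_form W (\<lambda>z. v n z - w z) (\<lambda>z. v n z - w z)))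
          \<le> nsq (D1 (\<lambda>z. v n z - w z)) / 2 + form_bound W * (2 * nsq (\<lambda>z. v n z - w z) + 2 * nsq (D1 (\<lambda>z. v n z - w z)))"
      proof
        fix n
        show "norm (Re (schroedinger_form W (\<lambda>z. v n z - w z) (\<lambda>z. v n z - w z)))
          \<le> nsq (D1 (\<lambda>z. v n z - w z)) / 2 + form_bound W * (2 * nsq (\<lambda>z. v n z - w z) + 2 * nsq (D1 (\<lambda>z. v n z - w z)))"
          using potential_form_bound[OF W H1_0_diff(1)[OF v w(1)], of 1 n] nsq_nonneg[of "D1 (\<lambda>z. v n z - w z)"]
          unfolding schroedinger_form_quad real_norm_def by simp
      qed
      have "(\<lambda>n. nsq (D1 (\<lambda>z. v n z - w z)) / 2 + form_bound W * (2 * nsq (\<lambda>z. v n z - w z) + 2 * nsq (D1 (\<lambda>z. v n z - w z))))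
          \<longlonglongrightarrow> 0 / 2 + form_bound W * (2 * 0 + 2 * 0)"
        by (rule tendsto_add[OF tendsto_divide[OF w(3) tendsto_const] tendsto_mult_left[OF
            tendsto_add[OF tendsto_mult_left[OF w(2)] tendsto_mult_left[OF w(3)]]]]) simp
      then show "(\<lambda>n. nsq (D1 (\<lambda>z. v n z - w z)) / 2 + form_bound W * (2 * nsq (\<lambda>z. v n z - w z) + 2 * nsq (D1 (\<lambda>z. v n z - w z))))
          \<longlonglongrightarrow> 0" by simp
    qed
    then show ?thesis using w by blast
  qed
  show ?thesis
  proof (intro semibounded_form.intro s B semibounded_form_axioms.intro)
    fix u :: "real \<Rightarrow> complex" assume u: "u \<in> ?X"
    show "0 \<le> nsq u" by (rule nsq_nonneg)
    show "- ?C * nsq u \<le> Re (schroedinger_form W u u)"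
      using schroedinger_form_coercive[OF W u] nsq_nonneg[of "D1 u"] by simp
  qed (rule compact complete; assumption)+
qed

lemma schroedinger_eq_iff:
  assumes W: "integrable lebesgue_unit W"
  shows "schroedinger_eq W E u \<longleftrightarrow> u \<in> H1_0 unit_ivl \<and>
    (\<forall>\<phi>\<in>H1_0 unit_ivl. schroedinger_form W u \<phi> = complex_of_real E * L2_inner u \<phi>)"
  unfolding schroedinger_eq_def schroedinger_form_def
  using potential_mult_integrable[OF W] by blast

lemma eigenvalues_lower_bound:
  assumes W: "integrable lebesgue_unit W" and lam: "eigenvalues W lam"
    and e: "\<And>k. schroedinger_eq W (lam k) (e k)"
    and orth: "\<And>k l. L2_inner (e k) (e l) = (if k = l then 1 else 0)"
  obtains K where "{k. lam k < m} = {..<K}"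
    and "\<And>u. u \<in> H1_0 unit_ivl \<Longrightarrow>
      m * nsq u - (\<Sum>k<K. (m - lam k) * (cmod (L2_inner u (e k)))\<^sup>2) \<le> Re (schroedinger_form W u u)"
proof -
  interpret semibounded_form "H1_0 unit_ivl" L2_inner "schroedinger_form W" "form_shift W"
    by (rule semibounded_schroedinger_form[OF W])
  have eX: "e k \<in> H1_0 unit_ivl" for k using e[of k] by (simp add: schroedinger_eq_iff[OF W])
  show ?thesis
  proof (rule eigenvalue_lower_bound[of lam e m])
    show "mono lam" "finite {j. lam j = E}" for E using lam by (auto simp: eigenvalues_def)
    show "orthonormal n e" for n by (simp add: orthonormal_def eX orth)
    show "schroedinger_form W (e k) \<phi> = complex_of_real (lam k) * L2_inner (e k) \<phi>"
      if "\<phi> \<in> H1_0 unit_ivl" for k \<phi> using e[of k] that by (simp add: schroedinger_eq_iff[OF W])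
    show "n \<le> card {j. lam j = E}" if v: "orthonormal n v"
      and eig: "\<And>k \<phi>. k < n \<Longrightarrow> \<phi> \<in> H1_0 unit_ivl \<Longrightarrow> schroedinger_form W (v k) \<phi> = complex_of_real E * L2_inner (v k) \<phi>"
      for E n v
    proof -
      have "\<forall>k<n. schroedinger_eq W E (v k)"
        using v eig by (simp add: schroedinger_eq_iff[OF W] orthonormal_def)
      moreover have "\<forall>k<n. \<forall>l<n. L2_inner (v k) (v l) = (if k = l then 1 else 0)"
        using v by (simp add: orthonormal_def)
      ultimately show ?thesis using lam unfolding eigenvalues_def by blast
    qed
  qed (rule that)
qed

lemma orthonormal_Bessel:
  assumes u: "u \<in> H1_0 unit_ivl" and e: "\<And>k. e k \<in> H1_0 unit_ivl"
    and orth: "\<And>k l. L2_inner (e k) (e l) = (if k = l then 1 else 0)"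
  shows "(\<Sum>k<(n::nat). (cmod (L2_inner u (e k)))\<^sup>2) \<le> nsq u"
proof -
  \<comment> \<open>Bessel's inequality was proved for semibounded forms; the zero potential
    provides one on this space.\<close>
  have "integrable lebesgue_unit (\<lambda>_. 0 :: real)" by simp
  from semibounded_schroedinger_form[OF this]
  interpret semibounded_form "H1_0 unit_ivl" L2_inner "schroedinger_form (\<lambda>_. 0)"
    "form_shift (\<lambda>_. 0)" .
  show ?thesis by (rule Bessel[OF _ u]) (simp add: orthonormal_def e orth)
qed

section \<open>Iterated integrals for the completed Lebesgue measure\<close>

lemma complete_lebesgue_on:
  assumes "S \<in> sets lebesgue"
  shows "complete_measure (lebesgue_on S)"
proof
  fix A B :: "'a set" assume "B \<subseteq> A" "A \<in> null_sets (lebesgue_on S)"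
  then have "A \<in> null_sets lebesgue" "A \<subseteq> S"
    using assms by (auto simp: null_sets_restrict_space)
  then have "B \<in> null_sets lebesgue" "B \<subseteq> S"
    using \<open>B \<subseteq> A\<close> completion.complete2 by auto
  then show "B \<in> sets (lebesgue_on S)"
    using assms by (auto simp: sets_restrict_space_iff)
qed

lemma borel_measurable_lebesgue_on_AE:
  assumes S: "S \<in> sets lebesgue" and f: "f \<in> borel_measurable (lebesgue_on S)"
    and ae: "AE x in lebesgue_on S. f x = g x"
  shows "g \<in> borel_measurable (lebesgue_on S)"
proof (rule borel_measurableI)
  fix T :: "'b set" assume T: "open T"
  show "g -` T \<inter> space (lebesgue_on S) \<in> sets (lebesgue_on S)"
  proof (rule complete_measure.in_sets_AE[OF complete_lebesgue_on[OF S]])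
    show "f -` T \<inter> space (lebesgue_on S) \<in> sets (lebesgue_on S)"
      by (rule measurable_sets[OF f]) (use T in simp)
    show "AE x in lebesgue_on S. (x \<in> f -` T \<inter> space (lebesgue_on S)) = (x \<in> g -` T \<inter> space (lebesgue_on S))"
      using ae by eventually_elim simp
  qed simp
qed

lemma AE_lebesgue_on_iff:
  "S \<in> sets lebesgue \<Longrightarrow> (AE x in lebesgue_on S. P x) \<longleftrightarrow> (AE x in lborel. x \<in> S \<longrightarrow> P x)"
  by (simp add: AE_restrict_space_iff AE_completion_iff)

lemma borel_imp_lebesgue_on:
  "f \<in> borel_measurable borel \<Longrightarrow> f \<in> borel_measurable (lebesgue_on S)"
  by (intro measurable_restrict_space1 measurable_completion) simp

text \<open>Lebesgue measure on a product space is the completion of a product, not a product of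
  completions. Measurable functions are therefore replaced by Borel functions equal to them almost
  everywhere, Tonelli is applied to these, and completeness of the measure carries measurability
  back.\<close>

lemma lebesgue_on_rep_ennreal:
  fixes h :: "'a::euclidean_space \<Rightarrow> ennreal"
  assumes S: "S \<in> sets lebesgue" and h: "h \<in> borel_measurable (lebesgue_on S)"
  obtains h' where "h' \<in> borel_measurable borel" "AE x in lebesgue_on S. h x = h' x"
proof -
  have "(\<lambda>x. h x * indicator S x) \<in> borel_measurable lebesgue"
    using h S by (simp add: borel_measurable_restrict_space_iff_ennreal)
  from completion_ex_borel_measurable[OF this] obtain h' where
    h': "h' \<in> borel_measurable lborel" "AE x in lborel. h x * indicator S x = h' x" by blast
  have "AE x in lebesgue_on S. h x = h' x"
    unfolding AE_lebesgue_on_iff[OF S] using h'(2) by eventually_elim auto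
  then show ?thesis using that h'(1) by simp
qed

lemma lebesgue_on_rep_real:
  fixes h :: "'a::euclidean_space \<Rightarrow> real"
  assumes S: "S \<in> sets lebesgue" and h: "h \<in> borel_measurable (lebesgue_on S)"
  obtains h' where "h' \<in> borel_measurable borel" "AE x in lebesgue_on S. h x = h' x"
proof -
  have "(\<lambda>x. indicator S x *\<^sub>R h x) \<in> borel_measurable lebesgue"
    using h S by (simp add: borel_measurable_restrict_space_iff)
  from completion_ex_borel_measurable_real[OF this] obtain h' where
    h': "h' \<in> borel_measurable lborel" "AE x in lborel. indicator S x *\<^sub>R h x = h' x" by blast
  have "AE x in lebesgue_on S. h x = h' x"
    unfolding AE_lebesgue_on_iff[OF S] using h'(2) by eventually_elim auto
  then show ?thesis using that h'(1) by simp
qed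

lemma lebesgue_on_rep_complex:
  fixes h :: "'a::euclidean_space \<Rightarrow> complex"
  assumes S: "S \<in> sets lebesgue" and h: "h \<in> borel_measurable (lebesgue_on S)"
  obtains h' where "h' \<in> borel_measurable borel" "AE x in lebesgue_on S. h x = h' x"
proof -
  have "(\<lambda>x. Re (h x)) \<in> borel_measurable (lebesgue_on S)" "(\<lambda>x. Im (h x)) \<in> borel_measurable (lebesgue_on S)"
    using h by measurable
  then obtain a b where ab [measurable]: "a \<in> borel_measurable borel" "b \<in> borel_measurable borel"
    and ae: "AE x in lebesgue_on S. Re (h x) = a x" "AE x in lebesgue_on S. Im (h x) = b x"
    using lebesgue_on_rep_real[OF S] by metis
  have "(\<lambda>x. complex_of_real (a x) + \<i> * complex_of_real (b x)) \<in> borel_measurable borel" by measurable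
  moreover have "AE x in lebesgue_on S. h x = complex_of_real (a x) + \<i> * complex_of_real (b x)"
    using ae by eventually_elim (simp add: complex_eq_iff)
  ultimately show ?thesis using that by blast
qed

section \<open>Products of two Borel sets\<close>

context
  fixes A :: "'a::euclidean_space set" and B :: "'b::euclidean_space set"
  assumes A: "A \<in> sets borel" and B: "B \<in> sets borel"
begin

lemma sets_Times: "A \<in> sets lebesgue" "B \<in> sets lebesgue" "A \<times> B \<in> sets lebesgue"
proof -
  have "A \<times> B \<in> sets (borel \<Otimes>\<^sub>M borel)" using A B by (rule pair_measureI)
  then have "A \<times> B \<in> sets borel" by (simp only: borel_prod)
  then show "A \<times> B \<in> sets lebesgue" by simp
  show "A \<in> sets lebesgue" "B \<in> sets lebesgue" using A B by simp_all
qed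

lemma AE_Times:
  assumes "AE p in lebesgue_on (A \<times> B). P p"
  shows "AE y in lebesgue_on A. AE z in lebesgue_on B. P (y, z)"
proof -
  have "AE p in lborel \<Otimes>\<^sub>M lborel. p \<in> A \<times> B \<longrightarrow> P p"
    using assms unfolding AE_lebesgue_on_iff[OF sets_Times(3)] lborel_prod .
  from lborel_pair.AE_pair[OF this]
  show ?thesis
    unfolding AE_lebesgue_on_iff[OF sets_Times(1)] AE_lebesgue_on_iff[OF sets_Times(2)]
    by eventually_elim (auto elim!: eventually_mono)
qed

text \<open>A null set times the whole second factor is null, as 0 times \<infinity> is 0.\<close>

lemma AE_Times_fst:
  assumes "AE y in lebesgue_on A. P y"
  shows "AE p in lebesgue_on (A \<times> B). P (fst p)"
proof -
  have "AE y in lborel. y \<in> A \<longrightarrow> P y" using assms by (simp add: AE_lebesgue_on_iff[OF sets_Times(1)])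
  then obtain N where N: "{y. \<not> (y \<in> A \<longrightarrow> P y)} \<subseteq> N" "N \<in> null_sets lborel"
    by (auto elim!: AE_E simp: null_sets_def)
  have "emeasure (lborel \<Otimes>\<^sub>M lborel) (N \<times> (UNIV :: 'b set)) = emeasure lborel N * emeasure lborel (UNIV :: 'b set)"
    using N(2) by (intro lborel.emeasure_pair_measure_Times) auto
  moreover have "N \<times> (UNIV :: 'b set) \<in> sets (lborel \<Otimes>\<^sub>M lborel)"
    using N(2) by (intro pair_measureI) auto
  ultimately have "N \<times> (UNIV :: 'b set) \<in> null_sets (lborel \<Otimes>\<^sub>M lborel)"
    using N(2) by (auto simp: null_sets_def)
  from AE_not_in[OF this] have "AE p in lborel. p \<notin> N \<times> (UNIV :: 'b set)" unfolding lborel_prod .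
  then show ?thesis
    unfolding AE_lebesgue_on_iff[OF sets_Times(3)] by eventually_elim (use N(1) in auto)
qed

lemma measurable_Times_fst:
  fixes k :: "'a \<Rightarrow> ennreal"
  assumes "k \<in> borel_measurable (lebesgue_on A)"
  shows "(\<lambda>p. k (fst p)) \<in> borel_measurable (lebesgue_on (A \<times> B))"
proof -
  obtain k' where k': "k' \<in> borel_measurable borel" "AE y in lebesgue_on A. k y = k' y"
    using lebesgue_on_rep_ennreal[OF sets_Times(1) assms] by blast
  have "(\<lambda>p::'a \<times> 'b. k' (fst p)) \<in> borel_measurable borel"
    using k'(1) by (simp add: borel_prod[symmetric])
  then have "(\<lambda>p. k' (fst p)) \<in> borel_measurable (lebesgue_on (A \<times> B))" by (rule borel_imp_lebesgue_on)
  then show ?thesis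
    by (rule borel_measurable_lebesgue_on_AE[OF sets_Times(3)])
      (use AE_Times_fst[OF k'(2)] in \<open>auto elim!: eventually_mono\<close>)
qed

lemma Tonelli:
  fixes h :: "'a \<times> 'b \<Rightarrow> ennreal"
  assumes "h \<in> borel_measurable (lebesgue_on (A \<times> B))"
  shows "(\<integral>\<^sup>+p. h p \<partial>lebesgue_on (A \<times> B)) = (\<integral>\<^sup>+y. (\<integral>\<^sup>+z. h (y, z) \<partial>lebesgue_on B) \<partial>lebesgue_on A)"
    and "(\<lambda>y. \<integral>\<^sup>+z. h (y, z) \<partial>lebesgue_on B) \<in> borel_measurable (lebesgue_on A)"
proof -
  obtain h' where h': "h' \<in> borel_measurable borel" "AE p in lebesgue_on (A \<times> B). h p = h' p"
    using lebesgue_on_rep_ennreal[OF sets_Times(3) assms] by blast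
  have h'm: "h' \<in> borel_measurable (lborel \<Otimes>\<^sub>M lborel)"
    using h'(1) by (simp add: lborel_prod)
  have [measurable]: "A \<in> sets lborel" "B \<in> sets lborel" using A B by simp_all
  note h'm[measurable]
  \<comment> \<open>Only almost every section of h agrees with that of the Borel representative,
    which is enough for the outer integral.\<close>
  have sec: "AE y in lebesgue_on A. (\<integral>\<^sup>+z. h (y, z) \<partial>lebesgue_on B) = (\<integral>\<^sup>+z. h' (y, z) * indicator B z \<partial>lborel)"
    using AE_Times[OF h'(2)]
  proof eventually_elim
    case (elim y)
    have "(\<integral>\<^sup>+z. h (y, z) \<partial>lebesgue_on B) = (\<integral>\<^sup>+z. h' (y, z) \<partial>lebesgue_on B)"
      using elim by (rule nn_integral_cong_AE)
    then show ?case
      using sets_Times(2) by (simp add: nn_integral_restrict_space nn_integral_completion)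
  qed
  have "(\<lambda>y. \<integral>\<^sup>+z. h' (y, z) * indicator B z \<partial>lborel) \<in> borel_measurable lborel" by measurable
  then have "(\<lambda>y. \<integral>\<^sup>+z. h' (y, z) * indicator B z \<partial>lborel) \<in> borel_measurable (lebesgue_on A)"
    by (intro borel_imp_lebesgue_on) simp
  then show "(\<lambda>y. \<integral>\<^sup>+z. h (y, z) \<partial>lebesgue_on B) \<in> borel_measurable (lebesgue_on A)"
    by (rule borel_measurable_lebesgue_on_AE[OF sets_Times(1)]) (use sec in \<open>auto elim!: eventually_mono\<close>)
  have "(\<integral>\<^sup>+p. h p \<partial>lebesgue_on (A \<times> B)) = (\<integral>\<^sup>+p. h' p \<partial>lebesgue_on (A \<times> B))"
    using h'(2) by (rule nn_integral_cong_AE)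
  also have "\<dots> = (\<integral>\<^sup>+p. h' p * indicator (A \<times> B) p \<partial>(lborel \<Otimes>\<^sub>M lborel))"
    using sets_Times(3) by (simp add: nn_integral_restrict_space nn_integral_completion lborel_prod)
  also have "\<dots> = (\<integral>\<^sup>+y. (\<integral>\<^sup>+z. h' (y, z) * indicator (A \<times> B) (y, z) \<partial>lborel) \<partial>lborel)"
    by (rule lborel.nn_integral_fst[symmetric]) measurable
  also have "\<dots> = (\<integral>\<^sup>+y. (\<integral>\<^sup>+z. h' (y, z) * indicator B z \<partial>lborel) * indicator A y \<partial>lborel)"
  proof (rule nn_integral_cong)
    show "(\<integral>\<^sup>+z. h' (y, z) * indicator (A \<times> B) (y, z) \<partial>lborel) = (\<integral>\<^sup>+z. h' (y, z) * indicator B z \<partial>lborel) * indicator A y" for y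
      by (auto simp: indicator_def cong: nn_integral_cong)
  qed
  also have "\<dots> = (\<integral>\<^sup>+y. (\<integral>\<^sup>+z. h' (y, z) * indicator B z \<partial>lborel) \<partial>lebesgue_on A)"
    using sets_Times(1) by (simp add: nn_integral_restrict_space nn_integral_completion)
  also have "\<dots> = (\<integral>\<^sup>+y. (\<integral>\<^sup>+z. h (y, z) \<partial>lebesgue_on B) \<partial>lebesgue_on A)"
    using sec by (intro nn_integral_cong_AE) (auto elim!: eventually_mono)
  finally show "(\<integral>\<^sup>+p. h p \<partial>lebesgue_on (A \<times> B)) = (\<integral>\<^sup>+y. (\<integral>\<^sup>+z. h (y, z) \<partial>lebesgue_on B) \<partial>lebesgue_on A)" .
qed

text \<open>The representative is made a hypothesis so that one proof serves several value
  types.\<close>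

lemma AE_Times_measurable:
  fixes h :: "'a \<times> 'b \<Rightarrow> 'c::{second_countable_topology, t2_space}"
  assumes "h \<in> borel_measurable (lebesgue_on (A \<times> B))"
    and rep: "\<exists>h'\<in>borel_measurable borel. AE p in lebesgue_on (A \<times> B). h p = h' p"
  shows "AE y in lebesgue_on A. (\<lambda>z. h (y, z)) \<in> borel_measurable (lebesgue_on B)"
proof -
  obtain h' where h': "h' \<in> borel_measurable borel" "AE p in lebesgue_on (A \<times> B). h p = h' p"
    using rep by blast
  have "(\<lambda>z. h' (y, z)) \<in> borel_measurable borel" for y
    using h'(1) by (simp add: borel_prod[symmetric])
  then have sec: "(\<lambda>z. h' (y, z)) \<in> borel_measurable (lebesgue_on B)" for y by (rule borel_imp_lebesgue_on)
  show ?thesis using AE_Times[OF h'(2)]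
  proof eventually_elim
    case (elim y)
    show ?case
      by (rule borel_measurable_lebesgue_on_AE[OF sets_Times(2) sec[of y]])
        (use elim in \<open>auto elim!: eventually_mono\<close>)
  qed
qed

lemma measurable_section_integral:
  fixes h :: "'a \<times> 'b \<Rightarrow> complex"
  assumes "h \<in> borel_measurable (lebesgue_on (A \<times> B))"
  shows "(\<lambda>y. \<integral>z. h (y, z) \<partial>lebesgue_on B) \<in> borel_measurable (lebesgue_on A)"
proof -
  obtain h' where h': "h' \<in> borel_measurable borel" "AE p in lebesgue_on (A \<times> B). h p = h' p"
    using lebesgue_on_rep_complex[OF sets_Times(3) assms] by blast
  have h'm[measurable]: "h' \<in> borel_measurable (lborel \<Otimes>\<^sub>M lborel)"
    using h'(1) by (simp add: lborel_prod)
  have Bm[measurable]: "B \<in> sets lborel" using B by simp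
  have h'y: "(\<lambda>z. h' (y, z)) \<in> borel_measurable borel" for y
    using h'(1) by (simp add: borel_prod[symmetric])
  have sec: "AE y in lebesgue_on A. (\<integral>z. indicator B z *\<^sub>R h' (y, z) \<partial>lborel) = (\<integral>z. h (y, z) \<partial>lebesgue_on B)"
    using AE_Times[OF h'(2)]
  proof eventually_elim
    case (elim y)
    have m: "(\<lambda>z. h' (y, z)) \<in> borel_measurable (lebesgue_on B)" by (rule borel_imp_lebesgue_on[OF h'y])
    have "(\<lambda>z. h (y, z)) \<in> borel_measurable (lebesgue_on B)"
      by (rule borel_measurable_lebesgue_on_AE[OF sets_Times(2) m]) (use elim in \<open>auto elim!: eventually_mono\<close>)
    then have "(\<integral>z. h (y, z) \<partial>lebesgue_on B) = (\<integral>z. h' (y, z) \<partial>lebesgue_on B)"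
      using m elim by (rule integral_cong_AE)
    also have "\<dots> = (\<integral>z. indicator B z *\<^sub>R h' (y, z) \<partial>lebesgue)"
      using sets_Times(2) by (simp add: integral_restrict_space)
    also have "\<dots> = (\<integral>z. indicator B z *\<^sub>R h' (y, z) \<partial>lborel)"
      using h'y Bm by (intro integral_completion) measurable
    finally show ?case by simp
  qed
  have "(\<lambda>y. \<integral>z. indicator B z *\<^sub>R h' (y, z) \<partial>lborel) \<in> borel_measurable lborel" by measurable
  then have "(\<lambda>y. \<integral>z. indicator B z *\<^sub>R h' (y, z) \<partial>lborel) \<in> borel_measurable (lebesgue_on A)"
    by (intro borel_imp_lebesgue_on) simp
  then show ?thesis
    by (rule borel_measurable_lebesgue_on_AE[OF sets_Times(1)]) (rule sec)
qed

end

text \<open>Inserting z between the variables of a null set in (y, v) leaves it null. This is what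
  makes f(y, v) measurable as a function of ((y, z), v). The exceptional set is first enlarged to a
  Borel null set, whose preimage under the projection is measurable.\<close>

lemma AE_Times_outer:
  fixes A :: "'a::euclidean_space set" and B :: "'b::euclidean_space set" and C :: "'c::euclidean_space set"
  assumes A: "A \<in> sets borel" and B: "B \<in> sets borel" and C: "C \<in> sets borel"
    and ae: "AE p in lebesgue_on (A \<times> C). P p"
  shows "AE q in lebesgue_on ((A \<times> B) \<times> C). P (fst (fst q), snd q)"
proof -
  have AB: "A \<times> B \<in> sets borel"
    using pair_measureI[OF A B] by (simp only: borel_prod)
  note s = sets_Times(3)[OF A C] sets_Times(3)[OF AB C]
  have "AE p in lborel. p \<in> A \<times> C \<longrightarrow> P p" using ae by (simp add: AE_lebesgue_on_iff[OF s(1)])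
  then obtain N where N: "{p. \<not> (p \<in> A \<times> C \<longrightarrow> P p)} \<subseteq> N" "N \<in> null_sets lborel"
    by (auto elim!: AE_E simp: null_sets_def)
  have "AE p in lborel \<Otimes>\<^sub>M lborel. p \<notin> N" unfolding lborel_prod by (rule AE_not_in[OF N(2)])
  from lborel_pair.AE_pair[OF this] have "AE y in lborel. AE v in lborel. (y, v) \<notin> N" .
  then have "AE y in lebesgue_on UNIV. AE v in lborel. (y, v) \<notin> N" by (simp add: AE_lebesgue_on_iff)
  from AE_Times_fst[OF _ _ this, of "UNIV :: 'b set"]
  have "AE x :: 'a \<times> 'b in lborel. AE v in lborel. (fst x, v) \<notin> N"
    by (simp add: AE_lebesgue_on_iff)
  moreover have "{q \<in> space (lborel \<Otimes>\<^sub>M lborel). (fst (fst q :: 'a \<times> 'b), snd q) \<notin> N} \<in> sets (lborel \<Otimes>\<^sub>M lborel)"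
  proof -
    let ?f = "\<lambda>q :: ('a \<times> 'b) \<times> 'c. (fst (fst q), snd q)"
    have "?f \<in> borel_measurable borel"
      by (intro borel_measurable_continuous_onI continuous_intros)
    then have "?f -` (- N) \<inter> space borel \<in> sets borel"
      by (rule measurable_sets) (use null_setsD2[OF N(2)] in auto)
    moreover have "?f -` (- N) \<inter> space borel = {q \<in> space (lborel \<Otimes>\<^sub>M lborel). ?f q \<notin> N}"
      by (auto simp: space_pair_measure)
    ultimately show ?thesis by (simp only: lborel_prod sets_lborel)
  qed
  ultimately have "AE q in lborel \<Otimes>\<^sub>M lborel. (fst (fst q :: 'a \<times> 'b), snd q) \<notin> N"
    by (intro lborel_pair.AE_pair_measure) simp_all
  then show ?thesis
    unfolding AE_lebesgue_on_iff[OF s(2)] lborel_prod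
    by eventually_elim (use N(1) in auto)
qed

section \<open>Integrals of sums with a nonmeasurable summand\<close>

text \<open>A simple s \<le> f + g gives s - g \<le> f with s - g measurable, whatever f is. Taking
  s with finite values keeps the truncated subtraction of \<open>ennreal\<close> meaningful. In the
  application f is the kinetic density, which depends on y through \<open>weak_partial\<close> of a
  slice.\<close>

lemma nn_integral_add_le:
  assumes g: "g \<in> borel_measurable M"
  shows "(\<integral>\<^sup>+x. f x + g x \<partial>M) \<le> (\<integral>\<^sup>+x. f x \<partial>M) + (\<integral>\<^sup>+x. g x \<partial>M)"
  unfolding nn_integral_def_finite[of M "\<lambda>x. f x + g x"]
proof (rule SUP_least)
  fix s assume "s \<in> {s. simple_function M s \<and> s \<le> (\<lambda>x. f x + g x) \<and> (\<forall>x. s x < top)}"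
  then have s: "simple_function M s" "\<And>x. s x \<le> f x + g x" "\<And>x. s x < top" by (auto simp: le_fun_def)
  have sm: "s \<in> borel_measurable M" using s(1) by (rule borel_measurable_simple_function)
  have "integral\<^sup>S M s = (\<integral>\<^sup>+x. s x \<partial>M)" using s(1) by (simp add: nn_integral_eq_simple_integral)
  also have "\<dots> \<le> (\<integral>\<^sup>+x. (s x - g x) + g x \<partial>M)"
  proof (rule nn_integral_mono)
    show "s x \<le> (s x - g x) + g x" for x
      by (cases "g x \<le> s x") (simp_all add: diff_add_cancel_ennreal add_increasing)
  qed
  also have "\<dots> = (\<integral>\<^sup>+x. s x - g x \<partial>M) + (\<integral>\<^sup>+x. g x \<partial>M)"
    using sm g by (intro nn_integral_add) auto
  also have "(\<integral>\<^sup>+x. s x - g x \<partial>M) \<le> (\<integral>\<^sup>+x. f x \<partial>M)"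
  proof (rule nn_integral_mono)
    show "s x - g x \<le> f x" for x
      using s(2)[of x] s(3)[of x] by (auto simp: ennreal_minus_le_iff add.commute)
  qed
  finally show "integral\<^sup>S M s \<le> (\<integral>\<^sup>+x. f x \<partial>M) + (\<integral>\<^sup>+x. g x \<partial>M)" by (simp add: add_right_mono)
qed

text \<open>The nonnegative integral of a nonmeasurable function is a lower integral, hence superadditive.\<close>

lemma nn_integral_superadditive:
  "(\<integral>\<^sup>+x. f x \<partial>M) + (\<integral>\<^sup>+x. g x \<partial>M) \<le> (\<integral>\<^sup>+x. f x + g x \<partial>M)"
proof -
  have "integral\<^sup>S M s + integral\<^sup>S M t \<le> (\<integral>\<^sup>+x. f x + g x \<partial>M)"
    if "simple_function M s" "s \<le> f" "simple_function M t" "t \<le> g" for s t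
  proof -
    have "integral\<^sup>S M s + integral\<^sup>S M t = integral\<^sup>S M (\<lambda>x. s x + t x)"
      using that by (simp add: simple_integral_add)
    also have "\<dots> = (\<integral>\<^sup>+x. s x + t x \<partial>M)"
      using that by (intro nn_integral_eq_simple_integral[symmetric] simple_function_add)
    also have "\<dots> \<le> (\<integral>\<^sup>+x. f x + g x \<partial>M)"
      using that by (intro nn_integral_mono add_mono) (auto simp: le_fun_def)
    finally show ?thesis .
  qed
  then have "integral\<^sup>S M s + (\<integral>\<^sup>+x. g x \<partial>M) \<le> (\<integral>\<^sup>+x. f x + g x \<partial>M)"
    if "simple_function M s" "s \<le> f" for s
    unfolding nn_integral_def[of M g] using that
    by (subst ennreal_SUP_add_right) (auto intro!: SUP_least exI[of _ "\<lambda>_. 0"] simp: le_fun_def)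
  then show ?thesis
    unfolding nn_integral_def[of M f]
    by (subst ennreal_SUP_add_left[symmetric]) (auto intro!: SUP_least exI[of _ "\<lambda>_. 0"] simp: le_fun_def)
qed

section \<open>Legendre duality for the entropy generator\<close>

text \<open>The slope of T \<beta> at 0: for smaller s the maximum of s x - T \<beta> x over [0,1]
  is at x = 0, for larger s it is not.\<close>

definition beta_threshold :: "real \<Rightarrow> (real \<Rightarrow> real) \<Rightarrow> real" where
  "beta_threshold T \<beta> = (if T = 0 then 0 else T * dbeta \<beta> 0)"

context
  fixes \<beta> :: "real \<Rightarrow> real"
  assumes gen: "entropy_generator \<beta>"
begin

lemma beta_0: "\<beta> 0 = 0" and beta_nonneg: "s \<in> {0..1} \<Longrightarrow> 0 \<le> \<beta> s"
  using gen by (auto simp: entropy_generator_def)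

lemma dbeta_deriv:
  assumes "r \<in> {0..1}"
  shows "(\<beta> has_real_derivative dbeta \<beta> r) (at r within {0..1})"
proof -
  have "\<beta> differentiable (at r within {0..1})"
    using gen assms by (simp add: entropy_generator_def differentiable_on_def)
  then show ?thesis
    unfolding dbeta_def has_real_derivative_iff_has_vector_derivative by (rule vector_derivative_works[THEN iffD1])
qed

lemma beta_continuous: "continuous_on {0..1} \<beta>"
  using dbeta_deriv by (intro DERIV_continuous_on)

lemma beta_strict_convex:
  assumes "r \<in> {0..1}" "s \<in> {0..1}" "a \<in> {0<..<1}" "r \<noteq> s"
  shows "\<beta> ((1 - a) * r + a * s) < (1 - a) * \<beta> r + a * \<beta> s"
  using gen assms unfolding entropy_generator_def by blast

text \<open>Convexity bounds the difference quotients along the segment from r to x by \<beta> x -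
  \<beta> r, and their limit is the derivative in that direction. Parametrizing the segment by a in
  [0,1] treats the one-sided derivatives at the endpoints in the same way as interior ones.\<close>

lemma beta_tangent:
  assumes r: "r \<in> {0..1}" and x: "x \<in> {0..1}"
  shows "\<beta> r + dbeta \<beta> r * (x - r) \<le> \<beta> x"
proof (cases "x = r")
  case False
  let ?h = "\<lambda>a. \<beta> (r + a * (x - r))"
  have img: "r + a * (x - r) \<in> {0..1}" if "a \<in> {0..1}" for a
  proof -
    have "(1 - a) * r + a * x \<in> {0..1}"
      using convexD_alt[OF convex_real_interval(5)[of 0 1] r x, of a] that by simp
    then show ?thesis by (simp add: algebra_simps)
  qed
  have "((\<lambda>a. r + a * (x - r)) has_real_derivative (x - r)) (at 0 within {0..1})"
    by (auto intro!: derivative_eq_intros)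
  moreover have "(\<beta> has_real_derivative dbeta \<beta> r) (at (r + 0 * (x - r)) within (\<lambda>a. r + a * (x - r)) ` {0..1})"
    using dbeta_deriv[OF r] by (simp, rule DERIV_subset) (use img in auto)
  ultimately have "(?h has_real_derivative dbeta \<beta> r * (x - r)) (at 0 within {0..1})"
    using DERIV_image_chain[of \<beta> "dbeta \<beta> r" "\<lambda>a. r + a * (x - r)" 0 "{0..1}" "x - r"] by (simp add: o_def)
  then have lim: "((\<lambda>a. (?h a - ?h 0) / (a - 0)) \<longlongrightarrow> dbeta \<beta> r * (x - r)) (at 0 within {0..1})"
    unfolding has_field_derivative_iff by simp
  have "dbeta \<beta> r * (x - r) \<le> \<beta> x - \<beta> r"
  proof (rule tendsto_upperbound[OF lim])
    show "\<forall>\<^sub>F a in at 0 within {0..1}. (?h a - ?h 0) / (a - 0) \<le> \<beta> x - \<beta> r"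
      unfolding eventually_at
    proof (intro exI[of _ "1::real"] conjI ballI impI)
      fix a :: real assume a: "a \<in> {0..1}" "a \<noteq> 0 \<and> dist a 0 < 1"
      then have "a \<in> {0<..<1}" by (auto simp: dist_real_def)
      from beta_strict_convex[OF r x this False[symmetric]]
      have "?h a \<le> (1 - a) * \<beta> r + a * \<beta> x" by (simp add: algebra_simps)
      then have "?h a - \<beta> r \<le> (\<beta> x - \<beta> r) * a" by (simp add: algebra_simps)
      then show "(?h a - ?h 0) / (a - 0) \<le> \<beta> x - \<beta> r"
        using \<open>a \<in> {0<..<1}\<close> by (simp add: pos_divide_le_eq)
    qed simp
    show "at (0::real) within {0..1} \<noteq> bot" by (simp add: trivial_limit_within islimpt_Icc)
  qed
  then show ?thesis by simp
qed simp

text \<open>If two points had the same slope, adding their tangents at the midpoint would bound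
  \<beta> there from below by the average of its two values, against strict convexity.\<close>

lemma dbeta_inj: "inj_on (dbeta \<beta>) {0..1}"
proof (rule inj_onI, rule ccontr)
  fix r s assume rs: "r \<in> {0..1}" "s \<in> {0..1}" "dbeta \<beta> r = dbeta \<beta> s" "r \<noteq> s"
  have "\<beta> ((1 - 1/2) * r + 1/2 * s) < (1 - 1/2) * \<beta> r + 1/2 * \<beta> s"
    by (rule beta_strict_convex[OF rs(1,2) _ rs(4)]) simp
  moreover have mid: "(1 - 1/2) * r + 1/2 * s \<in> {0..1}" using rs(1,2) by auto
  note beta_tangent[OF rs(1) mid] beta_tangent[OF rs(2) mid, folded rs(3)]
  ultimately show False by (simp add: algebra_simps)
qed

lemma dbeta_0_nonneg: "0 \<le> dbeta \<beta> 0"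
proof (rule ccontr)
  assume "\<not> 0 \<le> dbeta \<beta> 0"
  then obtain d where d: "d > 0" "\<And>h. 0 < h \<Longrightarrow> 0 + h \<in> {0..1} \<Longrightarrow> h < d \<Longrightarrow> \<beta> (0 + h) < \<beta> 0"
    using has_real_derivative_neg_dec_right[OF dbeta_deriv[of 0]] by auto
  define h where "h = min (d / 2) 1"
  have h: "0 < h" "h \<le> 1" "h < d" using d(1) by (auto simp: h_def min_def)
  have "\<beta> h < 0" using d(2)[of h] h beta_0 by simp
  then show False using beta_nonneg[of h] h by simp
qed

text \<open>Darboux's argument, as continuity of the derivative is not assumed: a minimizer of
  \<beta> x - c x on [0,1] is critical if interior, it cannot be 1 because the slope there is
  positive, and at 0 minimality and the first hypothesis bound the slope from both sides.\<close>

lemma dbeta_surj: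
  assumes "dbeta \<beta> 0 \<le> c" "c < dbeta \<beta> 1"
  shows "\<exists>r\<in>{0..1}. dbeta \<beta> r = c"
proof -
  let ?g = "\<lambda>x. \<beta> x - c * x"
  have "continuous_on {0..1} ?g" by (intro continuous_intros beta_continuous)
  then obtain r where r: "r \<in> {0..1}" "\<And>x. x \<in> {0..1} \<Longrightarrow> ?g r \<le> ?g x"
    using continuous_attains_inf[of "{0..1::real}" ?g] by auto
  have D: "(?g has_real_derivative dbeta \<beta> x - c) (at x within {0..1})" if "x \<in> {0..1}" for x
    using dbeta_deriv[OF that] by (auto intro!: derivative_eq_intros)
  consider "r = 0" | "r = 1" | "0 < r" "r < 1" using r(1) by fastforce
  then have "dbeta \<beta> r = c"
  proof cases
    case 1
    have "\<not> dbeta \<beta> 0 - c < 0"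
    proof
      assume "dbeta \<beta> 0 - c < 0"
      then obtain d where d: "d > 0" "\<And>h. 0 < h \<Longrightarrow> 0 + h \<in> {0..1} \<Longrightarrow> h < d \<Longrightarrow> ?g (0 + h) < ?g 0"
        using has_real_derivative_neg_dec_right[OF D[of 0]] by auto
      have "?g (min (d / 2) 1) < ?g 0" using d(2)[of "min (d / 2) 1"] d(1) by (simp add: min_def split: if_splits)
      then show False using r(2)[of "min (d / 2) 1"] d(1) 1 by (simp add: min_def split: if_splits)
    qed
    then show ?thesis using assms(1) 1 by simp
  next
    case 2
    obtain d where d: "d > 0" "\<And>h. 0 < h \<Longrightarrow> 1 - h \<in> {0..1} \<Longrightarrow> h < d \<Longrightarrow> ?g (1 - h) < ?g 1"
      using has_real_derivative_pos_inc_left[OF D[of 1]] assms(2) by auto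
    have "?g (1 - min (d / 2) 1) < ?g 1" by (rule d(2)) (use d(1) in \<open>auto simp: min_def\<close>)
    moreover have "1 - min (d / 2) 1 \<in> {0..1}" using d(1) by (auto simp: min_def)
    ultimately have False using r(2)[of "1 - min (d / 2) 1"] 2 by simp
    then show ?thesis ..
  next
    case 3
    have "(?g has_real_derivative dbeta \<beta> r - c) (at r)"
      using D[OF r(1)] 3 by (simp add: at_within_Icc_at)
    then have "dbeta \<beta> r - c = 0"
    proof (rule DERIV_local_min[where d = "min r (1 - r)"])
      show "0 < min r (1 - r)" using 3 by simp
      show "\<forall>y. \<bar>r - y\<bar> < min r (1 - r) \<longrightarrow> ?g r \<le> ?g y"
      proof (intro allI impI r(2))
        show "y \<in> {0..1}" if "\<bar>r - y\<bar> < min r (1 - r)" for y using that by (auto simp: abs_less_iff)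
      qed
    qed
    then show ?thesis by simp
  qed
  then show ?thesis using r(1) by blast
qed

text \<open>\<open>beta_tilde\<close> is the maximizer in the Legendre transform of T \<beta> over
  [0,1]. The cases follow its definition; for T > 0 and s \<ge> 0 the inequality comes from the
  tangent of \<beta> at the claimed maximizer, whose slope is s / T or, at an endpoint, differs from
  it in the favourable direction.\<close>

lemma beta_tilde_optimal:
  assumes T: "T \<ge> 0" and x: "x \<in> {0..1}"
  shows "beta_tilde T \<beta> s \<in> {0..1}"
    and "s * x - T * \<beta> x \<le> s * beta_tilde T \<beta> s - T * \<beta> (beta_tilde T \<beta> s)"
    and "s > beta_threshold T \<beta> \<Longrightarrow> 0 < beta_tilde T \<beta> s"
    and "s < beta_threshold T \<beta> \<Longrightarrow> beta_tilde T \<beta> s = 0"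
proof -
  let ?b = "beta_tilde T \<beta> s"
  have "?b \<in> {0..1} \<and> s * x - T * \<beta> x \<le> s * ?b - T * \<beta> ?b \<and>
    (s > beta_threshold T \<beta> \<longrightarrow> 0 < ?b) \<and> (s < beta_threshold T \<beta> \<longrightarrow> ?b = 0)"
  proof -
    have th: "0 \<le> beta_threshold T \<beta>" using T dbeta_0_nonneg by (simp add: beta_threshold_def)
    have Tb: "0 \<le> T * \<beta> x" using T beta_nonneg[OF x] by simp
    have scale: "s * x - T * \<beta> x \<le> s * b - T * \<beta> b"
      if "T > 0" "\<beta> b + s / T * (x - b) \<le> \<beta> x" for b
    proof -
      have "T * (\<beta> b + s / T * (x - b)) \<le> T * \<beta> x" using that by (intro mult_left_mono) simp_all
      moreover have "T * (\<beta> b + s / T * (x - b)) = T * \<beta> b + s * (x - b)"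
        using that(1) by (simp add: distrib_left)
      ultimately show ?thesis by (simp add: right_diff_distrib)
    qed
    consider "s < 0" | "0 \<le> s" "T = 0" | "0 \<le> s" "T > 0" "s / T < dbeta \<beta> 0"
      | "0 \<le> s" "T > 0" "dbeta \<beta> 0 \<le> s / T" "s / T \<ge> dbeta \<beta> 1"
      | "0 \<le> s" "T > 0" "dbeta \<beta> 0 \<le> s / T" "s / T < dbeta \<beta> 1"
      using T by linarith
    then show ?thesis
    proof cases
      case 1
      then have "s * x \<le> 0" using x by (simp add: mult_nonpos_nonneg)
      then show ?thesis using 1 th Tb by (simp add: beta_tilde_def beta_0)
    next
      case 2
      then have "s * x \<le> s * 1" using x by (intro mult_left_mono) auto
      then show ?thesis using 2 by (simp add: beta_tilde_def beta_threshold_def)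
    next
      case 3
      have b: "?b = 0" using 3 by (simp add: beta_tilde_def)
      have "s / T * x \<le> dbeta \<beta> 0 * x" using 3 x by (intro mult_right_mono) auto
      also have "\<dots> \<le> \<beta> x" using beta_tangent[of 0 x] x beta_0 by simp
      finally have "s * x - T * \<beta> x \<le> 0" using scale[of 0] 3 beta_0 by simp
      moreover have "s < beta_threshold T \<beta>" using 3 by (simp add: beta_threshold_def pos_divide_less_eq mult.commute)
      ultimately show ?thesis using b beta_0 by simp
    next
      case 4
      have b: "?b = 1" using 4 by (simp add: beta_tilde_def)
      have "s / T * (x - 1) \<le> dbeta \<beta> 1 * (x - 1)" using 4 x by (intro mult_right_mono_neg) auto
      also have "\<beta> 1 + \<dots> \<le> \<beta> x" using beta_tangent[of 1 x] x by simp
      finally have "s * x - T * \<beta> x \<le> s * 1 - T * \<beta> 1" using scale[of 1] 4 by simp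
      moreover have "\<not> s < beta_threshold T \<beta>" using 4 by (simp add: beta_threshold_def pos_le_divide_eq mult.commute)
      ultimately show ?thesis using b by simp
    next
      case 5
      define r where "r = the_inv_into {0..1} (dbeta \<beta>) (s / T)"
      have mem: "s / T \<in> dbeta \<beta> ` {0..1}" using dbeta_surj[OF 5(3,4)] by force
      have r: "dbeta \<beta> r = s / T" "r \<in> {0..1}"
        unfolding r_def by (rule f_the_inv_into_f[OF dbeta_inj mem], rule the_inv_into_into[OF dbeta_inj mem subset_refl])
      have b: "?b = r" using 5 r(2) by (simp add: beta_tilde_def r_def[symmetric])
      have "s * x - T * \<beta> x \<le> s * r - T * \<beta> r"
        using scale[of r] beta_tangent[OF r(2) x] 5(2) r(1) by simp
      moreover have "\<not> s < beta_threshold T \<beta>" using 5 by (simp add: beta_threshold_def pos_le_divide_eq mult.commute)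
      moreover have "0 < r" if "s > beta_threshold T \<beta>"
      proof -
        have "r \<noteq> 0" using that r(1) 5(2) by (auto simp: beta_threshold_def)
        then show ?thesis using r(2) by simp
      qed
      ultimately show ?thesis using b r(2) by simp
    qed
  qed
  then show "?b \<in> {0..1}" "s * x - T * \<beta> x \<le> s * ?b - T * \<beta> ?b"
    "s > beta_threshold T \<beta> \<Longrightarrow> 0 < ?b" "s < beta_threshold T \<beta> \<Longrightarrow> ?b = 0" by blast+
qed

text \<open>The line of slope s stays below the tangent of T \<beta> at 0.\<close>

lemma below_beta_threshold:
  assumes T: "T \<ge> 0" and x: "x \<in> {0..1}" and s: "s \<le> beta_threshold T \<beta>"
  shows "s * x - T * \<beta> x \<le> 0"
proof -
  have "s * x \<le> beta_threshold T \<beta> * x" using s x by (intro mult_right_mono) auto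
  also have "\<dots> \<le> T * \<beta> x"
    using beta_tangent[of 0 x] x T beta_0 beta_nonneg[OF x]
    by (auto simp: beta_threshold_def mult.assoc intro: mult_left_mono)
  finally show ?thesis by simp
qed

end

section \<open>Densities as iterated integrals\<close>

text \<open>The expectation of W(y, .) in the transverse state at y; with values in
  \<open>ennreal\<close> it makes sense for every nonnegative W.\<close>

definition transverse_mean :: "(vec2 \<times> real \<Rightarrow> real) \<Rightarrow> (vec2 \<times> real \<Rightarrow> complex) \<Rightarrow> vec2 \<Rightarrow> ennreal" where
  "transverse_mean W \<eta> y = (\<integral>\<^sup>+z. ennreal (W (y, z) * (cmod (\<eta> (y, z)))\<^sup>2) \<partial>lebesgue_unit)"

lemma unit_ivl_borel: "unit_ivl \<in> sets borel"
  by simp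

lemma ennreal_section_measurable:
  fixes A :: "'a::euclidean_space set" and B :: "'b::euclidean_space set" and h :: "'a \<times> 'b \<Rightarrow> ennreal"
  assumes "A \<in> sets borel" "B \<in> sets borel" "h \<in> borel_measurable (lebesgue_on (A \<times> B))"
  shows "AE y in lebesgue_on A. (\<lambda>z. h (y, z)) \<in> borel_measurable (lebesgue_on B)"
proof (rule AE_Times_measurable[OF assms])
  show "\<exists>h'\<in>borel_measurable borel. AE p in lebesgue_on (A \<times> B). h p = h' p"
    using lebesgue_on_rep_ennreal[OF sets_Times(3)[OF assms(1,2)] assms(3)] by blast
qed

lemma real_section_measurable:
  fixes A :: "'a::euclidean_space set" and B :: "'b::euclidean_space set" and h :: "'a \<times> 'b \<Rightarrow> real"
  assumes "A \<in> sets borel" "B \<in> sets borel" "h \<in> borel_measurable (lebesgue_on (A \<times> B))"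
  shows "AE y in lebesgue_on A. (\<lambda>z. h (y, z)) \<in> borel_measurable (lebesgue_on B)"
proof (rule AE_Times_measurable[OF assms])
  show "\<exists>h'\<in>borel_measurable borel. AE p in lebesgue_on (A \<times> B). h p = h' p"
    using lebesgue_on_rep_real[OF sets_Times(3)[OF assms(1,2)] assms(3)] by blast
qed

context
  fixes \<omega> :: "vec2 set"
  assumes \<omega>: "\<omega> \<in> sets borel"
begin

lemma weight_measurable:
  assumes "W \<in> borel_measurable (lebesgue_on (cylinder \<omega>))" "\<eta> \<in> borel_measurable (lebesgue_on (cylinder \<omega>))"
  shows "(\<lambda>x. ennreal (W x * (cmod (\<eta> x))\<^sup>2)) \<in> borel_measurable (lebesgue_on (cylinder \<omega>))"
  using assms by measurable

lemma transverse_mean_measurable: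
  assumes "W \<in> borel_measurable (lebesgue_on (cylinder \<omega>))" "\<eta> \<in> borel_measurable (lebesgue_on (cylinder \<omega>))"
  shows "transverse_mean W \<eta> \<in> borel_measurable (lebesgue_on \<omega>)"
  unfolding transverse_mean_def[abs_def]
  by (rule Tonelli(2)[OF \<omega> unit_ivl_borel weight_measurable[OF assms]])

lemma velocity_integral_measurable:
  fixes f :: "vec2 \<times> vec2 \<Rightarrow> real"
  assumes "f \<in> borel_measurable (lebesgue_on (\<omega> \<times> UNIV))"
  shows "(\<lambda>y. \<integral>\<^sup>+v. ennreal (f (y, v)) \<partial>lebesgue) \<in> borel_measurable (lebesgue_on \<omega>)"
  using Tonelli(2)[OF \<omega>, of UNIV "\<lambda>p. ennreal (f p)"] assms by (simp add: lebesgue_on_UNIV_eq)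

text \<open>Both sides are the integral of W |\<eta>|^2 f over (y, z, v), with v integrated first on
  the left and z first on the right.\<close>

lemma weighted_velocity_integral:
  fixes f :: "vec2 \<times> vec2 \<Rightarrow> real"
  assumes W: "W \<in> borel_measurable (lebesgue_on (cylinder \<omega>))"
    and \<eta>: "\<eta> \<in> borel_measurable (lebesgue_on (cylinder \<omega>))"
    and f: "f \<in> borel_measurable (lebesgue_on (\<omega> \<times> UNIV))"
  shows "(\<integral>\<^sup>+x. ennreal (W x * (cmod (\<eta> x))\<^sup>2) * (\<integral>\<^sup>+v. ennreal (f (fst x, v)) \<partial>lebesgue)
      \<partial>lebesgue_on (cylinder \<omega>))
    = (\<integral>\<^sup>+p. transverse_mean W \<eta> (fst p) * ennreal (f p) \<partial>lebesgue_on (\<omega> \<times> UNIV))"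
    (is "?L = ?R")
proof -
  let ?k = "\<lambda>x. ennreal (W x * (cmod (\<eta> x))\<^sup>2)"
  let ?n = "\<lambda>y. \<integral>\<^sup>+v. ennreal (f (y, v)) \<partial>lebesgue"
  have k: "?k \<in> borel_measurable (lebesgue_on (cylinder \<omega>))" by (rule weight_measurable[OF W \<eta>])
  have ef: "(\<lambda>p. ennreal (f p)) \<in> borel_measurable (lebesgue_on (\<omega> \<times> UNIV))" using f by measurable
  have n: "?n \<in> borel_measurable (lebesgue_on \<omega>)" by (rule velocity_integral_measurable[OF f])
  have "?L = (\<integral>\<^sup>+y. (\<integral>\<^sup>+z. ?k (y, z) * ?n y \<partial>lebesgue_unit) \<partial>lebesgue_on \<omega>)"
    using Tonelli(1)[OF \<omega> unit_ivl_borel borel_measurable_times_ennreal[OF k measurable_Times_fst[OF \<omega> unit_ivl_borel n]]]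
    by simp
  also have "\<dots> = (\<integral>\<^sup>+y. transverse_mean W \<eta> y * ?n y \<partial>lebesgue_on \<omega>)"
    using ennreal_section_measurable[OF \<omega> unit_ivl_borel k]
    by (intro nn_integral_cong_AE) (auto simp: transverse_mean_def nn_integral_multc elim!: eventually_mono)
  also have "\<dots> = (\<integral>\<^sup>+y. (\<integral>\<^sup>+v. transverse_mean W \<eta> y * ennreal (f (y, v)) \<partial>lebesgue_on UNIV) \<partial>lebesgue_on \<omega>)"
    using ennreal_section_measurable[OF \<omega> _ ef]
    by (intro nn_integral_cong_AE) (auto simp: nn_integral_cmult lebesgue_on_UNIV_eq elim!: eventually_mono)
  also have "\<dots> = ?R"
    using Tonelli(1)[OF \<omega> _ borel_measurable_times_ennreal[OF
        measurable_Times_fst[OF \<omega> _ transverse_mean_measurable[OF W \<eta>]] ef]]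
    by simp
  finally show ?thesis .
qed

lemma external_energy_eq:
  fixes f :: cl_state
  assumes V: "V \<in> borel_measurable (lebesgue_on (cylinder \<omega>))" "\<And>x. x \<in> cylinder \<omega> \<Longrightarrow> 0 \<le> V x"
    and \<eta>: "\<And>j. ch j \<in> borel_measurable (lebesgue_on (cylinder \<omega>))"
    and f: "\<And>j. f j \<in> borel_measurable (lebesgue_on (\<omega> \<times> UNIV))"
  shows "external_energy \<omega> V f ch
    = (\<Sum>j. \<integral>\<^sup>+p. transverse_mean V (ch j) (fst p) * ennreal (f j p) \<partial>lebesgue_on (\<omega> \<times> UNIV))"
  unfolding external_energy_def
proof (rule arg_cong[where f = suminf], rule ext)
  fix j
  have cyl: "cylinder \<omega> \<in> sets borel" using pair_measureI[OF \<omega> unit_ivl_borel] by (simp only: borel_prod)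
  let ?k = "\<lambda>x. ennreal (V x * (cmod (ch j x))\<^sup>2)"
  have k: "?k \<in> borel_measurable (lebesgue_on (cylinder \<omega>))" by (rule weight_measurable[OF V(1) \<eta>])
  let ?M = "lebesgue_on (cylinder \<omega> \<times> (UNIV :: vec2 set))"
  have U: "(UNIV :: vec2 set) \<in> sets borel" by simp
  \<comment> \<open>Lebesgue measurability need not survive composition with a projection, so a
    Borel representative of \<open>f j\<close> is composed instead.\<close>
  have ff: "(\<lambda>q. ennreal (f j (fst (fst q), snd q))) \<in> borel_measurable ?M"
  proof -
    obtain f' where f': "f' \<in> borel_measurable borel" "AE p in lebesgue_on (\<omega> \<times> UNIV). f j p = f' p"
      using lebesgue_on_rep_real[OF sets_Times(3)[OF \<omega> U] f] by blast
    have "(\<lambda>q :: (vec2 \<times> real) \<times> vec2. (fst (fst q), snd q)) \<in> borel_measurable borel"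
      by (intro borel_measurable_continuous_onI continuous_intros)
    then have "(\<lambda>q :: (vec2 \<times> real) \<times> vec2. ennreal (f' (fst (fst q), snd q))) \<in> borel_measurable borel"
      using f'(1) by measurable
    then have "(\<lambda>q. ennreal (f' (fst (fst q), snd q))) \<in> borel_measurable ?M" by (rule borel_imp_lebesgue_on)
    then show ?thesis
      by (rule borel_measurable_lebesgue_on_AE[OF sets_Times(3)[OF cyl U]])
        (use AE_Times_outer[OF \<omega> unit_ivl_borel U f'(2)] in \<open>auto elim!: eventually_mono\<close>)
  qed
  have prod: "(\<lambda>q. ?k (fst q) * ennreal (f j (fst (fst q), snd q))) \<in> borel_measurable ?M"
    by (rule borel_measurable_times_ennreal[OF measurable_Times_fst[OF cyl U k] ff])
  have ef: "(\<lambda>p. ennreal (f j p)) \<in> borel_measurable (lebesgue_on (\<omega> \<times> UNIV))" using f[of j] by measurable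
  have "(\<integral>\<^sup>+(x, v). ennreal (V x * (cmod (ch j x))\<^sup>2 * f j (fst x, v)) \<partial>?M)
      = (\<integral>\<^sup>+q. ?k (fst q) * ennreal (f j (fst (fst q), snd q)) \<partial>?M)"
    using V(2) by (intro nn_integral_cong) (auto simp: ennreal_mult')
  also have "\<dots> = (\<integral>\<^sup>+x. (\<integral>\<^sup>+v. ?k x * ennreal (f j (fst x, v)) \<partial>lebesgue) \<partial>lebesgue_on (cylinder \<omega>))"
    using Tonelli(1)[OF cyl U prod] by (simp add: lebesgue_on_UNIV_eq)
  also have "\<dots> = (\<integral>\<^sup>+x. ?k x * (\<integral>\<^sup>+v. ennreal (f j (fst x, v)) \<partial>lebesgue) \<partial>lebesgue_on (cylinder \<omega>))"
  proof (rule nn_integral_cong_AE)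
    have "AE y in lebesgue_on \<omega>. (\<lambda>v. ennreal (f j (y, v))) \<in> borel_measurable lebesgue"
      using ennreal_section_measurable[OF \<omega> U ef] by (simp add: lebesgue_on_UNIV_eq)
    from AE_Times_fst[OF \<omega> unit_ivl_borel this]
    show "AE x in lebesgue_on (cylinder \<omega>). (\<integral>\<^sup>+v. ?k x * ennreal (f j (fst x, v)) \<partial>lebesgue)
        = ?k x * (\<integral>\<^sup>+v. ennreal (f j (fst x, v)) \<partial>lebesgue)"
      by eventually_elim (rule nn_integral_cmult)
  qed
  also have "\<dots> = (\<integral>\<^sup>+p. transverse_mean V (ch j) (fst p) * ennreal (f j p) \<partial>lebesgue_on (\<omega> \<times> UNIV))"
    by (rule weighted_velocity_integral[OF V(1) \<eta> f])
  finally show "(\<integral>\<^sup>+(x, v). ennreal (V x * (cmod (ch j x))\<^sup>2 * f j (fst x, v)) \<partial>?M)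
    = (\<integral>\<^sup>+p. transverse_mean V (ch j) (fst p) * ennreal (f j p) \<partial>lebesgue_on (\<omega> \<times> UNIV))" .
qed

lemma A_qm_transverse_mean_1:
  assumes ch: "ch \<in> A_qm \<omega>" and y: "y \<in> \<omega>"
  shows "transverse_mean (\<lambda>_. 1) (ch j) y = 1"
proof -
  have "(\<lambda>z. ch j (y, z)) \<in> H1_0 unit_ivl" and one: "L2_inner (\<lambda>z. ch j (y, z)) (\<lambda>z. ch j (y, z)) = 1"
    using ch y by (simp_all add: A_qm_def)
  then have "(\<lambda>z. ch j (y, z)) \<in> L2u" using H1_0D(1) by blast
  from L2_normsq_eq[OF this] show ?thesis
    using one nsq_eq[of "\<lambda>z. ch j (y, z)"] by (simp add: L2_normsq_def transverse_mean_def)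
qed

text \<open>\<open>particle_density\<close> is made of Bochner integrals and a real series, which
  take default values when they do not converge. As the transverse states are normalized, the mass
  is the integral of the series in \<open>ennreal\<close>; its finiteness makes the velocity
  averages and the series converge almost everywhere.\<close>

lemma particle_density_AE:
  assumes f: "f \<in> A_cm \<omega>" and ch: "ch \<in> A_qm \<omega>"
  shows "AE x in lebesgue_on (cylinder \<omega>). 0 \<le> particle_density f ch x \<and>
    ennreal (particle_density f ch x)
      = (\<Sum>j. ennreal ((cmod (ch j x))\<^sup>2) * (\<integral>\<^sup>+v. ennreal (f j (fst x, v)) \<partial>lebesgue))"
proof -
  let ?Q = "lebesgue_on (cylinder \<omega>)"
  let ?n = "\<lambda>j y. \<integral>\<^sup>+v. ennreal (f j (y, v)) \<partial>lebesgue"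
  have U: "(UNIV :: vec2 set) \<in> sets borel" by simp
  have fm: "f j \<in> borel_measurable (lebesgue_on (\<omega> \<times> UNIV))" and f0: "\<And>y v. y \<in> \<omega> \<Longrightarrow> 0 \<le> f j (y, v)"
    and mass: "mass \<omega> f < \<infinity>" for j using f by (auto simp: A_cm_def)
  have cm: "ch j \<in> borel_measurable ?Q" for j using ch by (simp add: A_qm_def)
  have nm: "?n j \<in> borel_measurable (lebesgue_on \<omega>)" for j by (rule velocity_integral_measurable[OF fm])
  note nQ = measurable_Times_fst[OF \<omega> unit_ivl_borel nm]
  have one: "(\<lambda>_. 1 :: real) \<in> borel_measurable ?Q" by simp
  have km: "(\<lambda>x. ennreal (W' x * (cmod (ch j x))\<^sup>2) * ?n j (fst x)) \<in> borel_measurable ?Q"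
    if "W' \<in> borel_measurable ?Q" for W' j
    by (rule borel_measurable_times_ennreal[OF weight_measurable[OF that cm] nQ])
  have mass_eq: "mass \<omega> f = (\<Sum>j. \<integral>\<^sup>+x. ennreal (1 * (cmod (ch j x))\<^sup>2) * ?n j (fst x) \<partial>?Q)"
    unfolding weighted_velocity_integral[OF one cm fm] mass_def
    using A_qm_transverse_mean_1[OF ch]
    by (intro arg_cong[where f = suminf] ext nn_integral_cong) auto
  also have "\<dots> = (\<integral>\<^sup>+x. (\<Sum>j. ennreal (1 * (cmod (ch j x))\<^sup>2) * ?n j (fst x)) \<partial>?Q)"
    by (rule nn_integral_suminf[symmetric]) (rule km[OF one])
  finally have "(\<integral>\<^sup>+x. (\<Sum>j. ennreal (1 * (cmod (ch j x))\<^sup>2) * ?n j (fst x)) \<partial>?Q) \<noteq> \<infinity>"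
    using mass by simp
  then have fin: "AE x in ?Q. (\<Sum>j. ennreal (1 * (cmod (ch j x))\<^sup>2) * ?n j (fst x)) \<noteq> \<infinity>"
    by (rule nn_integral_PInf_AE[rotated]) (use km[OF one] in measurable)
  have "AE y in lebesgue_on \<omega>. \<forall>j. ennreal (velocity_average (f j) y) = ?n j y \<and> 0 \<le> velocity_average (f j) y"
    unfolding AE_all_countable
  proof
    fix j
    have "(\<integral>\<^sup>+y. ?n j y \<partial>lebesgue_on \<omega>) = (\<integral>\<^sup>+p. ennreal (f j p) \<partial>lebesgue_on (\<omega> \<times> UNIV))"
      using Tonelli(1)[OF \<omega> U, of "\<lambda>p. ennreal (f j p)"] fm[of j] by (simp add: lebesgue_on_UNIV_eq)
    also have "\<dots> \<le> mass \<omega> f"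
      unfolding mass_def using sum_le_suminf[OF summableI, of "{j}"] by simp
    finally have "(\<integral>\<^sup>+y. ?n j y \<partial>lebesgue_on \<omega>) \<noteq> \<infinity>" using mass by (auto simp: top_unique)
    then have "AE y in lebesgue_on \<omega>. ?n j y \<noteq> \<infinity>" by (rule nn_integral_PInf_AE[rotated]) (rule nm)
    moreover have "AE y in lebesgue_on \<omega>. (\<lambda>v. f j (y, v)) \<in> borel_measurable lebesgue"
      using real_section_measurable[OF \<omega> U fm] by (simp add: lebesgue_on_UNIV_eq)
    moreover have "AE y in lebesgue_on \<omega>. y \<in> \<omega>" by (rule AE_I2) simp
    ultimately show "AE y in lebesgue_on \<omega>. ennreal (velocity_average (f j) y) = ?n j y \<and> 0 \<le> velocity_average (f j) y"
    proof eventually_elim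
      case (elim y)
      have "integrable lebesgue (\<lambda>v. f j (y, v))"
        using elim f0[of y] by (intro integrableI_bounded) (auto simp: top.not_eq_extremum)
      then show ?case
        using f0[OF elim(3)] by (simp add: velocity_average_def nn_integral_eq_integral Bochner_Integration.integral_nonneg)
    qed
  qed
  from AE_Times_fst[OF \<omega> unit_ivl_borel this] fin
  show ?thesis
  proof eventually_elim
    case (elim x)
    let ?t = "\<lambda>j. velocity_average (f j) (fst x) * (cmod (ch j x))\<^sup>2"
    have t0: "0 \<le> ?t j" for j using elim(1) by simp
    have t: "ennreal (?t j) = ennreal ((cmod (ch j x))\<^sup>2) * ?n j (fst x)" for j
    proof -
      have "ennreal (?t j) = ennreal (velocity_average (f j) (fst x)) * ennreal ((cmod (ch j x))\<^sup>2)"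
        using elim(1) by (intro ennreal_mult) auto
      then show ?thesis using elim(1) by (simp add: mult.commute)
    qed
    have "(\<Sum>j. ennreal (?t j)) \<noteq> \<infinity>" using elim(2) by (simp add: t)
    then have sm: "summable ?t" using t0 by (intro summable_suminf_not_top) auto
    show ?case
      unfolding particle_density_def using suminf_nonneg[OF sm t0] suminf_ennreal2[OF t0 sm]
      by (simp add: t)
  qed
qed

lemma density_integral_eq:
  assumes f: "f \<in> A_cm \<omega>" and ch: "ch \<in> A_qm \<omega>"
    and W: "W \<in> borel_measurable (lebesgue_on (cylinder \<omega>))" "\<And>x. 0 \<le> W x"
  shows "(\<integral>\<^sup>+x. ennreal (particle_density f ch x * W x) \<partial>lebesgue_on (cylinder \<omega>))
    = (\<Sum>j. \<integral>\<^sup>+p. transverse_mean W (ch j) (fst p) * ennreal (f j p) \<partial>lebesgue_on (\<omega> \<times> UNIV))"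
proof -
  let ?Q = "lebesgue_on (cylinder \<omega>)"
  let ?n = "\<lambda>j y. \<integral>\<^sup>+v. ennreal (f j (y, v)) \<partial>lebesgue"
  have U: "(UNIV :: vec2 set) \<in> sets borel" by simp
  have fm: "f j \<in> borel_measurable (lebesgue_on (\<omega> \<times> UNIV))" and f0: "\<And>y v. y \<in> \<omega> \<Longrightarrow> 0 \<le> f j (y, v)"
    and mass: "mass \<omega> f < \<infinity>" for j using f by (auto simp: A_cm_def)
  have cm: "ch j \<in> borel_measurable ?Q" for j using ch by (simp add: A_qm_def)
  have nm: "?n j \<in> borel_measurable (lebesgue_on \<omega>)" for j by (rule velocity_integral_measurable[OF fm])
  note nQ = measurable_Times_fst[OF \<omega> unit_ivl_borel nm]
  have one: "(\<lambda>_. 1 :: real) \<in> borel_measurable ?Q" by simp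
  have km: "(\<lambda>x. ennreal (W' x * (cmod (ch j x))\<^sup>2) * ?n j (fst x)) \<in> borel_measurable ?Q"
    if "W' \<in> borel_measurable ?Q" for W' j
    by (rule borel_measurable_times_ennreal[OF weight_measurable[OF that cm] nQ])
  have "AE x in ?Q. ennreal (particle_density f ch x * W x) = (\<Sum>j. ennreal (W x * (cmod (ch j x))\<^sup>2) * ?n j (fst x))"
    using particle_density_AE[OF f ch]
  proof eventually_elim
    case (elim x)
    have "ennreal (particle_density f ch x * W x) = ennreal (W x) * ennreal (particle_density f ch x)"
      using elim W(2) by (simp add: ennreal_mult mult.commute)
    also have "\<dots> = (\<Sum>j. ennreal (W x) * (ennreal ((cmod (ch j x))\<^sup>2) * ?n j (fst x)))"
      using elim by simp
    also have "\<dots> = (\<Sum>j. ennreal (W x * (cmod (ch j x))\<^sup>2) * ?n j (fst x))"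
      using W(2) by (simp add: ennreal_mult mult.assoc)
    finally show ?case .
  qed
  then have "(\<integral>\<^sup>+x. ennreal (particle_density f ch x * W x) \<partial>?Q)
      = (\<integral>\<^sup>+x. (\<Sum>j. ennreal (W x * (cmod (ch j x))\<^sup>2) * ?n j (fst x)) \<partial>?Q)"
    by (rule nn_integral_cong_AE)
  also have "\<dots> = (\<Sum>j. \<integral>\<^sup>+x. ennreal (W x * (cmod (ch j x))\<^sup>2) * ?n j (fst x) \<partial>?Q)"
    by (rule nn_integral_suminf) (rule km[OF W(1)])
  finally show ?thesis unfolding weighted_velocity_integral[OF W(1) cm fm] .
qed

end

section \<open>The relative free energy\<close>

lemma transverse_mean_eq:
  assumes W: "integrable lebesgue_unit (\<lambda>z. W (y, z))" "\<And>z. z \<in> unit_ivl \<Longrightarrow> 0 \<le> W (y, z)"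
    and u: "(\<lambda>z. \<eta> (y, z)) \<in> H1_0 unit_ivl"
  shows "integrable lebesgue_unit (\<lambda>z. W (y, z) * (cmod (\<eta> (y, z)))\<^sup>2)"
    and "transverse_mean W \<eta> y = ennreal (\<integral>z. W (y, z) * (cmod (\<eta> (y, z)))\<^sup>2 \<partial>lebesgue_unit)"
proof -
  have eq: "complex_of_real (W (y, z)) * \<eta> (y, z) * cnj (\<eta> (y, z))
      = complex_of_real (W (y, z) * (cmod (\<eta> (y, z)))\<^sup>2)" for z
    unfolding of_real_mult complex_norm_square by (simp only: mult.assoc)
  show i: "integrable lebesgue_unit (\<lambda>z. W (y, z) * (cmod (\<eta> (y, z)))\<^sup>2)"
    using integrable_Re[OF potential_mult_integrable[OF W(1) u u, unfolded eq]]
    unfolding Re_complex_of_real .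
  show "transverse_mean W \<eta> y = ennreal (\<integral>z. W (y, z) * (cmod (\<eta> (y, z)))\<^sup>2 \<partial>lebesgue_unit)"
    unfolding transverse_mean_def using W(2) by (intro nn_integral_eq_integral[OF i] AE_I2) auto
qed

lemma potential_quad_eq:
  "Re (L2_inner (\<lambda>z. complex_of_real (W z) * u z) u) = (\<integral>z. W z * (cmod (u z))\<^sup>2 \<partial>lebesgue_unit)"
proof -
  have eq: "complex_of_real (W z) * u z * cnj (u z) = complex_of_real (W z * (cmod (u z))\<^sup>2)" for z
    unfolding of_real_mult complex_norm_square by (simp only: mult.assoc)
  show ?thesis unfolding L2_inner_def eq by (simp only: integral_complex_of_real Re_complex_of_real)
qed

text \<open>Here f is the occupation, q the kinetic and E the transverse energy, b the entropy term
  T \<beta>(f), l the eigenvalues, p the overlaps and \<Phi> the Legendre transforms. The weights p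
  may sum to less than 1; the missing weight is charged to the level \<mu>0, where occupation brings
  no gain by the last hypothesis.\<close>

lemma Peierls_pointwise:
  fixes f E b \<mu> \<mu>0 q :: real and p l \<Phi> :: "nat \<Rightarrow> real"
  assumes f: "0 \<le> f" and p: "\<And>k. 0 \<le> p k" "(\<Sum>k<K. p k) \<le> 1"
    and E: "\<mu>0 - (\<Sum>k<K. (\<mu>0 - l k) * p k) \<le> E"
    and \<Phi>: "\<And>k. f * (\<mu> - q - l k) - b \<le> \<Phi> k" and c: "f * (\<mu> - q - \<mu>0) - b \<le> 0"
  shows "\<mu> * f \<le> q * f + E * f + b + (\<Sum>k<K. p k * \<Phi> k)"
proof -
  let ?c = "f * (\<mu> - q - \<mu>0) - b" and ?S = "\<Sum>k<K. (\<mu>0 - l k) * p k"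
  have "?c \<le> (\<Sum>k<K. p k) * ?c" using p(2) c mult_right_mono_neg[of "\<Sum>k<K. p k" 1 ?c] by simp
  moreover have "(\<Sum>k<K. p k) * ?c + f * ?S = (\<Sum>k<K. p k * (f * (\<mu> - q - l k) - b))"
    unfolding sum_distrib_right sum_distrib_left sum.distrib[symmetric]
    by (intro sum.cong) (simp_all add: algebra_simps)
  moreover have "\<dots> \<le> (\<Sum>k<K. p k * \<Phi> k)" by (intro sum_mono mult_left_mono p(1) \<Phi>)
  moreover have "f * (\<mu>0 - ?S) \<le> f * E" by (rule mult_left_mono[OF E f])
  ultimately show ?thesis by (simp add: algebra_simps)
qed

lemma suminf_swap_ennreal:
  fixes a :: "nat \<Rightarrow> nat \<Rightarrow> ennreal"
  shows "(\<Sum>j. \<Sum>k. a j k) = (\<Sum>k. \<Sum>j. a j k)"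
proof -
  have "(\<Sum>j. \<Sum>k. a j k) = (\<integral>\<^sup>+j. (\<Sum>k. a j k) \<partial>count_space UNIV)" by (simp add: nn_integral_count_space_nat)
  also have "\<dots> = (\<Sum>k. \<integral>\<^sup>+j. a j k \<partial>count_space UNIV)" by (rule nn_integral_suminf) simp
  finally show ?thesis by (simp add: nn_integral_count_space_nat)
qed

lemma integrable_of_square:
  fixes g :: "real \<Rightarrow> real"
  assumes "g \<in> borel_measurable lebesgue_unit" "(\<integral>\<^sup>+z. ennreal ((norm (g z))\<^sup>2) \<partial>lebesgue_unit) \<noteq> \<infinity>"
  shows "integrable lebesgue_unit g"
proof -
  have "g \<in> L2 unit_ivl" using assms by (simp add: L2_def L2_normsq_def top.not_eq_extremum)
  then have "integrable lebesgue_unit (\<lambda>z. (norm (g z))\<^sup>2)" by (simp add: L2_iff)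
  moreover have "integrable lebesgue_unit (\<lambda>_. 1 :: real)"
    using finite_measure.integrable_const[OF finite_measure_lebesgue_unit] .
  ultimately have "integrable lebesgue_unit (\<lambda>z. 1 + (norm (g z))\<^sup>2)" by (rule Bochner_Integration.integrable_add[rotated])
  then show ?thesis
  proof (rule Bochner_Integration.integrable_bound[OF _ assms(1)])
    have le: "x \<le> 1 + x\<^sup>2" for x :: real
      using sum_squares_bound[of x 1] zero_le_power2[of x] by (cases "x \<le> 0") (auto simp: power2_eq_square intro: add_increasing2)
    have "norm (g z) \<le> norm (1 + (norm (g z))\<^sup>2)" for z
      using le[of "norm (g z)"] by simp
    then show "AE z in lebesgue_unit. norm (g z) \<le> norm (1 + (norm (g z))\<^sup>2)"
      by (rule AE_I2)
  qed
qed

section \<open>The equilibrium and its Legendre transform\<close>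

text \<open>U is a fixed representative of the equilibrium potential; its Poisson equation enters in
  \<open>relative_energy\<close>. A potential is determined up to null sets, so the spectral
  conditions are imposed for almost every y.\<close>

locale equilibrium =
  fixes \<omega> :: "vec2 set" and V :: "vec2 \<times> real \<Rightarrow> real" and \<beta> :: "real \<Rightarrow> real" and T \<mu> :: real
    and fs :: cl_state and chs :: qm_state and lam :: "nat \<Rightarrow> vec2 \<Rightarrow> real" and U :: "vec2 \<times> real \<Rightarrow> real"
  assumes open_\<omega>: "open \<omega>" and bounded_\<omega>: "bounded \<omega>"
    and V_cont: "continuous_on (closure (cylinder \<omega>)) V"
    and V_nonneg: "\<And>x. x \<in> closure (cylinder \<omega>) \<Longrightarrow> 0 \<le> V x"
    and gen: "entropy_generator \<beta>" and T: "T \<ge> 0" and \<mu>: "\<mu> > 0"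
    and fs: "fs \<in> A_cm \<omega>" and chs: "chs \<in> A_qm \<omega>" and U: "U \<in> L2 (cylinder \<omega>)"
    and fs_eq: "\<And>j. AE (y, v) in lebesgue_on (\<omega> \<times> UNIV).
           fs j (y, v) = beta_tilde T \<beta> (\<mu> - (norm v)\<^sup>2 / 2 - lam j y)"
    and eig: "AE y in lebesgue_on \<omega>. eigenvalues (\<lambda>z. U (y, z) + V (y, z)) (\<lambda>j. lam j y)"
    and schr: "\<And>j. AE y in lebesgue_on \<omega>.
           schroedinger_eq (\<lambda>z. U (y, z) + V (y, z)) (lam j y) (\<lambda>z. chs j (y, z))"
begin

abbreviation P where "P \<equiv> lebesgue_on (\<omega> \<times> (UNIV :: vec2 set))"
abbreviation Q where "Q \<equiv> lebesgue_on (cylinder \<omega>)"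

lemma \<omega>: "\<omega> \<in> sets borel"
  using open_\<omega> by simp

lemma UNIV_borel: "(UNIV :: vec2 set) \<in> sets borel"
  by simp

definition U_plus where "U_plus x = max 0 (U x)"
definition U_minus where "U_minus x = max 0 (- U x)"

lemma U_measurable: "U \<in> borel_measurable Q" "U_plus \<in> borel_measurable Q" "U_minus \<in> borel_measurable Q"
proof -
  show m: "U \<in> borel_measurable Q" by (rule L2_measurable[OF U])
  show "U_plus \<in> borel_measurable Q" "U_minus \<in> borel_measurable Q"
    unfolding U_plus_def[abs_def] U_minus_def[abs_def] using m by measurable
qed

lemma V_measurable: "V \<in> borel_measurable Q"
  using continuous_imp_measurable_on_sets_lebesgue[OF continuous_on_subset[OF V_cont closure_subset]]
    sets_Times(3)[OF \<omega> unit_ivl_borel] .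

text \<open>By Tonelli almost every slice of U is square integrable on an interval of finite length;
  slices of V are bounded, V being continuous on a compact closure. Integrability of the sum is what
  the transverse form theory asks for.\<close>

lemma sections_integrable:
  "AE y in lebesgue_on \<omega>. integrable lebesgue_unit (\<lambda>z. U (y, z)) \<and> integrable lebesgue_unit (\<lambda>z. V (y, z))"
proof -
  have "compact (closure (cylinder \<omega>))"
    using bounded_Times[OF bounded_\<omega>, of unit_ivl] by (simp add: compact_closure)
  from compact_imp_bounded[OF compact_continuous_image[OF V_cont this]]
  obtain C where C: "\<And>x. x \<in> closure (cylinder \<omega>) \<Longrightarrow> norm (V x) \<le> C" unfolding bounded_iff by blast
  have "(\<integral>\<^sup>+y. (\<integral>\<^sup>+z. ennreal ((norm (U (y, z)))\<^sup>2) \<partial>lebesgue_unit) \<partial>lebesgue_on \<omega>) = L2_normsq (cylinder \<omega>) U"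
    unfolding L2_normsq_def
    by (rule Tonelli(1)[OF \<omega> unit_ivl_borel, symmetric]) (use U_measurable(1) in measurable)
  also have "\<dots> \<noteq> \<infinity>" using U by (auto simp: L2_def)
  finally have "AE y in lebesgue_on \<omega>. (\<integral>\<^sup>+z. ennreal ((norm (U (y, z)))\<^sup>2) \<partial>lebesgue_unit) \<noteq> \<infinity>"
    by (rule nn_integral_PInf_AE[rotated]) (rule Tonelli(2)[OF \<omega> unit_ivl_borel], use U_measurable(1) in measurable)
  moreover have "AE y in lebesgue_on \<omega>. y \<in> \<omega>" by (rule AE_I2) simp
  ultimately show ?thesis
    using real_section_measurable[OF \<omega> unit_ivl_borel U_measurable(1)]
      real_section_measurable[OF \<omega> unit_ivl_borel V_measurable]
  proof eventually_elim
    case (elim y)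
    interpret finite_measure lebesgue_unit by (rule finite_measure_lebesgue_unit)
    have "(y, z) \<in> closure (cylinder \<omega>)" if "z \<in> unit_ivl" for z
      using elim(2) that closure_subset[of "cylinder \<omega>"] by blast
    then have "AE z in lebesgue_unit. norm (V (y, z)) \<le> C"
      using C by (intro AE_I2) auto
    then show ?case
      using integrable_of_square[OF elim(3,1)] integrable_const_bound[OF _ elim(4)] by blast
  qed
qed

text \<open>At transverse levels above \<mu>0 the argument of \<open>beta_tilde\<close> is below its
  threshold for every velocity, so nothing is occupied.\<close>

definition \<mu>0 where "\<mu>0 = \<mu> - beta_threshold T \<beta>"

text \<open>The truncated level \<open>max 0 (\<mu>0 - lam k y)\<close>, read off from the measure of the velocities occupied at
  \<open>y\<close>, so that it is measurable although nothing is assumed about \<open>lam k\<close>.\<close>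

definition level :: "nat \<Rightarrow> vec2 \<Rightarrow> real" where
  "level k y = enn2real (\<integral>\<^sup>+v. indicator {0<..} (fs k (y, v)) \<partial>lebesgue) / (2 * pi)"

lemma fs_measurable: "fs k \<in> borel_measurable P"
  using fs by (simp add: A_cm_def)

lemma level_measurable: "(\<lambda>p. level k (fst p)) \<in> borel_measurable P"
proof -
  have "(\<lambda>p. indicator {0<..} (fs k p) :: ennreal) \<in> borel_measurable P"
    by (rule measurable_compose[OF fs_measurable]) (rule borel_measurable_indicator, simp)
  from Tonelli(2)[OF \<omega> UNIV_borel this]
  have "(\<lambda>y. \<integral>\<^sup>+v. indicator {0<..} (fs k (y, v)) \<partial>lebesgue :: ennreal) \<in> borel_measurable (lebesgue_on \<omega>)"
    by (simp add: lebesgue_on_UNIV_eq)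
  from measurable_Times_fst[OF \<omega> UNIV_borel this]
  show ?thesis unfolding level_def by measurable
qed

lemma occupied_iff:
  assumes "f = beta_tilde T \<beta> (\<mu> - (norm v)\<^sup>2 / 2 - l)"
  shows "(norm v)\<^sup>2 / 2 < \<mu>0 - l \<Longrightarrow> 0 < f" "\<mu>0 - l < (norm v)\<^sup>2 / 2 \<Longrightarrow> f = 0"
  using beta_tilde_optimal(3,4)[OF gen T, of 0] assms by (auto simp: \<mu>0_def)

text \<open>Up to a circle of measure 0, the velocities occupied at y form the disc |v|^2 / 2 <
  \<mu>0 - lam k y. Its area is 2 pi times the truncated level, hence the division in
  \<open>level\<close>.\<close>

lemma level_eq: "AE y in lebesgue_on \<omega>. level k y = max 0 (\<mu>0 - lam k y)"
proof -
  have "AE y in lebesgue_on \<omega>. AE v in lebesgue. fs k (y, v) = beta_tilde T \<beta> (\<mu> - (norm v)\<^sup>2 / 2 - lam k y)"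
    using AE_Times[OF \<omega> UNIV_borel fs_eq[of k]] unfolding lebesgue_on_UNIV_eq prod.case .
  then show ?thesis
  proof eventually_elim
    case (elim y)
    let ?m = "max 0 (\<mu>0 - lam k y)"
    define R where "R = sqrt (2 * ?m)"
    have R: "0 \<le> R" "R\<^sup>2 / 2 = ?m" by (simp_all add: R_def)
    have "AE v :: vec2 in lebesgue. v \<notin> sphere 0 R"
      using AE_not_in[OF negligible_sphere[of "0 :: vec2" R, unfolded negligible_iff_null_sets]] .
    with elim have "AE v in lebesgue. indicator {0<..} (fs k (y, v)) = (indicator (ball 0 R) v :: ennreal)"
    proof eventually_elim
      case (elim v)
      show ?case
      proof (cases "norm v < R")
        case True
        then have "(norm v)\<^sup>2 / 2 < ?m" using R power_strict_mono[of "norm v" R 2] by simp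
        then have "(norm v)\<^sup>2 / 2 < \<mu>0 - lam k y"
          using zero_le_power2[of "norm v"] by (simp add: max_def split: if_splits)
        then show ?thesis using occupied_iff(1)[OF elim(1)] True by (simp add: indicator_def)
      next
        case False
        then have "R < norm v" using elim(2) by simp
        then have "?m < (norm v)\<^sup>2 / 2" using R power_strict_mono[of R "norm v" 2] by simp
        then have "\<mu>0 - lam k y < (norm v)\<^sup>2 / 2" by (rule le_less_trans[OF max.cobounded2])
        then show ?thesis using occupied_iff(2)[OF elim(1)] False by (simp add: indicator_def)
      qed
    qed
    then have "(\<integral>\<^sup>+v. indicator {0<..} (fs k (y, v)) \<partial>lebesgue) = (\<integral>\<^sup>+v. indicator (ball 0 R) (v::vec2) \<partial>lebesgue)"
      by (rule nn_integral_cong_AE)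
    also have "\<dots> = emeasure lebesgue (ball (0::vec2) R)" by simp
    also have "\<dots> = ennreal (pi * R\<^sup>2)"
      using R(1) by (simp add: emeasure_ball unit_ball_vol_2)
    finally show ?case using R by (simp add: level_def)
  qed
qed

text \<open>The Legendre transform of T \<beta> at \<mu> - |v|^2 / 2 - lam k y, attained at
  \<open>fs k\<close>. Writing \<mu>0 - level for the eigenvalue keeps it measurable; almost
  everywhere the two differ only where lam k y exceeds \<mu>0, and there \<open>fs k\<close> = 0
  makes the value 0 in both forms.\<close>

definition dual :: "nat \<Rightarrow> vec2 \<times> vec2 \<Rightarrow> real" where
  "dual k p = fs k p * (\<mu> - (norm (snd p))\<^sup>2 / 2 - \<mu>0 + level k (fst p)) - T * \<beta> (fs k p)"

lemma beta_measurable: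
  fixes f :: "vec2 \<times> vec2 \<Rightarrow> real"
  assumes f: "f \<in> borel_measurable P" and f01: "\<And>y v. y \<in> \<omega> \<Longrightarrow> f (y, v) \<in> {0..1}"
  shows "(\<lambda>p. \<beta> (f p)) \<in> borel_measurable P"
proof -
  \<comment> \<open>\<beta> is controlled on [0,1] only; clamping the argument gives a continuous
    function on the line with the same values on the range of f.\<close>
  have "continuous_on UNIV (\<lambda>x. \<beta> (max 0 (min 1 x)))"
    by (rule continuous_on_compose2[OF beta_continuous[OF gen]]) (auto intro!: continuous_intros)
  then have "(\<lambda>p. \<beta> (max 0 (min 1 (f p)))) \<in> borel_measurable P"
    by (rule borel_measurable_continuous_on[OF _ f])
  moreover have "\<beta> (max 0 (min 1 (f p))) = \<beta> (f p)" if "p \<in> space P" for p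
    using that f01[of "fst p" "snd p"] by (cases p) auto
  ultimately show ?thesis
    using measurable_cong[of P "\<lambda>p. \<beta> (max 0 (min 1 (f p)))" "\<lambda>p. \<beta> (f p)" borel] by blast
qed

lemma A_cm_range: "f \<in> A_cm \<omega> \<Longrightarrow> y \<in> \<omega> \<Longrightarrow> f j (y, v) \<in> {0..1}"
  by (simp add: A_cm_def)

lemma norm_snd_measurable: "(\<lambda>p. (norm (snd p :: vec2))\<^sup>2 / 2) \<in> borel_measurable P"
  by (intro borel_imp_lebesgue_on borel_measurable_continuous_onI continuous_intros) simp

lemma dual_measurable: "dual k \<in> borel_measurable P"
  unfolding dual_def[abs_def]
  using fs_measurable[of k] norm_snd_measurable level_measurable[of k]
    beta_measurable[OF fs_measurable[of k] A_cm_range[OF fs]] by measurable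

lemma dual_eq:
  "AE p in P. \<forall>k. let s = \<mu> - (norm (snd p))\<^sup>2 / 2 - lam k (fst p) in
     dual k p = s * fs k p - T * \<beta> (fs k p) \<and> 0 \<le> dual k p \<and> (\<forall>x\<in>{0..1}. s * x - T * \<beta> x \<le> dual k p)"
  unfolding AE_all_countable
proof
  fix k
  have 1: "AE p in P. fs k p = beta_tilde T \<beta> (\<mu> - (norm (snd p))\<^sup>2 / 2 - lam k (fst p))"
    using fs_eq[of k] by (simp add: case_prod_beta)
  from 1 AE_Times_fst[OF \<omega> UNIV_borel level_eq[of k]]
  show "AE p in P. let s = \<mu> - (norm (snd p))\<^sup>2 / 2 - lam k (fst p) in
     dual k p = s * fs k p - T * \<beta> (fs k p) \<and> 0 \<le> dual k p \<and> (\<forall>x\<in>{0..1}. s * x - T * \<beta> x \<le> dual k p)"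
  proof eventually_elim
    case (elim p)
    let ?s = "\<mu> - (norm (snd p))\<^sup>2 / 2 - lam k (fst p)"
    have eq: "dual k p = ?s * fs k p - T * \<beta> (fs k p)"
    proof (cases "\<mu>0 < lam k (fst p)")
      case True
      then have "fs k p = 0"
        using occupied_iff(2)[OF elim(1)] zero_le_power2[of "norm (snd p)"] by (simp add: field_simps)
      then show ?thesis by (simp add: dual_def)
    next
      case False
      then have "\<mu> - (norm (snd p))\<^sup>2 / 2 - \<mu>0 + level k (fst p) = ?s" using elim(2) by simp
      then show ?thesis by (simp only: dual_def mult.commute)
    qed
    have opt: "?s * x - T * \<beta> x \<le> dual k p" if "x \<in> {0..1}" for x
      unfolding eq using beta_tilde_optimal(2)[OF gen T that, of ?s] elim(1) by simp
    then have "0 \<le> dual k p" using opt[of 0] beta_0[OF gen] by simp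
    then show ?case unfolding Let_def using eq opt by blast
  qed
qed

section \<open>Transverse energies and overlaps\<close>

definition transverse_energy :: "(vec2 \<times> real \<Rightarrow> complex) \<Rightarrow> vec2 \<Rightarrow> real" where
  "transverse_energy \<eta> y = Re (schroedinger_form (\<lambda>z. U (y, z) + V (y, z)) (\<lambda>z. \<eta> (y, z)) (\<lambda>z. \<eta> (y, z)))"

text \<open>All four parts are finite for slices in \<open>H1_0\<close>. With real names for them an
  inequality can be proved in \<real>, and c moved across before passing to
  \<open>ennreal\<close>.\<close>

lemma transverse_energy_split:
  assumes UV: "integrable lebesgue_unit (\<lambda>z. U (y, z))" "integrable lebesgue_unit (\<lambda>z. V (y, z))"
    and y: "y \<in> \<omega>" and u: "(\<lambda>z. \<eta> (y, z)) \<in> H1_0 unit_ivl"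
  obtains a v b c where "L2_normsq unit_ivl (D1 (\<lambda>z. \<eta> (y, z))) / 2 = ennreal a"
    "transverse_mean V \<eta> y = ennreal v" "transverse_mean U_plus \<eta> y = ennreal b"
    "transverse_mean U_minus \<eta> y = ennreal c" "0 \<le> a" "0 \<le> v" "0 \<le> b" "0 \<le> c"
    "transverse_energy \<eta> y = a + v + b - c"
proof -
  let ?u = "\<lambda>z. \<eta> (y, z)"
  let ?i = "\<lambda>W. \<integral>z. W (y, z) * (cmod (\<eta> (y, z)))\<^sup>2 \<partial>lebesgue_unit"
  have Vn: "0 \<le> V (y, z)" if "z \<in> unit_ivl" for z
    using V_nonneg[of "(y, z)"] y that closure_subset[of "cylinder \<omega>"] by blast
  have ip: "integrable lebesgue_unit (\<lambda>z. U_plus (y, z))" "integrable lebesgue_unit (\<lambda>z. U_minus (y, z))"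
    unfolding U_plus_def U_minus_def using UV(1) by (simp_all add: integrable_max)
  have n: "0 \<le> U_plus x" "0 \<le> U_minus x" for x by (simp_all add: U_plus_def U_minus_def)
  note v = transverse_mean_eq[OF UV(2) Vn u] and b = transverse_mean_eq[OF ip(1) n(1) u]
    and c = transverse_mean_eq[OF ip(2) n(2) u]
  have nn: "0 \<le> ?i V" "0 \<le> ?i U_plus" "0 \<le> ?i U_minus"
    using Vn n by (auto intro!: Bochner_Integration.integral_nonneg_AE AE_I2)
  have "(\<integral>z. (U (y, z) + V (y, z)) * (cmod (\<eta> (y, z)))\<^sup>2 \<partial>lebesgue_unit)
      = (\<integral>z. V (y, z) * (cmod (\<eta> (y, z)))\<^sup>2 + U_plus (y, z) * (cmod (\<eta> (y, z)))\<^sup>2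
          - U_minus (y, z) * (cmod (\<eta> (y, z)))\<^sup>2 \<partial>lebesgue_unit)"
    by (intro Bochner_Integration.integral_cong) (auto simp: U_plus_def U_minus_def max_def algebra_simps)
  also have "\<dots> = ?i V + ?i U_plus - ?i U_minus"
    using v(1) b(1) c(1) by simp
  finally have "transverse_energy \<eta> y = nsq (D1 ?u) / 2 + ?i V + ?i U_plus - ?i U_minus"
    unfolding transverse_energy_def schroedinger_form_quad potential_quad_eq by simp
  moreover have "L2_normsq unit_ivl (D1 ?u) / 2 = ennreal (nsq (D1 ?u) / 2)"
    using L2_normsq_eq[OF H1_0D(2)[OF u]] nsq_nonneg[of "D1 ?u"]
    by (simp add: nsq_eq[symmetric] divide_ennreal flip: ennreal_numeral)
  ultimately show ?thesis using v(2) b(2) c(2) nn nsq_nonneg[of "D1 ?u"] by (intro that) auto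
qed

definition overlap :: "qm_state \<Rightarrow> nat \<Rightarrow> nat \<Rightarrow> vec2 \<Rightarrow> real" where
  "overlap ch j k y = (cmod (L2_inner (\<lambda>z. ch j (y, z)) (\<lambda>z. chs k (y, z))))\<^sup>2"

lemma A_qm_D:
  assumes "ch \<in> A_qm \<omega>"
  shows "ch j \<in> borel_measurable Q" "y \<in> \<omega> \<Longrightarrow> (\<lambda>z. ch j (y, z)) \<in> H1_0 unit_ivl"
    "y \<in> \<omega> \<Longrightarrow> L2_inner (\<lambda>z. ch j (y, z)) (\<lambda>z. ch k (y, z)) = (if j = k then 1 else 0)"
  using assms by (simp_all add: A_qm_def)

lemma overlap_measurable:
  assumes "ch \<in> A_qm \<omega>"
  shows "(\<lambda>p. ennreal (overlap ch j k (fst p))) \<in> borel_measurable P"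
proof -
  have "(\<lambda>x. ch j x * cnj (chs k x)) \<in> borel_measurable Q"
    using A_qm_D(1)[OF assms, of j] A_qm_D(1)[OF chs, of k] by measurable
  from measurable_section_integral[OF \<omega> unit_ivl_borel this]
  have "(\<lambda>y. ennreal (overlap ch j k y)) \<in> borel_measurable (lebesgue_on \<omega>)"
    unfolding overlap_def L2_inner_def by measurable
  then show ?thesis by (rule measurable_Times_fst[OF \<omega> UNIV_borel])
qed

text \<open>Bessel's inequality for each of the two orthonormal families, so the overlap matrix is
  doubly sub-stochastic. Sums over k enter the estimate of one state, sums over j the summation over
  all states.\<close>

lemma overlap_sum_le:
  assumes ch: "ch \<in> A_qm \<omega>" and y: "y \<in> \<omega>"
  shows "(\<Sum>k<n. overlap ch j k y) \<le> 1" "(\<Sum>j<n. overlap ch j k y) \<le> 1"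
proof -
  have "nsq (\<lambda>z. ch j (y, z)) = 1" using A_qm_D(3)[OF ch y, of j j] by simp
  then show "(\<Sum>k<n. overlap ch j k y) \<le> 1"
    using orthonormal_Bessel[of "\<lambda>z. ch j (y, z)" "\<lambda>k z. chs k (y, z)" n] A_qm_D(2,3)[OF chs y] A_qm_D(2)[OF ch y]
    unfolding overlap_def by simp
  have "nsq (\<lambda>z. chs k (y, z)) = 1" using A_qm_D(3)[OF chs y, of k k] by simp
  moreover have "overlap ch j k y = (cmod (L2_inner (\<lambda>z. chs k (y, z)) (\<lambda>z. ch j (y, z))))\<^sup>2" for j
    using L2.h_cnj[OF H1_0D(1)[OF A_qm_D(2)[OF ch y]] H1_0D(1)[OF A_qm_D(2)[OF chs y]], of k j]
    by (simp add: overlap_def)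
  ultimately show "(\<Sum>j<n. overlap ch j k y) \<le> 1"
    using orthonormal_Bessel[of "\<lambda>z. chs k (y, z)" "\<lambda>j z. ch j (y, z)" n] A_qm_D(2,3)[OF ch y] A_qm_D(2)[OF chs y]
    by simp
qed

abbreviation kinetic_density :: "qm_state \<Rightarrow> cl_state \<Rightarrow> nat \<Rightarrow> vec2 \<times> vec2 \<Rightarrow> ennreal" where
  "kinetic_density ch f j p \<equiv> (ennreal ((norm (snd p))\<^sup>2 / 2)
            + L2_normsq unit_ivl (weak_partial unit_ivl 1 (\<lambda>z. ch j (fst p, z))) / 2) * ennreal (f j p)"

abbreviation mean_density :: "(vec2 \<times> real \<Rightarrow> real) \<Rightarrow> qm_state \<Rightarrow> cl_state \<Rightarrow> nat \<Rightarrow> vec2 \<times> vec2 \<Rightarrow> ennreal" where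
  "mean_density W ch f j p \<equiv> transverse_mean W (ch j) (fst p) * ennreal (f j p)"

lemma regular_points:
  "AE p in P. fst p \<in> \<omega> \<and> integrable lebesgue_unit (\<lambda>z. U (fst p, z)) \<and> integrable lebesgue_unit (\<lambda>z. V (fst p, z))
    \<and> eigenvalues (\<lambda>z. U (fst p, z) + V (fst p, z)) (\<lambda>j. lam j (fst p))
    \<and> (\<forall>k. schroedinger_eq (\<lambda>z. U (fst p, z) + V (fst p, z)) (lam k (fst p)) (\<lambda>z. chs k (fst p, z)))"
proof (rule AE_Times_fst[OF \<omega> UNIV_borel])
  have "AE y in lebesgue_on \<omega>. y \<in> \<omega>" by (rule AE_I2) simp
  moreover have "AE y in lebesgue_on \<omega>. \<forall>k. schroedinger_eq (\<lambda>z. U (y, z) + V (y, z)) (lam k y) (\<lambda>z. chs k (y, z))"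
    unfolding AE_all_countable using schr by blast
  ultimately show "AE y in lebesgue_on \<omega>. y \<in> \<omega> \<and> integrable lebesgue_unit (\<lambda>z. U (y, z)) \<and> integrable lebesgue_unit (\<lambda>z. V (y, z))
    \<and> eigenvalues (\<lambda>z. U (y, z) + V (y, z)) (\<lambda>j. lam j y)
    \<and> (\<forall>k. schroedinger_eq (\<lambda>z. U (y, z) + V (y, z)) (lam k y) (\<lambda>z. chs k (y, z)))"
    using sections_integrable eig by eventually_elim blast
qed

section \<open>Inequality for a general state and equality at the equilibrium\<close>

text \<open>\<open>Peierls_pointwise\<close> at almost every phase space point, with the variational
  bound for H taken at the level \<mu>0. The sum over the finitely many eigenvalues below it is
  extended to all k, as the added terms are nonnegative.\<close>

lemma state_pointwise:
  assumes f: "f \<in> A_cm \<omega>" and ch: "ch \<in> A_qm \<omega>"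
  shows "AE p in P. ennreal \<mu> * ennreal (f j p) + mean_density U_minus ch f j p
    \<le> kinetic_density ch f j p + (mean_density V ch f j p + mean_density U_plus ch f j p
      + ennreal T * ennreal (\<beta> (f j p)) + (\<Sum>k. ennreal (overlap ch j k (fst p)) * ennreal (dual k p)))"
  using regular_points dual_eq
proof eventually_elim
  case (elim p)
  let ?y = "fst p" and ?q = "(norm (snd p))\<^sup>2 / 2"
  let ?W = "\<lambda>z. U (?y, z) + V (?y, z)"
  have y: "?y \<in> \<omega>" and i: "integrable lebesgue_unit (\<lambda>z. U (?y, z))" "integrable lebesgue_unit (\<lambda>z. V (?y, z))"
    and ev: "eigenvalues ?W (\<lambda>j. lam j ?y)" "\<And>k. schroedinger_eq ?W (lam k ?y) (\<lambda>z. chs k (?y, z))"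
    using elim(1) by auto
  have W: "integrable lebesgue_unit ?W" by (rule Bochner_Integration.integrable_add[OF i])
  have f01: "f j p \<in> {0..1}" using A_cm_range[OF f y, of j "snd p"] by simp
  have u: "(\<lambda>z. ch j (?y, z)) \<in> H1_0 unit_ivl" by (rule A_qm_D(2)[OF ch y])
  have nsq1: "nsq (\<lambda>z. ch j (?y, z)) = 1" using A_qm_D(3)[OF ch y, of j j] by simp
  obtain a v b c where e: "L2_normsq unit_ivl (D1 (\<lambda>z. ch j (?y, z))) / 2 = ennreal a"
    "transverse_mean V (ch j) ?y = ennreal v" "transverse_mean U_plus (ch j) ?y = ennreal b"
    "transverse_mean U_minus (ch j) ?y = ennreal c" "0 \<le> a" "0 \<le> v" "0 \<le> b" "0 \<le> c"
    "transverse_energy (ch j) ?y = a + v + b - c"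
    by (rule transverse_energy_split[OF i y u])
  obtain K where K: "{k. lam k ?y < \<mu>0} = {..<K}"
    "\<And>u. u \<in> H1_0 unit_ivl \<Longrightarrow> \<mu>0 * nsq u - (\<Sum>k<K. (\<mu>0 - lam k ?y) * (cmod (L2_inner u (\<lambda>z. chs k (?y, z))))\<^sup>2)
        \<le> Re (schroedinger_form ?W u u)"
    using eigenvalues_lower_bound[OF W ev A_qm_D(3)[OF chs y], of \<mu>0] by blast
  have E: "\<mu>0 - (\<Sum>k<K. (\<mu>0 - lam k ?y) * overlap ch j k ?y) \<le> a + v + b - c"
    using K(2)[OF u] nsq1 unfolding e(9)[symmetric] transverse_energy_def overlap_def by simp
  have d: "(\<mu> - ?q - lam k ?y) * x - T * \<beta> x \<le> dual k p" "0 \<le> dual k p" if "x \<in> {0..1}" for k x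
    using elim(2) that unfolding Let_def by blast+
  \<comment> \<open>At the level \<mu>0 the argument is \<open>beta_threshold\<close> minus |v|^2 /
    2, hence at most the threshold.\<close>
  have thr: "f j p * (\<mu> - ?q - \<mu>0) - T * \<beta> (f j p) \<le> 0"
    using below_beta_threshold[OF gen T f01, of "\<mu> - ?q - \<mu>0"] by (simp add: \<mu>0_def mult.commute)
  have real: "\<mu> * f j p \<le> ?q * f j p + (a + v + b - c) * f j p + T * \<beta> (f j p)
      + (\<Sum>k<K. overlap ch j k ?y * dual k p)"
    by (rule Peierls_pointwise[OF _ _ overlap_sum_le(1)[OF ch y] E])
      (use f01 d[OF f01] thr in \<open>auto simp: overlap_def mult.commute\<close>)
  have \<beta>: "0 \<le> \<beta> (f j p)" by (rule beta_nonneg[OF gen f01])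
  have d0: "0 \<le> dual k p" for k using d(2)[of 0] by simp
  have o0: "0 \<le> overlap ch j k ?y" for k by (simp add: overlap_def)
  have f0: "0 \<le> f j p" using f01 by simp
  have "ennreal \<mu> * ennreal (f j p) + mean_density U_minus ch f j p = ennreal (\<mu> * f j p + c * f j p)"
    using e(4,8) \<mu> f0 by (simp add: ennreal_mult)
  also have "\<dots> \<le> ennreal ((?q + a) * f j p + (v * f j p + b * f j p + T * \<beta> (f j p)
      + (\<Sum>k<K. overlap ch j k ?y * dual k p)))"
    using real by (intro ennreal_leI) (simp add: algebra_simps)
  also have "\<dots> = (ennreal ?q + ennreal a) * ennreal (f j p) + (ennreal v * ennreal (f j p) + ennreal b * ennreal (f j p)
      + ennreal T * ennreal (\<beta> (f j p)) + ennreal (\<Sum>k<K. overlap ch j k ?y * dual k p))"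
    using e(5-8) f0 T \<beta> d0 o0 by (simp add: ennreal_plus ennreal_mult sum_nonneg)
  also have "ennreal (\<Sum>k<K. overlap ch j k ?y * dual k p) = (\<Sum>k<K. ennreal (overlap ch j k ?y) * ennreal (dual k p))"
    using d0 o0 by (simp add: ennreal_mult sum_ennreal[symmetric])
  also have "\<dots> \<le> (\<Sum>k. ennreal (overlap ch j k ?y) * ennreal (dual k p))"
    by (rule sum_le_suminf[OF summableI]) auto
  finally show ?case by (simp add: e(1-4) add_left_mono)
qed

text \<open>For \<open>chs j\<close> the transverse energy is the eigenvalue itself, and
  \<open>fs j\<close> attains the Legendre transform; so the estimate of a general state becomes an
  identity here.\<close>

lemma equilibrium_pointwise:
  "AE p in P. ennreal (dual j p) + (kinetic_density chs fs j p + (mean_density V chs fs j p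
      + (mean_density U_plus chs fs j p + ennreal T * ennreal (\<beta> (fs j p)))))
    = ennreal \<mu> * ennreal (fs j p) + mean_density U_minus chs fs j p"
  using regular_points dual_eq
proof eventually_elim
  case (elim p)
  let ?y = "fst p" and ?q = "(norm (snd p))\<^sup>2 / 2"
  let ?W = "\<lambda>z. U (?y, z) + V (?y, z)"
  have y: "?y \<in> \<omega>" and i: "integrable lebesgue_unit (\<lambda>z. U (?y, z))" "integrable lebesgue_unit (\<lambda>z. V (?y, z))"
    and ev: "schroedinger_eq ?W (lam j ?y) (\<lambda>z. chs j (?y, z))"
    using elim(1) by auto
  have W: "integrable lebesgue_unit ?W" by (rule Bochner_Integration.integrable_add[OF i])
  have f01: "fs j p \<in> {0..1}" using A_cm_range[OF fs y, of j "snd p"] by simp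
  have u: "(\<lambda>z. chs j (?y, z)) \<in> H1_0 unit_ivl" by (rule A_qm_D(2)[OF chs y])
  obtain a v b c where e: "L2_normsq unit_ivl (D1 (\<lambda>z. chs j (?y, z))) / 2 = ennreal a"
    "transverse_mean V (chs j) ?y = ennreal v" "transverse_mean U_plus (chs j) ?y = ennreal b"
    "transverse_mean U_minus (chs j) ?y = ennreal c" "0 \<le> a" "0 \<le> v" "0 \<le> b" "0 \<le> c"
    "transverse_energy (chs j) ?y = a + v + b - c"
    by (rule transverse_energy_split[OF i y u])
  have "schroedinger_form ?W (\<lambda>z. chs j (?y, z)) (\<lambda>z. chs j (?y, z)) = complex_of_real (lam j ?y)"
    using ev u A_qm_D(3)[OF chs y, of j j] by (simp add: schroedinger_eq_iff[OF W])
  then have l: "lam j ?y = a + v + b - c" using e(9) by (simp add: transverse_energy_def)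
  have d: "dual j p = (\<mu> - ?q - lam j ?y) * fs j p - T * \<beta> (fs j p)" "0 \<le> dual j p"
    using elim(2) unfolding Let_def by blast+
  have \<beta>: "0 \<le> \<beta> (fs j p)" by (rule beta_nonneg[OF gen f01])
  have f0: "0 \<le> fs j p" using f01 by simp
  have "ennreal (dual j p) + (kinetic_density chs fs j p + (mean_density V chs fs j p
      + (mean_density U_plus chs fs j p + ennreal T * ennreal (\<beta> (fs j p)))))
    = ennreal (dual j p + ((?q + a) * fs j p + (v * fs j p + (b * fs j p + T * \<beta> (fs j p)))))"
    using e(5-8) f0 T \<beta> d(2) by (simp add: e(1-3) ennreal_plus ennreal_mult)
  also have "dual j p + ((?q + a) * fs j p + (v * fs j p + (b * fs j p + T * \<beta> (fs j p)))) = \<mu> * fs j p + c * fs j p"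
    unfolding d(1) l by (simp add: algebra_simps)
  also have "ennreal \<dots> = ennreal \<mu> * ennreal (fs j p) + mean_density U_minus chs fs j p"
    using e(4,8) \<mu> f0 by (simp add: ennreal_mult)
  finally show ?case .
qed

end

section \<open>Integrated bounds\<close>

context equilibrium
begin

text \<open>Minus the equilibrium value of the summed integrals of (energy - \<mu>) f + T
  \<beta>(f). That it is finite comes out in \<open>relative_energy\<close>.\<close>

definition dual_total :: ennreal where
  "dual_total = (\<Sum>k. \<integral>\<^sup>+p. ennreal (dual k p) \<partial>P)"

lemma kinetic_energy_eq: "kinetic_energy \<omega> f ch = (\<Sum>j. \<integral>\<^sup>+p. kinetic_density ch f j p \<partial>P)"
  by (simp add: kinetic_energy_def case_prod_unfold)

lemma V_nonneg': "x \<in> cylinder \<omega> \<Longrightarrow> 0 \<le> V x"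
  using V_nonneg closure_subset[of "cylinder \<omega>"] by blast

lemma A_cm_measurable: "f \<in> A_cm \<omega> \<Longrightarrow> f j \<in> borel_measurable P"
  by (simp add: A_cm_def)

lemma external_energy_mean:
  assumes f: "f \<in> A_cm \<omega>" and ch: "ch \<in> A_qm \<omega>"
  shows "external_energy \<omega> V f ch = (\<Sum>j. \<integral>\<^sup>+p. mean_density V ch f j p \<partial>P)"
  by (rule external_energy_eq[OF \<omega> V_measurable]) (rule V_nonneg' A_qm_D(1)[OF ch] A_cm_measurable[OF f], assumption?)+

lemma densities_measurable:
  assumes f: "f \<in> A_cm \<omega>" and ch: "ch \<in> A_qm \<omega>"
  shows "(\<lambda>p. ennreal (f j p)) \<in> borel_measurable P"
    and "W \<in> borel_measurable Q \<Longrightarrow> mean_density W ch f j \<in> borel_measurable P"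
    and "(\<lambda>p. ennreal (\<beta> (f j p))) \<in> borel_measurable P"
proof -
  show 1: "(\<lambda>p. ennreal (f j p)) \<in> borel_measurable P"
    using A_cm_measurable[OF f, of j] by measurable
  show "(\<lambda>p. ennreal (\<beta> (f j p))) \<in> borel_measurable P"
    using beta_measurable[OF A_cm_measurable[OF f] A_cm_range[OF f]] by measurable
  show "mean_density W ch f j \<in> borel_measurable P" if W: "W \<in> borel_measurable Q"
    by (rule borel_measurable_times_ennreal[OF measurable_Times_fst[OF \<omega> UNIV_borel
          transverse_mean_measurable[OF \<omega> W A_qm_D(1)[OF ch]]] 1])
qed

text \<open>Exchanging the sums over j and k leaves, for each k, the overlaps summed over j, which
  are at most 1.\<close>

lemma overlap_dual_total:
  assumes ch: "ch \<in> A_qm \<omega>"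
  shows "(\<Sum>j. \<integral>\<^sup>+p. (\<Sum>k. ennreal (overlap ch j k (fst p)) * ennreal (dual k p)) \<partial>P) \<le> dual_total"
proof -
  have [measurable]: "(\<lambda>p. ennreal (overlap ch j k (fst p))) \<in> borel_measurable P"
    "(\<lambda>p. ennreal (dual k p)) \<in> borel_measurable P" for j k
    using overlap_measurable[OF ch] dual_measurable[of k] by measurable
  have "(\<Sum>j. \<integral>\<^sup>+p. (\<Sum>k. ennreal (overlap ch j k (fst p)) * ennreal (dual k p)) \<partial>P)
      = (\<integral>\<^sup>+p. (\<Sum>j. \<Sum>k. ennreal (overlap ch j k (fst p)) * ennreal (dual k p)) \<partial>P)"
    by (rule nn_integral_suminf[symmetric]) measurable
  also have "\<dots> \<le> (\<integral>\<^sup>+p. (\<Sum>k. ennreal (dual k p)) \<partial>P)"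
  proof (rule nn_integral_mono)
    fix p assume "p \<in> space P"
    then have y: "fst p \<in> \<omega>" by (cases p) auto
    have "(\<Sum>j. ennreal (overlap ch j k (fst p))) \<le> 1" for k
    proof (rule suminf_le_const[OF summableI])
      fix n
      have "(\<Sum>j<n. ennreal (overlap ch j k (fst p))) = ennreal (\<Sum>j<n. overlap ch j k (fst p))"
        by (rule sum_ennreal) (simp add: overlap_def)
      also have "\<dots> \<le> ennreal 1" by (rule ennreal_leI[OF overlap_sum_le(2)[OF ch y]])
      finally show "(\<Sum>j<n. ennreal (overlap ch j k (fst p))) \<le> 1" by simp
    qed
    then have "(\<Sum>j. ennreal (overlap ch j k (fst p)) * ennreal (dual k p)) \<le> ennreal (dual k p)" for k
      using mult_right_mono[of "\<Sum>j. ennreal (overlap ch j k (fst p))" 1 "ennreal (dual k p)"] by simp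
    then show "(\<Sum>j. \<Sum>k. ennreal (overlap ch j k (fst p)) * ennreal (dual k p)) \<le> (\<Sum>k. ennreal (dual k p))"
      unfolding suminf_swap_ennreal[of "\<lambda>j k. ennreal (overlap ch j k (fst p)) * ennreal (dual k p)"]
      by (intro suminf_le) auto
  qed
  also have "\<dots> = dual_total" unfolding dual_total_def by (rule nn_integral_suminf) measurable
  finally show ?thesis .
qed

text \<open>The kinetic density, possibly nonmeasurable, stands on the larger side, so the integral
  of the sum has to be bounded from above; \<open>nn_integral_add_le\<close> does this, the
  remaining terms being measurable.\<close>

lemma state_bound:
  assumes f: "f \<in> A_cm \<omega>" and ch: "ch \<in> A_qm \<omega>"
  shows "ennreal \<mu> * mass \<omega> f + (\<Sum>j. \<integral>\<^sup>+p. mean_density U_minus ch f j p \<partial>P)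
    \<le> kinetic_energy \<omega> f ch + (external_energy \<omega> V f ch + (\<Sum>j. \<integral>\<^sup>+p. mean_density U_plus ch f j p \<partial>P)
      + ennreal T * casimir \<omega> \<beta> f + dual_total)"
proof -
  note m = densities_measurable[OF f ch]
  let ?h = "\<lambda>j p. \<Sum>k. ennreal (overlap ch j k (fst p)) * ennreal (dual k p)"
  have h: "?h j \<in> borel_measurable P" for j
    using overlap_measurable[OF ch, of j] dual_measurable by measurable
  note v = m(2)[OF V_measurable] and up = m(2)[OF U_measurable(2)] and um = m(2)[OF U_measurable(3)]
  have each: "ennreal \<mu> * (\<integral>\<^sup>+p. ennreal (f j p) \<partial>P) + (\<integral>\<^sup>+p. mean_density U_minus ch f j p \<partial>P)
      \<le> (\<integral>\<^sup>+p. kinetic_density ch f j p \<partial>P) + ((\<integral>\<^sup>+p. mean_density V ch f j p \<partial>P)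
        + (\<integral>\<^sup>+p. mean_density U_plus ch f j p \<partial>P) + ennreal T * (\<integral>\<^sup>+p. ennreal (\<beta> (f j p)) \<partial>P)
        + (\<integral>\<^sup>+p. ?h j p \<partial>P))" (is "?l \<le> ?k + ?r") for j
  proof -
    let ?R = "\<lambda>p. mean_density V ch f j p + mean_density U_plus ch f j p + ennreal T * ennreal (\<beta> (f j p)) + ?h j p"
    have "?l = (\<integral>\<^sup>+p. ennreal \<mu> * ennreal (f j p) + mean_density U_minus ch f j p \<partial>P)"
      using m(1) um by (simp add: nn_integral_add nn_integral_cmult)
    also have "\<dots> \<le> (\<integral>\<^sup>+p. kinetic_density ch f j p + ?R p \<partial>P)"
      by (rule nn_integral_mono_AE[OF state_pointwise[OF f ch]])
    also have "\<dots> \<le> ?k + (\<integral>\<^sup>+p. ?R p \<partial>P)"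
      by (rule nn_integral_add_le) (use v up m(3) h in measurable)
    also have "(\<integral>\<^sup>+p. ?R p \<partial>P) = ?r"
      using v up m(3) h by (simp add: nn_integral_add nn_integral_cmult)
    finally show ?thesis .
  qed
  have "ennreal \<mu> * mass \<omega> f + (\<Sum>j. \<integral>\<^sup>+p. mean_density U_minus ch f j p \<partial>P)
      = (\<Sum>j. ennreal \<mu> * (\<integral>\<^sup>+p. ennreal (f j p) \<partial>P) + (\<integral>\<^sup>+p. mean_density U_minus ch f j p \<partial>P))"
    by (simp add: mass_def suminf_add[OF summableI summableI, symmetric])
  also have "\<dots> \<le> (\<Sum>j. (\<integral>\<^sup>+p. kinetic_density ch f j p \<partial>P) + ((\<integral>\<^sup>+p. mean_density V ch f j p \<partial>P)
        + (\<integral>\<^sup>+p. mean_density U_plus ch f j p \<partial>P) + ennreal T * (\<integral>\<^sup>+p. ennreal (\<beta> (f j p)) \<partial>P)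
        + (\<integral>\<^sup>+p. ?h j p \<partial>P)))"
    by (rule suminf_le[OF each summableI summableI])
  also have "\<dots> = kinetic_energy \<omega> f ch + (external_energy \<omega> V f ch + (\<Sum>j. \<integral>\<^sup>+p. mean_density U_plus ch f j p \<partial>P)
      + ennreal T * casimir \<omega> \<beta> f + (\<Sum>j. \<integral>\<^sup>+p. ?h j p \<partial>P))"
    unfolding kinetic_energy_eq casimir_def
      external_energy_mean[OF f ch]
    by (simp add: suminf_add[OF summableI summableI, symmetric])
  also have "\<dots> \<le> kinetic_energy \<omega> f ch + (external_energy \<omega> V f ch + (\<Sum>j. \<integral>\<^sup>+p. mean_density U_plus ch f j p \<partial>P)
      + ennreal T * casimir \<omega> \<beta> f + dual_total)"
    by (intro add_left_mono overlap_dual_total[OF ch])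
  finally show ?thesis .
qed

text \<open>Here the kinetic density stands on the smaller side, and superadditivity of the lower
  integral has the right direction. With \<open>state_bound\<close> this encloses
  \<open>dual_total\<close> between equilibrium and competitor.\<close>

lemma equilibrium_bound:
  "dual_total + (kinetic_energy \<omega> fs chs + (external_energy \<omega> V fs chs
      + ((\<Sum>j. \<integral>\<^sup>+p. mean_density U_plus chs fs j p \<partial>P) + ennreal T * casimir \<omega> \<beta> fs)))
    \<le> ennreal \<mu> * mass \<omega> fs + (\<Sum>j. \<integral>\<^sup>+p. mean_density U_minus chs fs j p \<partial>P)"
proof -
  note m = densities_measurable[OF fs chs]
  note um = m(2)[OF U_measurable(3)]
  have each: "(\<integral>\<^sup>+p. ennreal (dual j p) \<partial>P) + ((\<integral>\<^sup>+p. kinetic_density chs fs j p \<partial>P) + ((\<integral>\<^sup>+p. mean_density V chs fs j p \<partial>P)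
        + ((\<integral>\<^sup>+p. mean_density U_plus chs fs j p \<partial>P) + ennreal T * (\<integral>\<^sup>+p. ennreal (\<beta> (fs j p)) \<partial>P))))
      \<le> ennreal \<mu> * (\<integral>\<^sup>+p. ennreal (fs j p) \<partial>P) + (\<integral>\<^sup>+p. mean_density U_minus chs fs j p \<partial>P)" (is "?l \<le> ?r") for j
  proof -
    have "?l = (\<integral>\<^sup>+p. ennreal (dual j p) \<partial>P) + ((\<integral>\<^sup>+p. kinetic_density chs fs j p \<partial>P) + ((\<integral>\<^sup>+p. mean_density V chs fs j p \<partial>P)
        + ((\<integral>\<^sup>+p. mean_density U_plus chs fs j p \<partial>P) + (\<integral>\<^sup>+p. ennreal T * ennreal (\<beta> (fs j p)) \<partial>P))))"
      using m(3) by (simp add: nn_integral_cmult)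
    also have "\<dots> \<le> (\<integral>\<^sup>+p. ennreal (dual j p) + (kinetic_density chs fs j p + (mean_density V chs fs j p
      + (mean_density U_plus chs fs j p + ennreal T * ennreal (\<beta> (fs j p))))) \<partial>P)"
      by (rule order_trans[OF add_left_mono[OF order_trans[OF add_left_mono[OF order_trans[OF add_left_mono[OF
        nn_integral_superadditive] nn_integral_superadditive]] nn_integral_superadditive]] nn_integral_superadditive])
    also have "\<dots> = (\<integral>\<^sup>+p. ennreal \<mu> * ennreal (fs j p) + mean_density U_minus chs fs j p \<partial>P)"
      by (rule nn_integral_cong_AE[OF equilibrium_pointwise])
    also have "\<dots> = ?r" using m(1) um by (simp add: nn_integral_add nn_integral_cmult)
    finally show ?thesis .
  qed
  have "dual_total + (kinetic_energy \<omega> fs chs + (external_energy \<omega> V fs chs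
      + ((\<Sum>j. \<integral>\<^sup>+p. mean_density U_plus chs fs j p \<partial>P) + ennreal T * casimir \<omega> \<beta> fs)))
    = (\<Sum>j. (\<integral>\<^sup>+p. ennreal (dual j p) \<partial>P) + ((\<integral>\<^sup>+p. kinetic_density chs fs j p \<partial>P) + ((\<integral>\<^sup>+p. mean_density V chs fs j p \<partial>P)
        + ((\<integral>\<^sup>+p. mean_density U_plus chs fs j p \<partial>P) + ennreal T * (\<integral>\<^sup>+p. ennreal (\<beta> (fs j p)) \<partial>P)))))"
    unfolding kinetic_energy_eq casimir_def dual_total_def
      external_energy_mean[OF fs chs]
    by (simp add: suminf_add[OF summableI summableI, symmetric])
  also have "\<dots> \<le> (\<Sum>j. ennreal \<mu> * (\<integral>\<^sup>+p. ennreal (fs j p) \<partial>P) + (\<integral>\<^sup>+p. mean_density U_minus chs fs j p \<partial>P))"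
    by (rule suminf_le[OF each summableI summableI])
  also have "\<dots> = ennreal \<mu> * mass \<omega> fs + (\<Sum>j. \<integral>\<^sup>+p. mean_density U_minus chs fs j p \<partial>P)"
    by (simp add: mass_def suminf_add[OF summableI summableI, symmetric])
  finally show ?thesis .
qed

text \<open>The integrability hypothesis is met because U is a test function in the Poisson equation
  of the state. It makes both sums finite, so they can be subtracted.\<close>

lemma density_potential_integral:
  assumes f: "f \<in> A_cm \<omega>" and ch: "ch \<in> A_qm \<omega>"
    and int: "integrable Q (\<lambda>x. particle_density f ch x * U x)"
  obtains a b where "(\<Sum>j. \<integral>\<^sup>+p. mean_density U_plus ch f j p \<partial>P) = ennreal a" "0 \<le> a"
    "(\<Sum>j. \<integral>\<^sup>+p. mean_density U_minus ch f j p \<partial>P) = ennreal b" "0 \<le> b"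
    "(\<integral>x. particle_density f ch x * U x \<partial>Q) = a - b"
proof -
  let ?r = "particle_density f ch"
  have n: "0 \<le> U_plus x" "0 \<le> U_minus x" for x by (simp_all add: U_plus_def U_minus_def)
  have "AE x in Q. ennreal (?r x * U_plus x) = ennreal (?r x * U x)"
    "AE x in Q. ennreal (?r x * U_minus x) = ennreal (- (?r x * U x))"
    using particle_density_AE[OF \<omega> f ch]
    by (eventually_elim, auto simp: U_plus_def U_minus_def max_def ennreal_neg mult_nonneg_nonpos)+
  then have eq: "(\<Sum>j. \<integral>\<^sup>+p. mean_density U_plus ch f j p \<partial>P) = (\<integral>\<^sup>+x. ennreal (?r x * U x) \<partial>Q)"
    "(\<Sum>j. \<integral>\<^sup>+p. mean_density U_minus ch f j p \<partial>P) = (\<integral>\<^sup>+x. ennreal (- (?r x * U x)) \<partial>Q)"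
    unfolding density_integral_eq[OF \<omega> f ch U_measurable(2) n(1), symmetric]
      density_integral_eq[OF \<omega> f ch U_measurable(3) n(2), symmetric]
    by (auto intro!: nn_integral_cong_AE)
  let ?a = "enn2real (\<integral>\<^sup>+x. ennreal (?r x * U x) \<partial>Q)" and ?b = "enn2real (\<integral>\<^sup>+x. ennreal (- (?r x * U x)) \<partial>Q)"
  have fin: "(\<integral>\<^sup>+x. ennreal (?r x * U x) \<partial>Q) \<noteq> \<infinity>" "(\<integral>\<^sup>+x. ennreal (- (?r x * U x)) \<partial>Q) \<noteq> \<infinity>"
    using int unfolding real_integrable_def by blast+
  show ?thesis
  proof (rule that[of ?a ?b])
    show "(\<integral>x. ?r x * U x \<partial>Q) = ?a - ?b" by (rule real_lebesgue_integral_def[OF int])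
    have "ennreal (enn2real r) = r" if "r \<noteq> \<infinity>" for r :: ennreal
      using that by (cases r) simp_all
    from this[OF fin(1)] this[OF fin(2)]
    show "(\<Sum>j. \<integral>\<^sup>+p. mean_density U_plus ch f j p \<partial>P) = ennreal ?a"
      "(\<Sum>j. \<integral>\<^sup>+p. mean_density U_minus ch f j p \<partial>P) = ennreal ?b" by (simp_all only: eq)
  qed (rule enn2real_nonneg)+
qed

end

section \<open>Weak gradients and the field energy\<close>

lemma weak_grad_inner:
  "i \<in> Basis \<Longrightarrow> weak_grad S u x \<bullet> i = weak_partial S i u x"
  by (simp add: weak_grad_def inner_sum_left_Basis)

lemma weak_grad_L2:
  assumes "open S" "u \<in> H1 S"
  shows "weak_grad S u \<in> L2 S"
proof -
  note w = H1_weak_partial(2)[OF assms]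
  have m: "weak_partial S i u \<in> borel_measurable (lebesgue_on S)" if "i \<in> Basis" for i
    by (rule L2_measurable[OF w[OF that]])
  have "(\<lambda>x. \<Sum>i\<in>Basis. weak_partial S i u x *\<^sub>R i) \<in> borel_measurable (lebesgue_on S)"
    by (rule borel_measurable_sum, rule borel_measurable_scaleR[OF m]) simp_all
  then have "weak_grad S u \<in> borel_measurable (lebesgue_on S)" by (simp add: weak_grad_def[abs_def])
  moreover have "(norm (weak_grad S u x))\<^sup>2 = (\<Sum>i\<in>Basis. (norm (weak_partial S i u x))\<^sup>2)" for x
    unfolding power2_norm_eq_inner euclidean_inner[of "weak_grad S u x" "weak_grad S u x"]
    by (intro sum.cong) (simp_all add: weak_grad_inner power2_eq_square)
  then have "integrable (lebesgue_on S) (\<lambda>x. (norm (weak_grad S u x))\<^sup>2)"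
    using w by (simp add: L2_iff)
  ultimately show ?thesis by (simp add: L2_iff)
qed

lemma weak_grad_diff_AE:
  assumes "open S" "u \<in> H1 S" "w \<in> H1 S"
  shows "AE x in lebesgue_on S. weak_grad S (\<lambda>x. u x - w x) x = weak_grad S u x - weak_grad S w x"
proof -
  have "AE x in lebesgue_on S. \<forall>i\<in>Basis.
      weak_partial S i (\<lambda>x. u x - w x) x = weak_partial S i u x - weak_partial S i w x"
    by (rule AE_finite_allI[OF finite_Basis]) (rule weak_partial_diff_AE[OF assms])
  then show ?thesis
    by eventually_elim (simp add: weak_grad_def scaleR_diff_left sum_subtractf)
qed

lemma L2_normsq_diff:
  fixes g h :: "'a::euclidean_space \<Rightarrow> 'b::euclidean_space"
  assumes g: "g \<in> L2 S" and h: "h \<in> L2 S"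
  shows "L2_normsq S (\<lambda>x. g x - h x) = ennreal ((\<integral>x. (norm (g x))\<^sup>2 \<partial>lebesgue_on S)
    - 2 * (\<integral>x. g x \<bullet> h x \<partial>lebesgue_on S) + (\<integral>x. (norm (h x))\<^sup>2 \<partial>lebesgue_on S))"
proof -
  have m: "g \<in> borel_measurable (lebesgue_on S)" "h \<in> borel_measurable (lebesgue_on S)"
    using g h by (simp_all add: L2_iff)
  have i: "integrable (lebesgue_on S) (\<lambda>x. (norm (g x))\<^sup>2)" "integrable (lebesgue_on S) (\<lambda>x. (norm (h x))\<^sup>2)"
    using g h by (simp_all add: L2_iff)
  have gh: "integrable (lebesgue_on S) (\<lambda>x. g x \<bullet> h x)"
  proof (rule Bochner_Integration.integrable_bound[OF Bochner_Integration.integrable_add[OF i]])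
    show "(\<lambda>x. g x \<bullet> h x) \<in> borel_measurable (lebesgue_on S)" using m by measurable
    have le: "\<bar>a \<bullet> b\<bar> \<le> (norm a)\<^sup>2 + (norm b)\<^sup>2" for a b :: 'b
    proof -
      have "\<bar>a \<bullet> b\<bar> \<le> norm a * norm b" by (rule Cauchy_Schwarz_ineq2)
      moreover have "2 * (norm a * norm b) \<le> (norm a)\<^sup>2 + (norm b)\<^sup>2"
        using sum_squares_bound[of "norm a" "norm b"] by (simp add: mult.assoc)
      ultimately show ?thesis using mult_nonneg_nonneg[OF norm_ge_zero norm_ge_zero, of a b] by linarith
    qed
    have "norm (g x \<bullet> h x) \<le> norm ((norm (g x))\<^sup>2 + (norm (h x))\<^sup>2)" for x
      using le[of "g x" "h x"] by simp
    then show "AE x in lebesgue_on S. norm (g x \<bullet> h x) \<le> norm ((norm (g x))\<^sup>2 + (norm (h x))\<^sup>2)"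
      by (rule AE_I2)
  qed
  have eq: "(norm (g x - h x))\<^sup>2 = (norm (g x))\<^sup>2 - 2 * (g x \<bullet> h x) + (norm (h x))\<^sup>2" for x
    unfolding power2_norm_eq_inner by (simp add: inner_diff_left inner_diff_right inner_commute)
  have int: "integrable (lebesgue_on S) (\<lambda>x. (norm (g x))\<^sup>2 - 2 * (g x \<bullet> h x) + (norm (h x))\<^sup>2)"
    using i gh by simp
  have "L2_normsq S (\<lambda>x. g x - h x) = ennreal (\<integral>x. (norm (g x))\<^sup>2 - 2 * (g x \<bullet> h x) + (norm (h x))\<^sup>2 \<partial>lebesgue_on S)"
    unfolding L2_normsq_def eq by (rule nn_integral_eq_integral[OF int]) (simp flip: eq)
  then show ?thesis using i gh by simp
qed

lemma finite_field_energy: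
  assumes "field_energy \<omega> f ch < \<infinity>"
  shows "poisson_solution \<omega> (particle_density f ch) (potential \<omega> (particle_density f ch))"
    and "field_energy \<omega> f ch = L2_normsq (cylinder \<omega>)
      (weak_grad (cylinder \<omega>) (potential \<omega> (particle_density f ch))) / 2"
proof -
  have ex: "\<exists>U. poisson_solution \<omega> (particle_density f ch) U"
    using assms by (auto simp: field_energy_def split: if_splits)
  show "poisson_solution \<omega> (particle_density f ch) (potential \<omega> (particle_density f ch))"
    unfolding potential_def using ex by (rule someI_ex)
  show "field_energy \<omega> f ch = L2_normsq (cylinder \<omega>)
      (weak_grad (cylinder \<omega>) (potential \<omega> (particle_density f ch))) / 2"
    using ex by (simp add: field_energy_def)
qed

text \<open>Testing both Poisson equations with U turns the cross term and the equilibrium field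
  energy into integrals of U against the two densities. These are the U-terms of
  \<open>state_bound\<close> and \<open>equilibrium_bound\<close>; adding the two bounds and
  cancelling \<open>dual_total\<close> gives the claim.\<close>

lemma (in equilibrium) relative_energy:
  assumes U_eq: "U = potential \<omega> (particle_density fs chs)"
    and f: "f \<in> A_cm \<omega>" and ch: "ch \<in> A_qm \<omega>"
    and fin: "free_energy \<omega> V T \<beta> f ch < \<infinity>" "free_energy \<omega> V T \<beta> fs chs < \<infinity>"
  shows "L2_normsq (cylinder \<omega>) (weak_grad (cylinder \<omega>) (\<lambda>x. potential \<omega> (particle_density f ch) x - U x))
    \<le> ennreal (2 * (enn2real (free_energy \<omega> V T \<beta> f ch) - enn2real (free_energy \<omega> V T \<beta> fs chs))
        + 2 * \<mu> * (enn2real (mass \<omega> fs) - enn2real (mass \<omega> f)))"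
proof -
  let ?U = "potential \<omega> (particle_density f ch)" and ?C = "cylinder \<omega>"
  have oC: "open ?C" using open_\<omega> by (intro open_Times) auto
  define g where "g = weak_grad ?C ?U"
  define h where "h = weak_grad ?C U"
  have comp: "kinetic_energy \<omega> f' ch' < \<infinity>" "external_energy \<omega> V f' ch' < \<infinity>" "field_energy \<omega> f' ch' < \<infinity>"
    "ennreal T * casimir \<omega> \<beta> f' < \<infinity>"
    if "free_energy \<omega> V T \<beta> f' ch' < \<infinity>" for f' ch'
    using that unfolding free_energy_def energy_def by (auto simp: ennreal_add_less_top)
  note c = comp[OF fin(1)] and cs = comp[OF fin(2)]
  note fe = finite_field_energy[OF c(3)] and fes = finite_field_energy[OF cs(3), folded U_eq]
  have H: "?U \<in> H1 ?C" "U \<in> H1 ?C" and Hl: "U \<in> H1_lateral \<omega>"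
    using fe(1) fes(1) by (auto simp: poisson_solution_def H1_lateral_def H1_closure_def)
  have gL: "g \<in> L2 ?C" and hL: "h \<in> L2 ?C" unfolding g_def h_def by (rule weak_grad_L2[OF oC H(1)], rule weak_grad_L2[OF oC H(2)])
  let ?N = "\<integral>x. (norm (g x))\<^sup>2 \<partial>Q" and ?Ns = "\<integral>x. (norm (h x))\<^sup>2 \<partial>Q" and ?c = "\<integral>x. g x \<bullet> h x \<partial>Q"
  have N0: "0 \<le> ?N" "0 \<le> ?Ns" by (auto intro!: Bochner_Integration.integral_nonneg)
  have p: "integrable Q (\<lambda>x. particle_density f ch x * U x)" "?c = (\<integral>x. particle_density f ch x * U x \<partial>Q)"
    using fe(1) Hl unfolding poisson_solution_def g_def h_def by blast+
  have ps: "integrable Q (\<lambda>x. particle_density fs chs x * U x)" "?Ns = (\<integral>x. particle_density fs chs x * U x \<partial>Q)"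
    using fes(1) Hl unfolding poisson_solution_def h_def power2_norm_eq_inner by blast+
  obtain a b where ab: "(\<Sum>j. \<integral>\<^sup>+p. mean_density U_plus ch f j p \<partial>P) = ennreal a" "0 \<le> a"
    "(\<Sum>j. \<integral>\<^sup>+p. mean_density U_minus ch f j p \<partial>P) = ennreal b" "0 \<le> b"
    "(\<integral>x. particle_density f ch x * U x \<partial>Q) = a - b"
    by (rule density_potential_integral[OF f ch p(1)])
  obtain as bs where abs: "(\<Sum>j. \<integral>\<^sup>+p. mean_density U_plus chs fs j p \<partial>P) = ennreal as" "0 \<le> as"
    "(\<Sum>j. \<integral>\<^sup>+p. mean_density U_minus chs fs j p \<partial>P) = ennreal bs" "0 \<le> bs"
    "(\<integral>x. particle_density fs chs x * U x \<partial>Q) = as - bs"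
    by (rule density_potential_integral[OF fs chs ps(1)])
  have real: "\<exists>r\<ge>0. x = ennreal r" if "x < \<infinity>" for x :: ennreal
    using that by (cases x) auto
  obtain k e q where keq: "kinetic_energy \<omega> f ch = ennreal k" "0 \<le> k" "external_energy \<omega> V f ch = ennreal e" "0 \<le> e"
    "ennreal T * casimir \<omega> \<beta> f = ennreal q" "0 \<le> q"
    using real[OF c(1)] real[OF c(2)] real[OF c(4)] by blast
  obtain ks es qs where keqs: "kinetic_energy \<omega> fs chs = ennreal ks" "0 \<le> ks" "external_energy \<omega> V fs chs = ennreal es" "0 \<le> es"
    "ennreal T * casimir \<omega> \<beta> fs = ennreal qs" "0 \<le> qs"
    using real[OF cs(1)] real[OF cs(2)] real[OF cs(4)] by blast
  obtain m ms where ms: "mass \<omega> f = ennreal m" "0 \<le> m" "mass \<omega> fs = ennreal ms" "0 \<le> ms"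
    using real[of "mass \<omega> f"] real[of "mass \<omega> fs"] f fs by (auto simp: A_cm_def)
  have Sb: "dual_total + ennreal (ks + (es + (as + qs))) \<le> ennreal (\<mu> * ms + bs)"
    using equilibrium_bound keqs abs(1-4) ms \<mu> by (simp add: ennreal_mult)
  \<comment> \<open>The right-hand side of \<open>equilibrium_bound\<close> is finite, so
    \<open>dual_total\<close> is finite and can be cancelled.\<close>
  have "dual_total \<le> dual_total + ennreal (ks + (es + (as + qs)))" by (rule add_increasing2) simp_all
  also note Sb
  also have "ennreal (\<mu> * ms + bs) < \<infinity>" by simp
  finally have "dual_total < \<infinity>" .
  then obtain d where d: "dual_total = ennreal d" "0 \<le> d" using real by blast
  have S: "d + (ks + (es + (as + qs))) \<le> \<mu> * ms + bs"
  proof -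
    have "ennreal (d + (ks + (es + (as + qs)))) \<le> ennreal (\<mu> * ms + bs)"
      using Sb d keqs abs(2) by (simp add: ennreal_plus)
    then show ?thesis using \<mu> ms(4) abs(4) by (subst (asm) ennreal_le_iff) auto
  qed
  have G: "\<mu> * m + b \<le> k + (e + a + q + d)"
  proof -
    have "ennreal (\<mu> * m + b) \<le> ennreal (k + (e + a + q + d))"
      using state_bound[OF f ch] keq ab(1-4) ms d \<mu> by (simp add: ennreal_mult ennreal_plus)
    then show ?thesis using keq ab(2) d(2) by (subst (asm) ennreal_le_iff) auto
  qed
  have half: "ennreal r / 2 = ennreal (r / 2)" if "0 \<le> r" for r
    using that by (simp add: divide_ennreal flip: ennreal_numeral)
  have "free_energy \<omega> V T \<beta> f ch = ennreal (k + e + ?N / 2 + q)"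
    unfolding free_energy_def energy_def fe(2) g_def[symmetric] L2_normsq_eq[OF gL] half[OF N0(1)] keq(1,3,5)
    using keq N0 by (simp add: ennreal_plus)
  then have F: "enn2real (free_energy \<omega> V T \<beta> f ch) = k + e + ?N / 2 + q"
    using keq N0 by (simp del: ennreal_plus)
  have "free_energy \<omega> V T \<beta> fs chs = ennreal (ks + es + ?Ns / 2 + qs)"
    unfolding free_energy_def energy_def fes(2) h_def[symmetric] L2_normsq_eq[OF hL] half[OF N0(2)] keqs(1,3,5)
    using keqs N0 by (simp add: ennreal_plus)
  then have Fs: "enn2real (free_energy \<omega> V T \<beta> fs chs) = ks + es + ?Ns / 2 + qs"
    using keqs N0 by (simp del: ennreal_plus)
  have "L2_normsq ?C (weak_grad ?C (\<lambda>x. ?U x - U x)) = L2_normsq ?C (\<lambda>x. g x - h x)"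
    unfolding L2_normsq_def g_def h_def
    using weak_grad_diff_AE[OF oC H] by (intro nn_integral_cong_AE) auto
  also have "\<dots> = ennreal (?N - 2 * ?c + ?Ns)" by (rule L2_normsq_diff[OF gL hL])
  also have "\<dots> \<le> ennreal (2 * (enn2real (free_energy \<omega> V T \<beta> f ch) - enn2real (free_energy \<omega> V T \<beta> fs chs))
        + 2 * \<mu> * (enn2real (mass \<omega> fs) - enn2real (mass \<omega> f)))"
    unfolding F Fs ms(1,3) using G S p(2) ps(2) ab(5) abs(5) ms
    by (intro ennreal_leI) (simp add: algebra_simps)
  finally show ?thesis .
qed

text \<open>In \<open>ereal\<close> the difference of two infinities is \<infinity>, so a real bound
  on the difference forces both arguments to be finite. This is where the finiteness of the free
  energies comes from.\<close>

lemma enn2ereal_diff_le: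
  fixes a b :: ennreal
  assumes "\<bar>enn2ereal a - enn2ereal b\<bar> \<le> ereal \<delta>"
  shows "a < \<infinity>" "b < \<infinity>" "\<bar>enn2real a - enn2real b\<bar> \<le> \<delta>"
proof -
  have "a \<noteq> \<infinity>" "b \<noteq> \<infinity>"
    using assms by (cases a; cases b; auto simp: enn2ereal_ennreal)+
  then obtain x y where "a = ennreal x" "0 \<le> x" "b = ennreal y" "0 \<le> y"
    by (cases a; cases b) auto
  with assms show "a < \<infinity>" "b < \<infinity>" "\<bar>enn2real a - enn2real b\<bar> \<le> \<delta>"
    by (simp_all add: enn2ereal_ennreal)
qed

section \<open>Stability\<close>

theorem theorem1p7:
  fixes \<omega> :: "(real^2) set"
    and V :: "(real^2) \<times> real \<Rightarrow> real"
    and \<beta> :: "real \<Rightarrow> real"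
    and T M \<mu> :: real
    and fs :: "nat \<Rightarrow> (real^2) \<times> (real^2) \<Rightarrow> real"
    and chs :: "nat \<Rightarrow> (real^2) \<times> real \<Rightarrow> complex"
    and lam :: "nat \<Rightarrow> real^2 \<Rightarrow> real"
  defines "Us \<equiv> potential \<omega> (particle_density fs chs)"
  assumes "smooth_bounded_domain \<omega>"
    and "continuous_on (closure (cylinder \<omega>)) V"
    and "Ck_on 1 (cylinder \<omega>) V"
    and "\<forall>x\<in>closure (cylinder \<omega>). 0 \<le> V x"
    and "entropy_generator \<beta>"
    and "M > 0" and "T \<ge> 0"
    and "is_minimizer \<omega> V T \<beta> M fs chs"
    and "\<mu> > 0"
    and "\<forall>j. AE (y, v) in lebesgue_on (\<omega> \<times> UNIV).
           fs j (y, v) = beta_tilde T \<beta> (\<mu> - (norm v)\<^sup>2 / 2 - lam j y)"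
    and "AE y in lebesgue_on \<omega>. eigenvalues (\<lambda>z. Us (y, z) + V (y, z)) (\<lambda>j. lam j y)"
    and "\<forall>j. AE y in lebesgue_on \<omega>.
           schroedinger_eq (\<lambda>z. Us (y, z) + V (y, z)) (lam j y) (\<lambda>z. chs j (y, z))"
  shows "\<forall>\<epsilon>>0. \<exists>\<delta>>0. \<forall>f0 ch0 f ch.
           f0 \<in> A_cm \<omega> \<and> ch0 \<in> A_qm \<omega> \<and>
           \<bar>enn2ereal (mass \<omega> f0) - ereal M\<bar> \<le> ereal \<delta> \<and>
           \<bar>enn2ereal (free_energy \<omega> V T \<beta> f0 ch0) - enn2ereal (free_energy \<omega> V T \<beta> fs chs)\<bar>
             \<le> ereal \<delta> \<and>
           unique_VSP_solution \<omega> V f0 ch0 f ch \<and>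
           (\<forall>t. mass \<omega> (f t) = mass \<omega> f0) \<and>
           (\<forall>t. free_energy \<omega> V T \<beta> (f t) (ch t) = free_energy \<omega> V T \<beta> f0 ch0)
           \<longrightarrow> (SUP t. L2_normsq (cylinder \<omega>)
                 (weak_grad (cylinder \<omega>)
                   (\<lambda>x. potential \<omega> (particle_density (f t) (ch t)) x - Us x))) \<le> ennreal \<epsilon>"
proof (intro allI impI)
  fix \<epsilon> :: real assume \<epsilon>: "\<epsilon> > 0"
  define \<delta> where "\<delta> = \<epsilon> / (2 * (1 + \<mu>))"
  have \<mu>: "\<mu> > 0" and M: "M > 0" by fact+
  have "\<delta> * (2 * (1 + \<mu>)) = \<epsilon>" using \<mu> by (simp add: \<delta>_def)
  then have \<delta>: "\<delta> > 0" "2 * \<delta> + 2 * \<mu> * \<delta> = \<epsilon>"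
    using \<epsilon> \<mu> by (simp add: \<delta>_def, simp add: algebra_simps)
  have "L2_normsq (cylinder \<omega>) (weak_grad (cylinder \<omega>)
      (\<lambda>x. potential \<omega> (particle_density (f t) (ch t)) x - Us x)) \<le> ennreal \<epsilon>"
    if m0: "\<bar>enn2ereal (mass \<omega> f0) - ereal M\<bar> \<le> ereal \<delta>"
      and F0: "\<bar>enn2ereal (free_energy \<omega> V T \<beta> f0 ch0) - enn2ereal (free_energy \<omega> V T \<beta> fs chs)\<bar> \<le> ereal \<delta>"
      and sol: "unique_VSP_solution \<omega> V f0 ch0 f ch"
      and m: "\<forall>t. mass \<omega> (f t) = mass \<omega> f0"
      and F: "\<forall>t. free_energy \<omega> V T \<beta> (f t) (ch t) = free_energy \<omega> V T \<beta> f0 ch0"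
    for f0 ch0 f ch t
  proof -
    note F0' = enn2ereal_diff_le[OF F0]
    have fs: "fs \<in> A_cm \<omega>" "chs \<in> A_qm \<omega>" "mass \<omega> fs = ennreal M"
      using \<open>is_minimizer \<omega> V T \<beta> M fs chs\<close> by (simp_all add: is_minimizer_def)
    have "\<bar>enn2ereal (mass \<omega> f0) - enn2ereal (mass \<omega> fs)\<bar> \<le> ereal \<delta>"
      using m0 M fs(3) by (simp add: enn2ereal_ennreal)
    note m0' = enn2ereal_diff_le(3)[OF this]
    \<comment> \<open>Finite field energy includes solvability of the Poisson equation, so the
      choice in \<open>potential\<close> is a genuine solution and lies in L^2.\<close>
    have "field_energy \<omega> fs chs < \<infinity>"
      using F0'(2) by (auto simp: free_energy_def energy_def ennreal_add_less_top)
    from finite_field_energy(1)[OF this] have "Us \<in> L2 (cylinder \<omega>)"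
      unfolding Us_def by (simp add: poisson_solution_def H1_lateral_def H1_closure_def H1_def)
    then interpret equilibrium \<omega> V \<beta> T \<mu> fs chs lam Us
      using assms(2,3,5,6,8,10-13) fs(1,2)
      by unfold_locales (simp_all add: smooth_bounded_domain_def)
    have ft: "f t \<in> A_cm \<omega>" "ch t \<in> A_qm \<omega>"
      using sol by (simp_all add: unique_VSP_solution_def VSP_solution_def)
    have "free_energy \<omega> V T \<beta> (f t) (ch t) < \<infinity>" using F F0'(1) by simp
    from relative_energy[OF meta_eq_to_obj_eq[OF Us_def] ft this F0'(2)]
    show ?thesis
    proof (rule order_trans, intro ennreal_leI)
      have "\<mu> * (enn2real (mass \<omega> fs) - enn2real (mass \<omega> (f t))) \<le> \<mu> * \<delta>"
        using m0' m \<mu> by (intro mult_left_mono) auto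
      then show "2 * (enn2real (free_energy \<omega> V T \<beta> (f t) (ch t)) - enn2real (free_energy \<omega> V T \<beta> fs chs))
          + 2 * \<mu> * (enn2real (mass \<omega> fs) - enn2real (mass \<omega> (f t))) \<le> \<epsilon>"
        using F0'(3) F \<delta>(2) by (simp add: abs_le_iff)
    qed
  qed
  then show "\<exists>\<delta>>0. \<forall>f0 ch0 f ch.
           f0 \<in> A_cm \<omega> \<and> ch0 \<in> A_qm \<omega> \<and>
           \<bar>enn2ereal (mass \<omega> f0) - ereal M\<bar> \<le> ereal \<delta> \<and>
           \<bar>enn2ereal (free_energy \<omega> V T \<beta> f0 ch0) - enn2ereal (free_energy \<omega> V T \<beta> fs chs)\<bar>
             \<le> ereal \<delta> \<and>
           unique_VSP_solution \<omega> V f0 ch0 f ch \<and>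
           (\<forall>t. mass \<omega> (f t) = mass \<omega> f0) \<and>
           (\<forall>t. free_energy \<omega> V T \<beta> (f t) (ch t) = free_energy \<omega> V T \<beta> f0 ch0)
           \<longrightarrow> (SUP t. L2_normsq (cylinder \<omega>)
                 (weak_grad (cylinder \<omega>)
                   (\<lambda>x. potential \<omega> (particle_density (f t) (ch t)) x - Us x))) \<le> ennreal \<epsilon>"
    using \<delta>(1) by (intro exI[of _ \<delta>] conjI allI impI SUP_least) blast+
qed

end
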